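(* Let $n\ge3$ and $0<\lambda\le\Lambda$. Let $u\in C(\overline{B_1})$ satisfy $\mathcal{M}^-_{\lambda,\Lambda}(D^2u)\le0$ in $B_1\subset\mathbb{R}^n$ in the viscosity sense, let $k$ be the minimal number of nonpositive eigenvalues of $D^2u$ in $B_1$ in the viscosity sense, and assume $1\le k<\frac n2$. Then $u\in W^{2,\alpha}(B_{1/2})$, with universal estimates, for all $$0<\alpha<\frac{\left(1+\left(\frac{n-2k}{n-k}\right)\left(1-\frac{\lambda}{\Lambda}\right)\right)^{n-k}}{\ln n^4}\cdot\left(\frac{\Lambda}{\lambda}\right)^{k-n}.$$ In particular, if $\lambda<\Lambda$ and, for an integer $1\le k<\frac n2$, $$\varepsilon(n,\lambda,\Lambda,k):=\sup_{\gamma\in(0,1)}\frac{\ln(1-c\gamma^n)}{\ln(1-\gamma)},\qquad c:=\max_{1\le i\le k}\left(1+\left(\frac{\Lambda}{\lambda}-1\right)\frac{i}{n-i}\right)^{i-n},$$ then, for fixed $\lambda,\Lambda,k$, $$\lim_{n\to\infty}\frac{\varepsilon(n,\lambda,\Lambda,k)}{\left(\frac{\Lambda}{\lambda}\right)^{k-n}}=+\infty.$$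
   Context: $B_r\subset\mathbb{R}^n$ is the open ball of radius $r$ centered at $0$. For a real symmetric $n\times n$ matrix $M$, $\mathcal{M}^-_{\lambda,\Lambda}(M)=\inf\{\mathrm{trace}(AM): A \text{ symmetric},\ \lambda\,\mathrm{Id}\le A\le\Lambda\,\mathrm{Id}\}$. A continuous $u$ satisfies $\mathcal{M}^-_{\lambda,\Lambda}(D^2u)\le 0$ in $B_1$ in the viscosity sense if whenever $\varphi$ is $C^2$ and $u-\varphi$ has a local minimum at $x_0\in B_1$, then $\mathcal{M}^-_{\lambda,\Lambda}(D^2\varphi(x_0))\le 0$. $D^2u$ has at least $k$ nonpositive eigenvalues in $B_1$ in the viscosity sense if for every $\varphi\in C^2(B_1)$ such that $u-\varphi$ has a local minimum at some $x_0\in B_1$, the matrix $D^2\varphi(x_0)$ has at least $k$ eigenvalues (counted with multiplicity) that are $\le0$. The largest such $k$ is the minimal number of nonpositive eigenvalues of $D^2u$ in the viscosity sense. For $x_0\in B_1$, $\underline\Theta_u(x_0)=\underline\Theta(u,B_1)(x_0)$ is the infimum of all $A>0$ for which there is $y\in\mathbb{R}^n$ with $u(x)\ge u(x_0)+y\cdot(x-x_0)-\frac A2|x-x_0|^2$ for all $x\in B_1$ (and $+\infty$ if there is no such $A$). "$u\in W^{2,\alpha}(B_{1/2})$ with universal estimates" means $\int_{B_{1/2}}\underline\Theta_u^{\,\alpha}\,dx\le C\|u\|_{L^\infty(B_1)}^\alpha$ with $C$ depending only on $n,\lambda,\Lambda,k,\alpha$ (and not on $u$). *)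

theory Defs
  imports
    "HOL-Analysis.Analysis"
    "HOL-Probability.Essential_Supremum"
    "HOL-Computational_Algebra.Polynomial"
begin

definition loewner_le :: "real^'n^'n \<Rightarrow> real^'n^'n \<Rightarrow> bool" where
  "loewner_le A B \<longleftrightarrow> (\<forall>x. x \<bullet> (A *v x) \<le> x \<bullet> (B *v x))"

text \<open>For \<open>0 < lam \<le> Lam\<close> the infimum is over a nonempty family that is bounded below.\<close>

definition pucci_minus :: "real \<Rightarrow> real \<Rightarrow> real^'n^'n \<Rightarrow> real" where
  "pucci_minus lam Lam M =
     (INF A\<in>{A. transpose A = A \<and> loewner_le (mat lam) A \<and> loewner_le A (mat Lam)}. trace (A ** M))"

definition charpoly :: "real^'n^'n \<Rightarrow> real poly" where
  "charpoly M = det (mat [:0, 1:] - (\<chi> i j. [:M $ i $ j:]))"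

text \<open>Eigenvalues are counted with (algebraic) multiplicity: \<^const>\<open>proots\<close> is the multiset of real roots.\<close>

definition num_nonpos_eigenvalues :: "real^'n^'n \<Rightarrow> nat" where
  "num_nonpos_eigenvalues M = size {#t \<in># proots (charpoly M). t \<le> 0#}"

definition grad :: "(real^'n \<Rightarrow> real) \<Rightarrow> real^'n \<Rightarrow> real^'n" where
  "grad \<phi> x = (\<chi> i. frechet_derivative \<phi> (at x) (axis i 1))"

definition hessian :: "(real^'n \<Rightarrow> real) \<Rightarrow> real^'n \<Rightarrow> real^'n^'n" where
  "hessian \<phi> x = jacobian (grad \<phi>) (at x)"

text \<open>Intended for open \<open>S\<close>, since derivatives are taken in the full space.\<close>

definition C2_on :: "(real^'n) set \<Rightarrow> (real^'n \<Rightarrow> real) \<Rightarrow> bool" where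
  "C2_on S \<phi> \<longleftrightarrow> (\<forall>x\<in>S. \<phi> differentiable (at x) \<and> grad \<phi> differentiable (at x))
                \<and> continuous_on S (hessian \<phi>)"

definition local_min_at :: "(real^'n \<Rightarrow> real) \<Rightarrow> real^'n \<Rightarrow> bool" where
  "local_min_at f x0 \<longleftrightarrow> (\<forall>\<^sub>F x in nhds x0. f x0 \<le> f x)"

definition viscosity_pucci_minus_le_0 ::
    "real \<Rightarrow> real \<Rightarrow> (real^'n) set \<Rightarrow> (real^'n \<Rightarrow> real) \<Rightarrow> bool" where
  "viscosity_pucci_minus_le_0 lam Lam S u \<longleftrightarrow>
     (\<forall>\<phi>. \<forall>x0\<in>S. C2_on S \<phi> \<and> local_min_at (\<lambda>x. u x - \<phi> x) x0
        \<longrightarrow> pucci_minus lam Lam (hessian \<phi> x0) \<le> 0)"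

definition viscosity_nonpos_eigenvalues_ge ::
    "(real^'n) set \<Rightarrow> (real^'n \<Rightarrow> real) \<Rightarrow> nat \<Rightarrow> bool" where
  "viscosity_nonpos_eigenvalues_ge S u k \<longleftrightarrow>
     (\<forall>\<phi>. \<forall>x0\<in>S. C2_on S \<phi> \<and> local_min_at (\<lambda>x. u x - \<phi> x) x0
        \<longrightarrow> num_nonpos_eigenvalues (hessian \<phi> x0) \<ge> k)"

definition is_min_num_nonpos_eigenvalues ::
    "(real^'n) set \<Rightarrow> (real^'n \<Rightarrow> real) \<Rightarrow> nat \<Rightarrow> bool" where
  "is_min_num_nonpos_eigenvalues S u k \<longleftrightarrow>
     viscosity_nonpos_eigenvalues_ge S u k \<and>
     (\<forall>j. viscosity_nonpos_eigenvalues_ge S u j \<longrightarrow> j \<le> k)"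

text \<open>\<^term>\<open>Inf {}\<close> is \<^term>\<open>top\<close> in \<^typ>\<open>ennreal\<close>, matching the convention that \<open>\<Theta>\<close> is infinite
  if no paraboloid touches from below.\<close>

definition Theta_lower :: "(real^'n) set \<Rightarrow> (real^'n \<Rightarrow> real) \<Rightarrow> real^'n \<Rightarrow> ennreal" where
  "Theta_lower S u x0 = Inf {ennreal A | A. A > 0 \<and>
     (\<exists>y. \<forall>x\<in>S. u x \<ge> u x0 + y \<bullet> (x - x0) - A / 2 * (norm (x - x0))\<^sup>2)}"

definition ennreal_powr :: "ennreal \<Rightarrow> real \<Rightarrow> ennreal" where
  "ennreal_powr x a = (if x = top then top else ennreal (enn2real x powr a))"

definition Linfty_norm :: "(real^'n) set \<Rightarrow> (real^'n \<Rightarrow> real) \<Rightarrow> ennreal" where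
  "Linfty_norm S u = esssup (restrict_space lborel S) (\<lambda>x. ennreal \<bar>u x\<bar>)"

text \<open>The estimate behind \<open>u \<in> W(2,\<alpha>)\<close> with constant \<open>C\<close>. If \<open>u\<close> is continuous on the closed unit ball,
  then the sublevel sets of \<open>\<Theta>\<close> are relatively closed in the open ball, so the integrand is Borel
  and \<^const>\<open>nn_integral\<close> is the usual integral.\<close>

definition W2_estimate :: "real \<Rightarrow> real \<Rightarrow> (real^'n \<Rightarrow> real) \<Rightarrow> bool" where
  "W2_estimate C \<alpha> u \<longleftrightarrow>
     (\<integral>\<^sup>+x\<in>ball 0 (1/2). ennreal_powr (Theta_lower (ball 0 1) u x) \<alpha> \<partial>lborel)
       \<le> ennreal C * ennreal_powr (Linfty_norm (ball 0 1) u) \<alpha>"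

definition alpha_bound :: "nat \<Rightarrow> real \<Rightarrow> real \<Rightarrow> nat \<Rightarrow> real" where
  "alpha_bound n lam Lam k =
     (1 + (real n - 2 * real k) / (real n - real k) * (1 - lam / Lam)) ^ (n - k) / ln (real n ^ 4)
       * (Lam / lam) powi (int k - int n)"

definition c_const :: "nat \<Rightarrow> real \<Rightarrow> real \<Rightarrow> nat \<Rightarrow> real" where
  "c_const n lam Lam k =
     (MAX i\<in>{1..k}. (1 + (Lam / lam - 1) * (real i / (real n - real i))) powi (int i - int n))"

text \<open>For \<open>1 \<le> k < n / 2\<close> and \<open>0 < lam \<le> Lam\<close> the quotients lie in \<open>[0, 1]\<close>, since
  \<open>0 < c \<le> 1\<close> and hence \<open>c * \<gamma> ^ n \<le> \<gamma>\<close>; so this is a genuine real supremum.\<close>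

definition eps :: "nat \<Rightarrow> real \<Rightarrow> real \<Rightarrow> nat \<Rightarrow> real" where
  "eps n lam Lam k =
     (SUP \<gamma>\<in>{0<..<1}. ln (1 - c_const n lam Lam k * \<gamma> ^ n) / ln (1 - \<gamma>))"

end

theory Submission
  imports Defs "HOL-Probability.Probability"
begin

text \<open>
  Write \<open>A a\<close> for the set of points of the unit ball where a paraboloid of opening \<open>a\<close> touches \<open>u\<close>
  from below on the whole ball, so that \<open>\<Theta> \<le> a\<close> on \<open>A a\<close>. Everything follows from a decay estimate
  for the measure of the complement of \<open>A a\<close> as \<open>a\<close> is multiplied by \<open>n\<close>.

  Let \<open>a < a'\<close> and \<open>\<gamma> = 1 - a/a'\<close>. Through a point \<open>x\<close> outside \<open>A a\<close> draw the paraboloid of opening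
  \<open>a'\<close> that touches the \<open>a\<close>-envelope of \<open>u\<close> there, and slide it until it touches \<open>u\<close>. The vertex map
  \<open>x \<mapsto> \<gamma> x + (1 - \<gamma>) y\<close>, with \<open>y\<close> a subgradient of a convex function, expands lengths at least by
  \<open>\<gamma>\<close>, so the vertices fill a set of measure at least \<open>\<gamma>\<^sup>n |B - A a|\<close>. A supersolution has no convex
  kinks, which forces the new contact points to lie in \<open>A a' - A a\<close>. At such a point the eigenvalues \<open>\<mu>\<close>
  of \<open>I + D\<^sup>2u/a'\<close> satisfy the Pucci inequality and at least \<open>k\<close> of them are at most 1, so weighted AM-GM
  bounds their product by \<open>J = ((\<Lambda>/\<lambda>)/(2 - \<lambda>/\<Lambda>)) ^ (n-k)\<close>. Hence
  \<open>|A a' - A a| \<ge> J\<^sup>-\<^sup>1 \<gamma>\<^sup>n |B - A a|\<close> up to a boundary layer, and \<open>a' = n a\<close> gives the exponent.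

  The area formula for the vertex map is applied to the dual convex function instead of \<open>u\<close>. After an
  arbitrarily small increase of the opening its gradient is a Lipschitz map defined everywhere, hence
  differentiable almost everywhere by Rademacher's theorem, and its second order expansions from above
  dualize to quadratics touching \<open>u\<close> from below.
\<close>

section \<open>Vitali coverings and images of sets\<close>

text \<open>New contact points are selected by choice, so sets of vertices need not be measurable;
  their size is expressed throughout by measurable covers. The vertex as a function of the contact
  point need not be Lipschitz, so no derivative almost everywhere is available on that side; this is
  the reason for passing to the dual. The ratio n of successive openings makes \<gamma> = 1 - 1/n,
  hence \<gamma>^n \<ge> 1/4 for n \<ge> 2, while integrating the power \<alpha> only asks the
  complement to decay faster than n^(-\<alpha>) per step. Together this leads to the condition
  \<alpha> ln n < J^(-1)/4, which is where ln n^4 = 4 ln n comes from. As (n-2k)/(n-k) \<le> 1, the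
  stated exponent is at most J^(-1)/(4 ln n). The boundary layer for opening a has width of order
  (max |u| / a)^(1/2) and shrinks by n^(-1/2) per step, which does no harm because \<alpha> < 1/2.
  The limit statement rests on a separate fact: \<epsilon>(n,\<lambda>,\<Lambda>,k) is at least a
  constant over ln n, while the power of \<Lambda>/\<lambda> decays exponentially.\<close>

lemma vitali_image_bound:
  fixes f :: "'a::euclidean_space \<Rightarrow> 'a"
  assumes T: "T \<in> lmeasurable" and ST: "S \<subseteq> T" and p: "0 \<le> p" and e: "0 < e"
    and null: "\<And>N. N \<subseteq> S \<Longrightarrow> negligible N \<Longrightarrow> negligible (f ` N)"
    and cover: "\<And>x d. x \<in> S \<Longrightarrow> 0 < d \<Longrightarrow> \<exists>a r W. 0 < r \<and> r < d \<and> x \<in> cball a r \<and> W \<in> lmeasurable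
       \<and> f ` (S \<inter> cball a r) \<subseteq> W \<and> measure lebesgue W \<le> p * measure lebesgue (cball a r)"
  obtains V where "V \<in> lmeasurable" "f ` S \<subseteq> V" "measure lebesgue V \<le> p * measure lebesgue T + e"
proof -
  \<comment> \<open>The open superset \<open>U\<close> may exceed \<open>T\<close> by
    \<open>e'\<close>, which costs \<open>p * e' \<le> e\<close>; dividing by \<open>p + 1\<close>
    covers \<open>p = 0\<close>.\<close>
  define e' where "e' = e / (p + 1)"
  have e': "0 < e'" "p * e' \<le> e"
    using p e by (auto simp: e'_def field_simps)
  obtain U where U: "open U" "T \<subseteq> U" "U - T \<in> lmeasurable" "emeasure lebesgue (U - T) < ennreal e'"
    using sets_lebesgue_outer_open[OF _ e'(1), of T] T by (auto simp: fmeasurable_def)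
  have UT: "U = T \<union> (U - T)"
    using U by auto
  have Um: "U \<in> lmeasurable"
    using fmeasurable.Un[OF T U(3)] UT by metis
  have "measure lebesgue (U - T) < e'"
    using U(3,4) e'(1) by (simp add: emeasure_eq_measure2 ennreal_less_iff)
  moreover have "measure lebesgue U \<le> measure lebesgue T + measure lebesgue (U - T)"
    using measure_Un_le[of T lebesgue "U - T"] T U(3) UT by (auto simp: fmeasurable_def)
  ultimately have Ule: "p * measure lebesgue U \<le> p * measure lebesgue T + e"
    using mult_left_mono[of "measure lebesgue U" "measure lebesgue T + e'" p] p e'
    by (simp add: algebra_simps)
  \<comment> \<open>An index carries centre, radius and the cover of the image. The balls need only
    contain \<open>x\<close>, so intervals with \<open>x\<close> as an endpoint are allowed.
    Vitali's theorem selects disjoint balls inside \<open>U\<close> that exhaust \<open>S\<close> up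
    to a null set, which \<open>null\<close> takes care of.\<close>
  define K where "K = {(a, r, W). 0 < r \<and> cball a r \<subseteq> U \<and> W \<in> lmeasurable
       \<and> f ` (S \<inter> cball a r) \<subseteq> W \<and> measure lebesgue W \<le> p * measure lebesgue (cball a r)}"
  have K: "\<exists>i. i \<in> K \<and> x \<in> cball (fst i) (fst (snd i)) \<and> fst (snd i) < d"
    if x: "x \<in> S" and d: "0 < d" for x d
  proof -
    obtain d' where d': "0 < d'" "ball x d' \<subseteq> U"
      using U ST x by (meson open_contains_ball subset_eq)
    obtain a r W where *: "0 < r" "r < min d (d' / 2)" "x \<in> cball a r" "W \<in> lmeasurable"
       "f ` (S \<inter> cball a r) \<subseteq> W" "measure lebesgue W \<le> p * measure lebesgue (cball a r)"
      using cover[OF x, of "min d (d' / 2)"] d d' by auto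
    have "cball a r \<subseteq> ball x d'"
    proof
      fix z assume "z \<in> cball a r"
      then have "dist x z \<le> 2 * r"
        using * dist_triangle[of x z a] by (auto simp: dist_commute)
      with * show "z \<in> ball x d'" by auto
    qed
    with * d' have "(a, r, W) \<in> K"
      by (auto simp: K_def)
    with * show ?thesis
      by (intro exI[of _ "(a, r, W)"]) auto
  qed
  have Kpos: "0 < fst (snd i)" if "i \<in> K" for i
    using that by (auto simp: K_def)
  obtain C where C: "countable C" "C \<subseteq> K"
     "pairwise (\<lambda>i j. disjnt (cball (fst i) (fst (snd i))) (cball (fst j) (fst (snd j)))) C"
     "negligible (S - (\<Union>i\<in>C. cball (fst i) (fst (snd i))))"
    by (rule Vitali_covering_theorem_cballs[of K "\<lambda>i. fst (snd i)" S fst, OF Kpos K])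
  let ?W = "\<lambda>i. snd (snd i)" and ?B = "\<lambda>i. cball (fst i) (fst (snd i))"
  have KD: "?B i \<subseteq> U" "?W i \<in> lmeasurable" "f ` (S \<inter> ?B i) \<subseteq> ?W i"
    "measure lebesgue (?W i) \<le> p * measure lebesgue (?B i)" if "i \<in> C" for i
    using that C(2) by (cases i; force simp: K_def)+
  note Wm = KD(2)
  have bound: "measure lebesgue (\<Union>i\<in>I. ?W i) \<le> p * measure lebesgue U"
    if I: "finite I" "I \<subseteq> C" for I
  proof -
    have "measure lebesgue (\<Union>i\<in>I. ?W i) \<le> (\<Sum>i\<in>I. measure lebesgue (?W i))"
      using I Wm by (intro measure_UNION_le) auto
    also have "\<dots> \<le> (\<Sum>i\<in>I. p * measure lebesgue (?B i))"
      using I KD(4) by (intro sum_mono) auto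
    also have "\<dots> = p * measure lebesgue (\<Union>i\<in>I. ?B i)"
    proof -
      have "measure lebesgue (\<Union>i\<in>I. ?B i) = (\<Sum>i\<in>I. measure lebesgue (?B i))"
        using I by (intro measure_UNION' pairwise_subset[OF C(3)]) auto
      then show ?thesis by (simp add: sum_distrib_left)
    qed
    also have "\<dots> \<le> p * measure lebesgue U"
    proof (intro mult_left_mono measure_mono_fmeasurable UN_least)
      show "?B i \<subseteq> U" if "i \<in> I" for i
        using that I KD(1) by blast
      show "(\<Union>i\<in>I. ?B i) \<in> sets lebesgue"
        using I by (intro sets.finite_UN) auto
    qed (use p Um in auto)
    finally show ?thesis .
  qed
  have V1: "(\<Union>i\<in>C. ?W i) \<in> lmeasurable" "measure lebesgue (\<Union>i\<in>C. ?W i) \<le> p * measure lebesgue U"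
    using fmeasurable_UN_bound[OF C(1), of ?W lebesgue] measure_UN_bound[OF C(1), of ?W lebesgue] Wm bound
    by blast+
  define N where "N = f ` (S - (\<Union>i\<in>C. ?B i))"
  have N: "negligible N"
    unfolding N_def using C(4) by (intro null) auto
  show thesis
  proof
    show "(\<Union>i\<in>C. ?W i) \<union> N \<in> lmeasurable"
      using V1 N by (simp add: negligible_imp_measurable fmeasurable.Un)
    have "measure lebesgue ((\<Union>i\<in>C. ?W i) \<union> N) = measure lebesgue (\<Union>i\<in>C. ?W i)"
      using N by (intro measure_negligible_symdiff) (use V1 in \<open>auto intro: negligible_subset\<close>)
    with V1 Ule show "measure lebesgue ((\<Union>i\<in>C. ?W i) \<union> N) \<le> p * measure lebesgue T + e"
      by simp
    show "f ` S \<subseteq> (\<Union>i\<in>C. ?W i) \<union> N"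
    proof
      fix z assume "z \<in> f ` S"
      then obtain x where x: "x \<in> S" "z = f x" by auto
      show "z \<in> (\<Union>i\<in>C. ?W i) \<union> N"
      proof (cases "\<exists>i\<in>C. x \<in> ?B i")
        case True
        then obtain i where i: "i \<in> C" "x \<in> ?B i" by auto
        then have "f x \<in> ?W i" using x i KD(3) by blast
        with i x show ?thesis by auto
      next
        case False
        with x show ?thesis by (auto simp: N_def)
      qed
    qed
  qed
qed

text \<open>A ball of radius d/2 is mapped into one of radius L d/2, whose volume is larger by
  \<open>L ^ DIM('a)\<close>. The set \<open>S\<close> is arbitrary, as suits sets defined by
  choice.\<close>

lemma lipschitz_image_bound:
  fixes f :: "'a::euclidean_space \<Rightarrow> 'a"
  assumes T: "T \<in> lmeasurable" and ST: "S \<subseteq> T" and L: "0 \<le> L" and e: "0 < e"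
    and lip: "\<And>x y. x \<in> S \<Longrightarrow> y \<in> S \<Longrightarrow> norm (f x - f y) \<le> L * norm (x - y)"
  obtains V where "V \<in> lmeasurable" "f ` S \<subseteq> V" "measure lebesgue V \<le> L ^ DIM('a) * measure lebesgue T + e"
proof (rule vitali_image_bound[OF T ST _ e, of "L ^ DIM('a)" f])
  show "0 \<le> L ^ DIM('a)" using L by simp
next
  fix N assume N: "N \<subseteq> S" "negligible N"
  show "negligible (f ` N)"
  proof (rule negligible_locally_Lipschitz_image[OF order_refl N(2)])
    fix x assume "x \<in> N"
    then show "\<exists>T B. open T \<and> x \<in> T \<and> (\<forall>y\<in>N \<inter> T. norm (f y - f x) \<le> B * norm (y - x))"
      using lip N by (intro exI[of _ UNIV] exI[of _ L]) auto
  qed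
next
  fix x and d :: real assume x: "x \<in> S" and d: "0 < d"
  show "\<exists>a r W. 0 < r \<and> r < d \<and> x \<in> cball a r \<and> W \<in> lmeasurable
       \<and> f ` (S \<inter> cball a r) \<subseteq> W \<and> measure lebesgue W \<le> L ^ DIM('a) * measure lebesgue (cball a r)"
  proof (intro exI[of _ x] exI[of _ "d/2"] exI[of _ "cball (f x) (L * (d/2))"] conjI)
    show "f ` (S \<inter> cball x (d/2)) \<subseteq> cball (f x) (L * (d/2))"
    proof clarsimp
      fix y assume y: "y \<in> S" "dist x y * 2 \<le> d"
      have "norm (f x - f y) \<le> L * norm (x - y)" using lip x y by auto
      also have "\<dots> \<le> L * (d/2)" using y L by (intro mult_left_mono) (auto simp: dist_norm)
      finally show "dist (f x) (f y) * 2 \<le> L * d" by (simp add: dist_norm)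
    qed
    show "measure lebesgue (cball (f x) (L * (d/2))) \<le> L ^ DIM('a) * measure lebesgue (cball x (d/2))"
      using d L by (simp add: content_cball power_mult_distrib power_divide mult_ac)
  qed (use d in auto)
qed (use that in auto)

section \<open>Rademacher's theorem\<close>

text \<open>Half of the classical argument for monotone functions: where some difference quotient at
  every scale is below \<open>p\<close>, the interval between \<open>x\<close> and
  \<open>x + h\<close> is mapped into one of length at most \<open>p * \<bar>h\<bar>\<close>, and
  such intervals form a Vitali cover.\<close>

lemma small_slope_image_bound:
  fixes g :: "real \<Rightarrow> real"
  assumes mono: "strict_mono g"
    and lip: "\<And>x y. \<bar>g x - g y\<bar> \<le> L * \<bar>x - y\<bar>"
    and T: "T \<in> lmeasurable" and ST: "S \<subseteq> T" and p: "0 < p" and e: "0 < e"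
    and slope: "\<And>x d. x \<in> S \<Longrightarrow> 0 < d \<Longrightarrow> \<exists>h. h \<noteq> 0 \<and> \<bar>h\<bar> < d \<and> (g (x + h) - g x) / h < p"
  obtains V where "V \<in> lmeasurable" "g ` S \<subseteq> V" "measure lebesgue V \<le> p * measure lebesgue T + e"
proof (rule vitali_image_bound[OF T ST _ e, of p g])
  show "0 \<le> p" using p by simp
next
  fix N assume N: "N \<subseteq> S" "negligible N"
  show "negligible (g ` N)"
  proof (rule negligible_locally_Lipschitz_image[OF order_refl N(2)])
    fix x assume "x \<in> N"
    then show "\<exists>T B. open T \<and> x \<in> T \<and> (\<forall>y\<in>N \<inter> T. norm (g y - g x) \<le> B * norm (y - x))"
      using lip by (intro exI[of _ UNIV] exI[of _ L]) auto
  qed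
next
  fix x and d :: real assume x: "x \<in> S" and d: "0 < d"
  obtain h where h: "h \<noteq> 0" "\<bar>h\<bar> < d" "(g (x + h) - g x) / h < p"
    using slope[OF x d] by auto
  define l u where "l = min x (x + h)" and "u = max x (x + h)"
  have lu: "l < u" "u - l = \<bar>h\<bar>" "x \<in> {l..u}"
    using h by (auto simp: l_def u_def)
  have gl: "g l < g u" using mono lu by (auto simp: strict_mono_def)
  have gul: "g u - g l \<le> p * (u - l)"
    using h by (cases "h > 0") (auto simp: l_def u_def field_simps)
  have cb: "cball ((l + u) / 2) ((u - l) / 2) = {l..u}"
    using lu by (auto simp: cball_eq_atLeastAtMost field_simps)
  show "\<exists>a r W. 0 < r \<and> r < d \<and> x \<in> cball a r \<and> W \<in> lmeasurable
       \<and> g ` (S \<inter> cball a r) \<subseteq> W \<and> measure lebesgue W \<le> p * measure lebesgue (cball a r)"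
  proof (rule exI[of _ "(l + u) / 2"], rule exI[of _ "(u - l) / 2"], rule exI[of _ "{g l..g u}"], intro conjI)
    show "x \<in> cball ((l + u) / 2) ((u - l) / 2)" using lu cb by simp
    show "g ` (S \<inter> cball ((l + u) / 2) ((u - l) / 2)) \<subseteq> {g l..g u}"
      unfolding cb using mono by (auto simp: strict_mono_less_eq)
    show "measure lebesgue {g l..g u} \<le> p * measure lebesgue (cball ((l + u) / 2) ((u - l) / 2))"
      unfolding cb using gl gul lu by simp
  qed (use h lu in auto)
qed (use that in auto)

text \<open>The hypothesis gives s \<le> c s for the outer measure s of \<open>S\<close>, and s is
  finite because \<open>S\<close> is bounded.\<close>

lemma negligible_if_contracting:
  fixes S :: "'a::euclidean_space set"
  assumes S: "bounded S" and c: "0 \<le> c" "c < 1"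
    and step: "\<And>T e. T \<in> lmeasurable \<Longrightarrow> S \<subseteq> T \<Longrightarrow> 0 < e \<Longrightarrow>
       \<exists>V\<in>lmeasurable. S \<subseteq> V \<and> measure lebesgue V \<le> c * measure lebesgue T + e"
  shows "negligible S"
proof -
  define M where "M = {measure lebesgue T |T. T \<in> lmeasurable \<and> S \<subseteq> T}"
  have ne: "M \<noteq> {}"
  proof -
    obtain a b where "S \<subseteq> cbox a b" using S bounded_subset_cbox_symmetric by metis
    then show ?thesis by (auto simp: M_def)
  qed
  have bdd: "bdd_below M" by (auto simp: M_def intro!: bdd_belowI[of _ 0])
  define s where "s = Inf M"
  have s0: "0 \<le> s" unfolding s_def using ne by (intro cInf_greatest) (auto simp: M_def)
  have "s = 0"
  proof (rule ccontr)
    assume "s \<noteq> 0"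
    with s0 have s: "0 < s" by simp
    \<comment> \<open>With this choice c (s + e) + e is at most c s + (1 - c) s / 2, which is less
      than s.\<close>
    define e where "e = (1 - c) * s / 4"
    have e: "0 < e" using s c by (simp add: e_def)
    obtain T where T: "T \<in> lmeasurable" "S \<subseteq> T" "measure lebesgue T < s + e"
      using cInf_lessD[OF ne, of "s + e"] e by (auto simp: s_def M_def)
    obtain V where V: "V \<in> lmeasurable" "S \<subseteq> V" "measure lebesgue V \<le> c * measure lebesgue T + e"
      using step[OF T(1,2) e] by blast
    have "s \<le> measure lebesgue V"
      unfolding s_def using V bdd by (intro cInf_lower) (auto simp: M_def)
    also have "\<dots> \<le> c * (s + e) + e"
      using V T c mult_left_mono[of "measure lebesgue T" "s + e" c] by simp
    also have "\<dots> \<le> c * s + 2 * e" using c e mult_right_mono[of c 1 e] by (simp add: algebra_simps)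
    also have "\<dots> < s" using s c by (simp add: e_def field_simps)
    finally show False by simp
  qed
  show ?thesis
    unfolding negligible_outer
  proof (intro allI impI)
    fix e :: real assume "0 < e"
    then show "\<exists>T. S \<subseteq> T \<and> T \<in> lmeasurable \<and> measure lebesgue T < e"
      using cInf_lessD[OF ne, of e] \<open>s = 0\<close> by (auto simp: s_def M_def)
  qed
qed

text \<open>The map \<open>g\<close> carries the set to an image of outer measure at most
  \<open>p\<close> times its own; the inverse function has small slopes below \<open>1 / q\<close>
  there and carries the image back. Hence the outer measure is at most p/q times itself.\<close>

lemma negligible_oscillating_slope:
  fixes g :: "real \<Rightarrow> real"
  assumes low: "\<And>x y. x \<le> y \<Longrightarrow> y - x \<le> g y - g x"
    and up: "\<And>x y. \<bar>g x - g y\<bar> \<le> L * \<bar>x - y\<bar>"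
    and pq: "0 < p" "p < q"
  shows "negligible {x. (\<forall>d>0. \<exists>h. h \<noteq> 0 \<and> \<bar>h\<bar> < d \<and> (g (x + h) - g x) / h < p)
                       \<and> (\<forall>d>0. \<exists>h. h \<noteq> 0 \<and> \<bar>h\<bar> < d \<and> (g (x + h) - g x) / h > q)}"
    (is "negligible ?E")
proof -
  have L: "0 \<le> L" using up[of 0 1] by (metis abs_0 abs_ge_zero abs_minus_cancel abs_one diff_0 mult.right_neutral order_trans)
  have mono: "strict_mono g"
  proof (rule strict_monoI)
    fix x y :: real assume "x < y"
    then show "g x < g y" using low[of x y] by simp
  qed
  have cont: "continuous_on UNIV g"
    by (rule lipschitz_on_continuous_on[of L]) (auto simp: lipschitz_on_def dist_real_def up L)
  have surj: "\<exists>x. g x = y" for y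
  proof -
    have "g (- \<bar>y - g 0\<bar>) \<le> y" "y \<le> g \<bar>y - g 0\<bar>"
      using low[of "- \<bar>y - g 0\<bar>" 0] low[of 0 "\<bar>y - g 0\<bar>"] by auto
    then show ?thesis
      using IVT'[of g "- \<bar>y - g 0\<bar>" y "\<bar>y - g 0\<bar>"] continuous_on_subset[OF cont subset_UNIV] by auto
  qed
  define k where "k = inv g"
  have gk[simp]: "g (k y) = y" for y using surj by (metis k_def f_inv_into_f rangeI)
  have kg[simp]: "k (g x) = x" for x using mono by (simp add: k_def strict_mono_imp_inj_on)
  have kmono: "strict_mono k"
    using strict_mono_less[OF mono, of "k _" "k _"] by (simp add: strict_mono_def)
  have klip: "\<bar>k x - k y\<bar> \<le> 1 * \<bar>x - y\<bar>" for x y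
    using low[of "k x" "k y"] low[of "k y" "k x"] by (auto simp: abs_if)
  have "negligible (?E \<inter> {-real n..real n})" for n
  proof (rule negligible_if_contracting[of _ "p / q"])
    fix T :: "real set" and e :: real
    assume T: "T \<in> lmeasurable" "?E \<inter> {-real n..real n} \<subseteq> T" and e: "0 < e"
    let ?S = "?E \<inter> {-real n..real n}"
    \<comment> \<open>Each of the two image estimates contributes an error
      \<open>e' / q\<close>.\<close>
    define e' where "e' = q * e / 2"
    have e': "0 < e'" using e pq by (simp add: e'_def)
    obtain W where W: "W \<in> lmeasurable" "g ` ?S \<subseteq> W" "measure lebesgue W \<le> p * measure lebesgue T + e'"
      by (rule small_slope_image_bound[OF mono up T pq(1) e']) auto
    have slope: "\<exists>h. h \<noteq> 0 \<and> \<bar>h\<bar> < d \<and> (k (y + h) - k y) / h < 1 / q" if y: "y \<in> g ` ?S" and d: "0 < d" for y d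
    proof -
      obtain x where x: "x \<in> ?S" "y = g x" using y by auto
      \<comment> \<open>The increment of \<open>g\<close> is the step of the inverse function; this
        choice of scale keeps it below \<open>d\<close>.\<close>
      have "0 < d / (L + 1)" using d L by simp
      then obtain h where h: "h \<noteq> 0" "\<bar>h\<bar> < d / (L + 1)" "(g (x + h) - g x) / h > q"
        using x by blast
      have "g (x + h) \<noteq> g x" using h mono by (metis add_cancel_right_right kg)
      moreover have "\<bar>g (x + h) - g x\<bar> < d"
      proof -
        have "\<bar>g (x + h) - g x\<bar> \<le> L * \<bar>h\<bar>" using up[of "x + h" x] by simp
        also have "\<dots> \<le> (L + 1) * \<bar>h\<bar>" by (simp add: algebra_simps)
        also have "\<dots> < d" using h L by (simp add: field_simps)
        finally show ?thesis .
      qed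
      moreover have "h / (g (x + h) - g x) < 1 / q"
      proof -
        have "h / (g (x + h) - g x) = 1 / ((g (x + h) - g x) / h)" by simp
        moreover have "0 < (g (x + h) - g x) / h" using h(3) pq by linarith
        then have "1 / ((g (x + h) - g x) / h) < 1 / q"
          using h(3) pq by (intro divide_strict_left_mono mult_pos_pos) auto
        ultimately show ?thesis by simp
      qed
      ultimately show ?thesis
        using x by (intro exI[of _ "g (x + h) - g x"]) auto
    qed
    obtain V where V: "V \<in> lmeasurable" "k ` g ` ?S \<subseteq> V" "measure lebesgue V \<le> 1 / q * measure lebesgue W + e'/q"
      by (rule small_slope_image_bound[where p = "1/q" and e = "e'/q", OF kmono klip W(1,2) _ _ slope]) (use pq e' in auto)
    have "measure lebesgue V \<le> 1 / q * (p * measure lebesgue T + e') + e'/q"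
      using V W pq mult_left_mono[OF W(3), of "1/q"] by simp
    also have "\<dots> \<le> p / q * measure lebesgue T + e"
      using pq by (simp add: e'_def field_simps)
    finally show "\<exists>V\<in>lmeasurable. ?S \<subseteq> V \<and> measure lebesgue V \<le> p / q * measure lebesgue T + e"
      using V by (intro bexI[of _ V]) (auto simp: image_image)
  qed (use pq in \<open>auto intro: bounded_subset[of "{-real n..real n}"]\<close>)
  then have "negligible (\<Union>n. ?E \<inter> {-real n..real n})"
    by (intro negligible_Union_nat)
  moreover have "?E \<subseteq> (\<Union>n. ?E \<inter> {-real n..real n})"
  proof
    fix x assume "x \<in> ?E"
    moreover obtain n where "\<bar>x\<bar> \<le> real n" using real_arch_simple by blast
    then have "x \<in> {-real n..real n}" by auto
    ultimately show "x \<in> (\<Union>n. ?E \<inter> {-real n..real n})" by blast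
  qed
  ultimately show ?thesis by (rule negligible_subset)
qed

text \<open>Adding \<open>(L + 1) * x\<close> puts all difference quotients between 1 and 2 L + 1,
  so the oscillation lemma applies to \<open>g\<close>. Off countably many null sets, indexed by
  rational p < q, the lower derivate \<open>Sup M\<close> is a limit.\<close>

lemma lipschitz_differentiable_ae_1:
  fixes f :: "real \<Rightarrow> real"
  assumes lip: "\<And>x y. \<bar>f x - f y\<bar> \<le> L * \<bar>x - y\<bar>"
  shows "negligible {x. \<nexists>l. ((\<lambda>h. (f (x + h) - f x) / h) \<longlongrightarrow> l) (at 0)}"
proof -
  have L: "0 \<le> L" using lip[of 0 1] by (metis abs_0 abs_ge_zero abs_minus_cancel abs_one diff_0 mult.right_neutral order_trans)
  define g where "g x = f x + (L + 1) * x" for x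
  have low: "y - x \<le> g y - g x" if "x \<le> y" for x y
    using lip[of x y] that by (simp add: g_def algebra_simps abs_le_iff)
  have up: "\<bar>g x - g y\<bar> \<le> (2 * L + 1) * \<bar>x - y\<bar>" for x y
  proof -
    have "g x - g y = (f x - f y) + (L + 1) * (x - y)" by (simp add: g_def algebra_simps)
    then have "\<bar>g x - g y\<bar> \<le> L * \<bar>x - y\<bar> + \<bar>(L + 1) * (x - y)\<bar>"
      using lip[of x y] by linarith
    moreover have "\<bar>(L + 1) * (x - y)\<bar> = (L + 1) * \<bar>x - y\<bar>" using L by (simp add: abs_mult)
    ultimately show ?thesis by (simp add: algebra_simps)
  qed
  let ?Q = "\<lambda>x h. (g (x + h) - g x) / h"
  define E where "E p q = {x. (\<forall>d>0. \<exists>h. h \<noteq> 0 \<and> \<bar>h\<bar> < d \<and> ?Q x h < p)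
                       \<and> (\<forall>d>0. \<exists>h. h \<noteq> 0 \<and> \<bar>h\<bar> < d \<and> ?Q x h > q)}" for p q
  have neg: "negligible (\<Union>(p, q) \<in> {(p, q). p \<in> \<rat> \<and> q \<in> \<rat> \<and> 0 < p \<and> p < q}. E p q)"
  proof (rule negligible_countable_Union)
    have "countable ((\<rat> :: real set) \<times> (\<rat> :: real set))" by (simp add: countable_rat)
    then have "countable {(p :: real, q). p \<in> \<rat> \<and> q \<in> \<rat> \<and> 0 < p \<and> p < q}"
      by (rule countable_subset[rotated]) auto
    then show "countable ((\<lambda>(p, q). E p q) ` {(p, q). p \<in> \<rat> \<and> q \<in> \<rat> \<and> 0 < p \<and> p < q})"
      by (rule countable_image)
    show "negligible S" if "S \<in> (\<lambda>(p, q). E p q) ` {(p, q). p \<in> \<rat> \<and> q \<in> \<rat> \<and> 0 < p \<and> p < q}" for S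
      using that negligible_oscillating_slope[OF low up] by (auto simp: E_def)
  qed
  moreover have "\<exists>l. ((\<lambda>h. (f (x + h) - f x) / h) \<longlongrightarrow> l) (at 0)"
    if x: "\<And>p q. p \<in> \<rat> \<Longrightarrow> q \<in> \<rat> \<Longrightarrow> 0 < p \<Longrightarrow> p < q \<Longrightarrow> x \<notin> E p q" for x
  proof -
    have freq: "(\<forall>d>0. \<exists>h. h \<noteq> 0 \<and> \<bar>h\<bar> < d \<and> P h) \<longleftrightarrow> \<not> eventually (\<lambda>h. \<not> P h) (at (0::real))" for P
      by (auto simp: eventually_at dist_real_def)
    have x': "eventually (\<lambda>h. ?Q x h \<ge> p) (at 0) \<or> eventually (\<lambda>h. ?Q x h \<le> q) (at 0)"
      if "p \<in> \<rat>" "q \<in> \<rat>" "0 < p" "p < q" for p q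
      using x[OF that] by (simp add: E_def freq not_less)
    have Q1: "1 \<le> ?Q x h" "?Q x h \<le> 2 * L + 1" if "h \<noteq> 0" for h
    proof -
      show "1 \<le> ?Q x h"
        using low[of x "x + h"] low[of "x + h" x] that by (cases "h > 0") (auto simp: field_simps)
      have "\<bar>?Q x h\<bar> \<le> 2 * L + 1"
        using up[of "x + h" x] that by (simp add: field_simps)
      then show "?Q x h \<le> 2 * L + 1" by (rule order_trans[OF abs_ge_self])
    qed
    define M where "M = {p. eventually (\<lambda>h. ?Q x h \<ge> p) (at 0)}"
    have M1: "1 \<in> M" using Q1 by (auto simp: M_def eventually_at intro!: exI[of _ 1])
    have Mb: "p \<le> 2 * L + 1" if "p \<in> M" for p
    proof -
      have "eventually (\<lambda>h. p \<le> 2 * L + 1) (at (0::real))"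
        using that Q1(2) by (auto simp: M_def eventually_at intro: order_trans elim!: ex_forward)
      then show ?thesis by simp
    qed
    have Mbdd: "bdd_above M" using Mb by (rule bdd_aboveI)
    define l where "l = Sup M"
    have l1: "1 \<le> l" unfolding l_def by (rule cSup_upper[OF M1 Mbdd])
    have "((\<lambda>h. ?Q x h) \<longlongrightarrow> l) (at 0)"
    proof (rule order_tendstoI)
      fix a assume "a < l"
      then obtain p where p: "p \<in> M" "a < p"
        unfolding l_def using less_cSup_iff[OF _ Mbdd] M1 by auto
      then show "eventually (\<lambda>h. a < ?Q x h) (at 0)"
        by (auto simp: M_def elim!: eventually_mono)
    next
      fix a assume a: "l < a"
      obtain q where q: "q \<in> \<rat>" "l < q" "q < a" using Rats_dense_in_real[OF a] by auto
      obtain p where p: "p \<in> \<rat>" "l < p" "p < q" using Rats_dense_in_real[OF q(2)] by auto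
      \<comment> \<open>Both rationals lie above the lower derivate, so the quotients are not
        eventually at least \<open>p\<close>; since x is not in \<open>E p q\<close>, they are
        eventually at most \<open>q\<close>.\<close>
      have "p \<notin> M" using cSup_upper[OF _ Mbdd, of p] p by (auto simp: l_def)
      then have "eventually (\<lambda>h. ?Q x h \<le> q) (at 0)"
        using x'[of p q] p q l1 by (auto simp: M_def)
      then show "eventually (\<lambda>h. ?Q x h < a) (at 0)"
        using q by (auto elim!: eventually_mono)
    qed
    then have "((\<lambda>h. ?Q x h - (L + 1)) \<longlongrightarrow> l - (L + 1)) (at 0)"
      by (intro tendsto_intros)
    moreover have "eventually (\<lambda>h. ?Q x h - (L + 1) = (f (x + h) - f x) / h) (at 0)"
      by (auto simp: eventually_at g_def field_simps intro!: exI[of _ 1])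
    ultimately have "((\<lambda>h. (f (x + h) - f x) / h) \<longlongrightarrow> l - (L + 1)) (at 0)"
      by (rule Lim_transform_eventually)
    then show ?thesis by blast
  qed
  then have "{x. \<nexists>l. ((\<lambda>h. (f (x + h) - f x) / h) \<longlongrightarrow> l) (at 0)}
     \<subseteq> (\<Union>(p, q) \<in> {(p, q). p \<in> \<rat> \<and> q \<in> \<rat> \<and> 0 < p \<and> p < q}. E p q)"
    by blast
  ultimately show ?thesis by (rule negligible_subset)
qed

text \<open>Averaging over translations along \<open>v\<close> replaces a decomposition of the space into lines.\<close>

lemma AE_lborel_if_AE_on_lines:
  fixes v :: "'a::euclidean_space"
  assumes N: "N \<in> sets borel" and line: "\<And>x. negligible {t::real. x + t *\<^sub>R v \<in> N}"
  shows "AE x in lborel. x \<notin> N"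
proof -
  have meas: "(\<lambda>(x, t). indicator N (x + t *\<^sub>R v) * indicator {0..1} (t::real) :: ennreal) \<in> borel_measurable (lborel \<Otimes>\<^sub>M lborel)"
    using N by measurable
  \<comment> \<open>All translates of \<open>N\<close> have the same measure, so averaging over t in
    [0, 1] changes nothing; after exchanging the integrals the inner one runs along a line and
    vanishes.\<close>
  have "emeasure lborel N = (\<integral>\<^sup>+t. emeasure lborel N * indicator {0..1} (t::real) \<partial>lborel)"
    by (simp add: nn_integral_cmult)
  also have "\<dots> = (\<integral>\<^sup>+t. (\<integral>\<^sup>+x. indicator N (x + t *\<^sub>R v) * indicator {0..1} t \<partial>lborel) \<partial>lborel)"
  proof (rule nn_integral_cong)
    fix t :: real
    have "emeasure lborel N = emeasure (distr lborel borel ((+) (t *\<^sub>R v))) N"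
      by (simp add: lborel_distr_plus)
    also have "\<dots> = (\<integral>\<^sup>+x. indicator N x \<partial>distr lborel borel ((+) (t *\<^sub>R v)))"
      using N by (simp add: nn_integral_indicator)
    also have "\<dots> = (\<integral>\<^sup>+x. indicator N (x + t *\<^sub>R v) \<partial>lborel)"
      using N by (subst nn_integral_distr) (auto simp: add.commute)
    finally show "emeasure lborel N * indicator {0..1} t = (\<integral>\<^sup>+x. indicator N (x + t *\<^sub>R v) * indicator {0..1} t \<partial>lborel)"
      by (simp split: split_indicator)
  qed
  also have "\<dots> = (\<integral>\<^sup>+x. (\<integral>\<^sup>+t. indicator N (x + t *\<^sub>R v) * indicator {0..1} (t::real) \<partial>lborel) \<partial>lborel)"
    by (rule lborel_pair.Fubini'[OF meas])
  also have "\<dots> = (\<integral>\<^sup>+(x::'a). 0 \<partial>lborel)"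
  proof (rule nn_integral_cong)
    fix x :: 'a
    have m: "{t::real. x + t *\<^sub>R v \<in> N} \<in> sets borel"
      using N by measurable
    have "{t::real. x + t *\<^sub>R v \<in> N} \<in> null_sets lborel"
      using line[of x] m by (simp add: negligible_iff_null_sets null_sets_completion_iff)
    then have "AE t in lborel. x + t *\<^sub>R v \<notin> N"
      using AE_not_in by fastforce
    then show "(\<integral>\<^sup>+t. indicator N (x + t *\<^sub>R v) * indicator {0..1} (t::real) \<partial>lborel) = 0"
      by (subst nn_integral_0_iff_AE) (use N in \<open>auto elim!: eventually_mono\<close>)
  qed
  finally have "N \<in> null_sets lborel" using N by (auto simp: null_sets_def)
  then show ?thesis by (rule AE_not_in)
qed

text \<open>With quantifiers over rationals and naturals only, the set of points where a directional
  derivative exists becomes a countable combination of Borel conditions.\<close>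

lemma real_tendsto_at_0_iff_rat_Cauchy:
  fixes q :: "real \<Rightarrow> real"
  assumes cont: "continuous_on (- {0}) q"
  shows "(\<exists>l. (q \<longlongrightarrow> l) (at 0)) \<longleftrightarrow>
    (\<forall>n::nat. \<exists>m::nat. \<forall>h h'::rat. h \<noteq> 0 \<longrightarrow> h' \<noteq> 0 \<longrightarrow> \<bar>real_of_rat h\<bar> < 1 / Suc m \<longrightarrow> \<bar>real_of_rat h'\<bar> < 1 / Suc m
        \<longrightarrow> \<bar>q (real_of_rat h) - q (real_of_rat h')\<bar> \<le> 1 / Suc n)" (is "?L \<longleftrightarrow> ?R")
proof
  assume ?L
  then obtain l where l: "(q \<longlongrightarrow> l) (at 0)" by blast
  show ?R
  proof
    fix n :: nat
    have "eventually (\<lambda>h. dist (q h) l < 1 / (2 * Suc n)) (at 0)"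
      using l by (rule tendstoD) simp
    then obtain d where d: "d > 0" "\<And>h. h \<noteq> 0 \<Longrightarrow> \<bar>h\<bar> < d \<Longrightarrow> dist (q h) l < 1 / (2 * Suc n)"
      by (auto simp: eventually_at dist_real_def)
    obtain m where m: "1 / Suc m < d" using d(1) nat_approx_posE by metis
    have "\<bar>q h - q h'\<bar> \<le> 1 / Suc n" if "h \<noteq> 0" "h' \<noteq> 0" "\<bar>h\<bar> < 1 / Suc m" "\<bar>h'\<bar> < 1 / Suc m" for h h'
    proof -
      have "dist (q h) l < 1 / (2 * Suc n)" "dist (q h') l < 1 / (2 * Suc n)"
        using that m by (intro d(2); linarith)+
      then have "\<bar>q h - q h'\<bar> < 1 / (2 * Suc n) + 1 / (2 * Suc n)" unfolding dist_real_def by linarith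
      then show ?thesis by (simp add: field_simps)
    qed
    then show "\<exists>m::nat. \<forall>h h'::rat. h \<noteq> 0 \<longrightarrow> h' \<noteq> 0 \<longrightarrow> \<bar>real_of_rat h\<bar> < 1 / Suc m \<longrightarrow> \<bar>real_of_rat h'\<bar> < 1 / Suc m
        \<longrightarrow> \<bar>q (real_of_rat h) - q (real_of_rat h')\<bar> \<le> 1 / Suc n"
      by (intro exI[of _ m]) auto
  qed
next
  assume R: ?R
  have near: "\<exists>r::rat. r \<noteq> 0 \<and> \<bar>real_of_rat r\<bar> < d \<and> \<bar>q (real_of_rat r) - q h\<bar> < e"
    if h: "h \<noteq> 0" "\<bar>h\<bar> < d" "e > 0" for h d e
  proof -
    have "isCont q h" using cont h by (simp add: continuous_on_eq_continuous_at open_Compl)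
    then obtain s where s: "s > 0" "\<And>y. \<bar>y - h\<bar> < s \<Longrightarrow> \<bar>q y - q h\<bar> < e"
      using h(3) by (auto simp: continuous_at_eps_delta dist_real_def)
    define s' where "s' = min s (min \<bar>h\<bar> (d - \<bar>h\<bar>))"
    have "s' > 0" using h s by (auto simp: s'_def)
    then obtain r where r: "h - s' < real_of_rat r" "real_of_rat r < h + s'"
      using of_rat_dense[of "h - s'" "h + s'"] by auto
    have "\<bar>real_of_rat r - h\<bar> < s'" using r by linarith
    then have *: "\<bar>real_of_rat r - h\<bar> < s" "\<bar>real_of_rat r - h\<bar> < \<bar>h\<bar>" "\<bar>real_of_rat r - h\<bar> < d - \<bar>h\<bar>"
      by (simp_all add: s'_def)
    have "real_of_rat r \<noteq> 0" using *(2) by linarith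
    moreover have "\<bar>real_of_rat r\<bar> < d" using *(3) by linarith
    moreover have "\<bar>q (real_of_rat r) - q h\<bar> < e" using *(1) by (rule s(2))
    ultimately show ?thesis by (intro exI[of _ r]) auto
  qed
  have *: "\<exists>d>0. \<forall>h h'. h \<noteq> 0 \<longrightarrow> h' \<noteq> 0 \<longrightarrow> \<bar>h\<bar> < d \<longrightarrow> \<bar>h'\<bar> < d \<longrightarrow> \<bar>q h - q h'\<bar> < e" if e: "e > 0" for e
  proof -
    obtain n where n: "1 / Suc n < e / 3" using e nat_approx_posE[of "e/3"] by auto
    obtain m where m: "\<And>h h'::rat. h \<noteq> 0 \<Longrightarrow> h' \<noteq> 0 \<Longrightarrow> \<bar>real_of_rat h\<bar> < 1 / Suc m \<Longrightarrow> \<bar>real_of_rat h'\<bar> < 1 / Suc m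
        \<Longrightarrow> \<bar>q (real_of_rat h) - q (real_of_rat h')\<bar> \<le> 1 / Suc n"
      using R by blast
    have "\<bar>q h - q h'\<bar> < e" if h: "h \<noteq> 0" "h' \<noteq> 0" "\<bar>h\<bar> < 1 / Suc m" "\<bar>h'\<bar> < 1 / Suc m" for h h'
    proof -
      obtain r where r: "r \<noteq> 0" "\<bar>real_of_rat r\<bar> < 1 / Suc m" "\<bar>q (real_of_rat r) - q h\<bar> < e/3"
        using near[OF h(1,3), of "e/3"] e by auto
      obtain r' where r': "r' \<noteq> 0" "\<bar>real_of_rat r'\<bar> < 1 / Suc m" "\<bar>q (real_of_rat r') - q h'\<bar> < e/3"
        using near[OF h(2,4), of "e/3"] e by auto
      show ?thesis using m[OF r(1) r'(1) r(2) r'(2)] r r' n by linarith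
    qed
    then show ?thesis by (intro exI[of _ "1 / Suc m"]) auto
  qed
  then have "cauchy_filter (filtermap q (at 0))"
    unfolding cauchy_filter_metric_filtermap
  proof (intro allI impI)
    fix e :: real assume "0 < e"
    then obtain d where "d > 0" and d: "\<And>h h'. h \<noteq> 0 \<Longrightarrow> h' \<noteq> 0 \<Longrightarrow> \<bar>h\<bar> < d \<Longrightarrow> \<bar>h'\<bar> < d \<Longrightarrow> \<bar>q h - q h'\<bar> < e"
      using * by blast
    then show "\<exists>P. eventually P (at 0) \<and> (\<forall>x y. P x \<and> P y \<longrightarrow> dist (q x) (q y) < e)"
      by (intro exI[of _ "\<lambda>h. h \<noteq> 0 \<and> \<bar>h\<bar> < d"]) (auto simp: eventually_at dist_real_def)
  qed
  then have "\<exists>c. filtermap q (at 0) \<le> nhds c"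
    by (rule cauchy_filter_complete_converges[where A=UNIV]) (auto simp: filtermap_bot_iff complete_UNIV)
  then show ?L by (simp add: filterlim_def)
qed

lemma lipschitz_const_nonneg:
  fixes f :: "'a::euclidean_space \<Rightarrow> real"
  assumes "\<And>x y. \<bar>f x - f y\<bar> \<le> L * norm (x - y)"
  shows "0 \<le> L"
proof -
  obtain b :: 'a where "b \<in> Basis" using nonempty_Basis by blast
  then show ?thesis using assms[of b 0] abs_ge_zero[of "f b - f 0"] by simp
qed

definition dir_quot :: "('a::euclidean_space \<Rightarrow> real) \<Rightarrow> 'a \<Rightarrow> 'a \<Rightarrow> real \<Rightarrow> real" where
  "dir_quot f v x h = (f (x + h *\<^sub>R v) - f x) / h"

lemma dir_quot_borel [measurable]:
  assumes "continuous_on UNIV f"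
  shows "(\<lambda>x. dir_quot f v x h) \<in> borel_measurable borel"
proof -
  have [measurable]: "f \<in> borel_measurable borel" using assms by (rule borel_measurable_continuous_onI)
  show ?thesis unfolding dir_quot_def by measurable
qed

text \<open>The exceptional set is Borel by the rational Cauchy criterion, and each line in
  direction \<open>v\<close> meets it in a null set by the one-dimensional theorem.\<close>

lemma lipschitz_dir_quot_converges_ae:
  fixes f :: "'a::euclidean_space \<Rightarrow> real"
  assumes lip: "\<And>x y. \<bar>f x - f y\<bar> \<le> L * norm (x - y)"
  shows "AE x in lborel. \<exists>l. (dir_quot f v x \<longlongrightarrow> l) (at 0)"
proof -
  have L: "0 \<le> L" by (rule lipschitz_const_nonneg[OF lip])
  have cont: "continuous_on UNIV f"
    by (rule lipschitz_on_continuous_on[of L]) (auto simp: lipschitz_on_def dist_norm lip L)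
  have [measurable]: "f \<in> borel_measurable borel"
    using cont by (rule borel_measurable_continuous_onI)
  have contq: "continuous_on (- {0}) (dir_quot f v x)" for x
    unfolding dir_quot_def by (intro continuous_intros continuous_on_compose2[OF cont]) auto
  define N where "N = {x. \<nexists>l. (dir_quot f v x \<longlongrightarrow> l) (at 0)}"
  have [measurable]: "(\<lambda>x. dir_quot f v x h) \<in> borel_measurable borel" for h
    by (rule dir_quot_borel[OF cont])
  have "N \<in> sets borel"
  proof -
    have "Measurable.pred borel (\<lambda>x. \<forall>n::nat. \<exists>m::nat. \<forall>h h'::rat. h \<noteq> 0 \<longrightarrow> h' \<noteq> 0 \<longrightarrow> \<bar>real_of_rat h\<bar> < 1 / Suc m \<longrightarrow> \<bar>real_of_rat h'\<bar> < 1 / Suc m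
        \<longrightarrow> \<bar>dir_quot f v x (real_of_rat h) - dir_quot f v x (real_of_rat h')\<bar> \<le> 1 / Suc n)"
      by measurable
    then have "Measurable.pred borel (\<lambda>x. \<exists>l. (dir_quot f v x \<longlongrightarrow> l) (at 0))"
      by (simp only: real_tendsto_at_0_iff_rat_Cauchy[OF contq])
    then have "{x. \<exists>l. (dir_quot f v x \<longlongrightarrow> l) (at 0)} \<in> sets borel"
      by (simp add: pred_def)
    then have "- {x. \<exists>l. (dir_quot f v x \<longlongrightarrow> l) (at 0)} \<in> sets borel"
      by (rule borel_comp)
    then show ?thesis by (simp add: N_def Compl_eq)
  qed
  moreover have "negligible {t. x + t *\<^sub>R v \<in> N}" for x
  proof -
    have "\<bar>f (x + s *\<^sub>R v) - f (x + t *\<^sub>R v)\<bar> \<le> L * norm v * \<bar>s - t\<bar>" for s t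
      using lip[of "x + s *\<^sub>R v" "x + t *\<^sub>R v"]
      by (simp add: scaleR_diff_left[symmetric] mult_ac)
    from lipschitz_differentiable_ae_1[of "\<lambda>t. f (x + t *\<^sub>R v)", OF this]
    moreover have "dir_quot f v (x + t *\<^sub>R v) = (\<lambda>h. (f (x + (t + h) *\<^sub>R v) - f (x + t *\<^sub>R v)) / h)" for t
      by (simp add: fun_eq_iff dir_quot_def algebra_simps)
    ultimately show ?thesis
      by (simp add: N_def)
  qed
  ultimately have "AE x in lborel. x \<notin> N"
    by (rule AE_lborel_if_AE_on_lines)
  then show ?thesis by (simp add: N_def)
qed

text \<open>The function (g + K) / K is a positive density whose measure agrees with Lebesgue
  measure on boxes, hence everywhere; by uniqueness of densities it equals 1 almost
  everywhere.\<close>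

lemma AE_0_if_box_integrals_0:
  fixes g :: "'a::euclidean_space \<Rightarrow> real"
  assumes g [measurable]: "g \<in> borel_measurable borel" and bound: "AE x in lborel. \<bar>g x\<bar> \<le> C"
    and zero: "\<And>a b. integral\<^sup>L lborel (\<lambda>x. g x * indicator (box a b) x) = 0"
  shows "AE x in lborel. g x = 0"
proof -
  define K where "K = \<bar>C\<bar> + 1"
  have K: "0 < K" by (simp add: K_def)
  define h where "h x = ennreal ((g x + K) / K)" for x
  have [measurable]: "h \<in> borel_measurable borel" unfolding h_def by measurable
  have "lborel = density lborel h"
  proof (rule lborel_eqI)
    fix l u :: 'a assume lu: "\<And>b. b \<in> Basis \<Longrightarrow> l \<bullet> b \<le> u \<bullet> b"
    have ind: "integrable lborel (\<lambda>x. indicator (box l u) x :: real)"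
      by (intro integrable_real_indicator) (auto simp: emeasure_lborel_box_eq)
    have gind: "integrable lborel (\<lambda>x. g x * indicator (box l u) x)"
      by (rule Bochner_Integration.integrable_bound[OF integrable_mult_right[OF ind, of K]])
         (use bound in \<open>auto elim!: eventually_mono simp: K_def split: split_indicator\<close>)
    have hk: "integrable lborel (\<lambda>x. (g x * indicator (box l u) x + K * indicator (box l u) x) / K)"
      using gind ind by (intro integrable_divide Bochner_Integration.integrable_add integrable_mult_right)
    have "emeasure (density lborel h) (box l u) = (\<integral>\<^sup>+x. h x * indicator (box l u) x \<partial>lborel)"
      by (simp add: emeasure_density)
    also have "\<dots> = (\<integral>\<^sup>+x. ennreal ((g x * indicator (box l u) x + K * indicator (box l u) x) / K) \<partial>lborel)"
      by (rule nn_integral_cong) (auto simp: h_def split: split_indicator)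
    also have "\<dots> = ennreal (\<integral>x. (g x * indicator (box l u) x + K * indicator (box l u) x) / K \<partial>lborel)"
      by (rule nn_integral_eq_integral[OF hk])
         (use bound in \<open>auto elim!: eventually_mono simp: K_def split: split_indicator\<close>)
    also have "(\<integral>x. (g x * indicator (box l u) x + K * indicator (box l u) x) / K \<partial>lborel)
        = ((\<integral>x. g x * indicator (box l u) x \<partial>lborel) + K * (\<integral>x. indicator (box l u) x \<partial>lborel)) / K"
      using gind ind by simp
    also have "\<dots> = measure lborel (box l u)"
      using K by (simp add: zero)
    also have "ennreal \<dots> = emeasure lborel (box l u)"
      by (rule emeasure_eq_ennreal_measure[symmetric]) (simp add: emeasure_lborel_box_eq)
    also have "\<dots> = (\<Prod>b\<in>Basis. (u - l) \<bullet> b)"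
      using lu by (simp add: emeasure_lborel_box_eq)
    finally show "emeasure (density lborel h) (box l u) = (\<Prod>b\<in>Basis. (u - l) \<bullet> b)" .
  qed simp
  then have "density lborel h = density lborel (\<lambda>_. 1)" by (simp add: density_1)
  then have "AE x in lborel. h x = 1"
    by (intro sigma_finite_measure.density_unique[OF sigma_finite_lborel]) auto
  with bound show ?thesis
  proof eventually_elim
    fix x assume x: "\<bar>g x\<bar> \<le> C" "h x = 1"
    have "0 \<le> (g x + K) / K" using x K by (simp add: K_def)
    then have "(g x + K) / K = 1" using x by (simp add: h_def ennreal_eq_1)
    then show "g x = 0" using K by (simp add: field_simps)
  qed
qed

text \<open>Continuity of translations in L^1 for a box: pointwise convergence off the boundary,
  dominated by twice the indicator of a large ball.\<close>

lemma indicator_box_translate_integral_tendsto_0: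
  fixes a b w :: "'a::euclidean_space"
  assumes t: "t \<longlonglongrightarrow> 0"
  shows "(\<lambda>m. \<integral>x. \<bar>indicator (box a b) (x - t m *\<^sub>R w) - indicator (box a b) x\<bar> \<partial>lborel) \<longlonglongrightarrow> (0::real)"
proof -
  obtain T where T: "\<And>m. norm (t m) \<le> T" using convergent_imp_Bseq[OF convergentI[OF t]] by (auto simp: Bseq_def)
  obtain R where R: "box a b \<subseteq> cball 0 R" using bounded_box[of a b] bounded_subset_ballD[of "box a b" 0] by (metis ball_subset_cball subset_trans)
  have wbound: "integrable lborel (\<lambda>x::'a. 2 * indicator (cball 0 (R + T * norm w)) x :: real)"
    by (intro integrable_mult_right integrable_real_indicator) (auto simp: emeasure_lborel_cball_finite[unfolded infinity_ennreal_def])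
  have lim: "AE x in lborel. (\<lambda>m. \<bar>indicator (box a b) (x - t m *\<^sub>R w) - indicator (box a b) x\<bar>) \<longlonglongrightarrow> (0::real)"
  proof -
    have "cbox a b - box a b \<in> null_sets lborel"
      using negligible_frontier_interval[of a b] by (simp add: negligible_iff_null_sets null_sets_completion_iff)
    then have "AE x in lborel. x \<notin> cbox a b - box a b" by (rule AE_not_in)
    then show ?thesis
    proof eventually_elim
      fix x assume x: "x \<notin> cbox a b - box a b"
      have lim: "(\<lambda>m. x - t m *\<^sub>R w) \<longlonglongrightarrow> x"
        using tendsto_diff[OF tendsto_const[of x] tendsto_scaleR[OF t tendsto_const[of w]]] by simp
      have "\<forall>\<^sub>F m in sequentially. (x - t m *\<^sub>R w \<in> box a b) = (x \<in> box a b)"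
      proof (cases "x \<in> box a b")
        case True
        then show ?thesis using topological_tendstoD[OF lim open_box True] by simp
      next
        case False
        with x have "x \<in> - cbox a b" by auto
        moreover have "open (- cbox a b)" by (simp add: open_Compl closed_cbox)
        ultimately have "\<forall>\<^sub>F m in sequentially. x - t m *\<^sub>R w \<in> - cbox a b"
          using topological_tendstoD[OF lim] by blast
        then show ?thesis
          by eventually_elim (use False box_subset_cbox in auto)
      qed
      then have "\<forall>\<^sub>F m in sequentially. \<bar>indicator (box a b) (x - t m *\<^sub>R w) - indicator (box a b) x\<bar> = (0::real)"
        by eventually_elim (auto split: split_indicator)
      then show "(\<lambda>m. \<bar>indicator (box a b) (x - t m *\<^sub>R w) - indicator (box a b) x\<bar>) \<longlonglongrightarrow> (0::real)"
        by (rule tendsto_eventually)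
    qed
  qed
  have abs_diff_le: "0 \<le> p \<Longrightarrow> 0 \<le> q \<Longrightarrow> p \<le> r \<Longrightarrow> q \<le> r \<Longrightarrow> \<bar>p - q\<bar> \<le> 2 * r" for p q r :: real
    by linarith
  have "(\<lambda>m. \<integral>x. \<bar>indicator (box a b) (x - t m *\<^sub>R w) - indicator (box a b) x\<bar> \<partial>lborel) \<longlonglongrightarrow> (\<integral>x. (0::real) \<partial>(lborel :: 'a measure))"
  proof (rule integral_dominated_convergence[OF _ _ wbound lim])
    fix m
    have ind1: "indicator (box a b) (x - t m *\<^sub>R w) \<le> (indicator (cball 0 (R + T * norm w)) x :: real)" for x
    proof (cases "x - t m *\<^sub>R w \<in> box a b")
      case True
      then have "norm (x - t m *\<^sub>R w) \<le> R" using R by auto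
      moreover have "norm x \<le> norm (x - t m *\<^sub>R w) + norm (t m *\<^sub>R w)"
        using norm_triangle_ineq[of "x - t m *\<^sub>R w" "t m *\<^sub>R w"] by simp
      moreover have "norm (t m *\<^sub>R w) \<le> T * norm w"
        using T[of m] by (simp add: mult_right_mono)
      ultimately have "x \<in> cball 0 (R + T * norm w)" by simp
      then show ?thesis by (simp split: split_indicator)
    qed simp
    have ind2: "indicator (box a b) x \<le> (indicator (cball 0 (R + T * norm w)) x :: real)" for x
    proof (cases "x \<in> box a b")
      case True
      have "0 \<le> T" using T[of 0] norm_ge_zero order_trans by blast
      with True have "x \<in> cball 0 (R + T * norm w)" using R by (auto intro!: add_increasing2)
      then show ?thesis by (simp split: split_indicator)
    qed simp
    have "norm \<bar>indicator (box a b) (x - t m *\<^sub>R w) - indicator (box a b) x :: real\<bar>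
        \<le> (2 * indicator (cball 0 (R + T * norm w)) x :: real)" for x
      by (simp only: real_norm_def abs_abs abs_diff_le[OF indicator_pos_le indicator_pos_le ind1 ind2])
    then show "AE x in lborel. norm \<bar>indicator (box a b) (x - t m *\<^sub>R w) - indicator (box a b) x :: real\<bar>
        \<le> (2 * indicator (cball 0 (R + T * norm w)) x :: real)"
      by (intro AE_I2)
  qed simp_all
  then show ?thesis by simp
qed

text \<open>Integrated over a box, the defect of additivity is a difference of translates of an
  increment of size L |v| h. Moving the translation to the indicator leaves the L^1 distance of two
  nearly equal boxes, so the limit defect has zero integral over every box.\<close>

lemma lipschitz_dir_deriv_additive_ae:
  fixes f :: "'a::euclidean_space \<Rightarrow> real"
  assumes lip: "\<And>x y. \<bar>f x - f y\<bar> \<le> L * norm (x - y)"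
  shows "AE x in lborel. \<exists>\<alpha> \<beta>. (dir_quot f v x \<longlongrightarrow> \<alpha>) (at 0) \<and> (dir_quot f w x \<longlongrightarrow> \<beta>) (at 0)
      \<and> (dir_quot f (v + w) x \<longlongrightarrow> \<alpha> + \<beta>) (at 0)"
proof -
  have L: "0 \<le> L" by (rule lipschitz_const_nonneg[OF lip])
  have cont: "continuous_on UNIV f"
    by (rule lipschitz_on_continuous_on[of L]) (auto simp: lipschitz_on_def dist_norm lip L)
  have fb[measurable]: "f \<in> borel_measurable borel"
    using cont by (rule borel_measurable_continuous_onI)
  have [measurable]: "(\<lambda>x. dir_quot f v x h) \<in> borel_measurable borel" for v h
    by (rule dir_quot_borel[OF cont])
  define t :: "nat \<Rightarrow> real" where "t m = 1 / Suc m" for m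
  have t0: "t \<longlonglongrightarrow> 0" "t m > 0" for m
    using LIMSEQ_inverse_real_of_nat by (simp_all add: t_def[abs_def] inverse_eq_divide)
  have tat: "filterlim t (at 0) sequentially"
    using t0 by (auto simp: filterlim_at intro!: always_eventually less_imp_neq[symmetric])
  define D where "D v x = lim (\<lambda>m. dir_quot f v x (t m))" for v x
  have [measurable]: "D v \<in> borel_measurable borel" for v
    unfolding D_def by measurable
  have D: "AE x in lborel. (dir_quot f v x \<longlongrightarrow> D v x) (at 0)" for v
    using lipschitz_dir_quot_converges_ae[OF lip, of v]
  proof eventually_elim
    fix x assume "\<exists>l. (dir_quot f v x \<longlongrightarrow> l) (at 0)"
    then obtain l where l: "(dir_quot f v x \<longlongrightarrow> l) (at 0)" by blast
    then have "(\<lambda>m. dir_quot f v x (t m)) \<longlonglongrightarrow> l" by (rule filterlim_compose[OF _ tat])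
    then have "D v x = l" unfolding D_def by (rule limI)
    with l show "(dir_quot f v x \<longlongrightarrow> D v x) (at 0)" by simp
  qed
  have qb: "\<bar>dir_quot f v x h\<bar> \<le> L * norm v" if "h \<noteq> 0" for v x h
    using lip[of "x + h *\<^sub>R v" x] that by (simp add: dir_quot_def divide_le_eq mult_ac)
  define s where "s m x = dir_quot f (v + w) x (t m) - dir_quot f v x (t m) - dir_quot f w x (t m)" for m x
  define g where "g x = D (v + w) x - D v x - D w x" for x
  define C where "C = L * norm (v + w) + L * norm v + L * norm w"
  have C0: "0 \<le> C" using L by (simp add: C_def)
  have sb: "\<bar>s m x\<bar> \<le> C" for m x
    using qb[of "t m" "v + w" x] qb[of "t m" v x] qb[of "t m" w x] t0(2)[of m]
    unfolding s_def C_def by linarith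
  have slim: "AE x in lborel. (\<lambda>m. s m x) \<longlonglongrightarrow> g x"
    using D[of v] D[of w] D[of "v + w"]
  proof eventually_elim
    case (elim x)
    then show ?case unfolding s_def g_def
      by (intro tendsto_diff filterlim_compose[OF _ tat])
  qed
  have gb: "AE x in lborel. \<bar>g x\<bar> \<le> C"
    using slim
  proof eventually_elim
    fix x assume "(\<lambda>m. s m x) \<longlonglongrightarrow> g x"
    then have "(\<lambda>m. \<bar>s m x\<bar>) \<longlonglongrightarrow> \<bar>g x\<bar>" by (rule tendsto_rabs)
    then show "\<bar>g x\<bar> \<le> C" by (rule LIMSEQ_le_const2) (use sb in auto)
  qed
  have "AE x in lborel. g x = 0"
  proof (rule AE_0_if_box_integrals_0[OF _ gb])
    show "g \<in> borel_measurable borel" unfolding g_def by measurable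
    fix a b :: 'a
    let ?I = "\<lambda>x. indicator (box a b) x :: real"
    have ind: "integrable lborel ?I"
      by (intro integrable_real_indicator) (auto simp: emeasure_lborel_box_eq)
    have lim1: "(\<lambda>m. \<integral>x. s m x * ?I x \<partial>lborel) \<longlonglongrightarrow> (\<integral>x. g x * ?I x \<partial>lborel)"
    proof (rule integral_dominated_convergence[OF _ _ integrable_mult_right[OF ind, of C]])
      show "AE x in lborel. (\<lambda>m. s m x * ?I x) \<longlonglongrightarrow> g x * ?I x"
        using slim by eventually_elim (intro tendsto_mult tendsto_const)
      show "AE x in lborel. norm (s m x * ?I x) \<le> C * ?I x" for m
        using sb[of m] C0 by (intro AE_I2) (auto split: split_indicator)
    qed (auto simp: g_def s_def)
    have "norm (\<integral>x. s m x * ?I x \<partial>lborel) \<le> L * norm v * (\<integral>x. \<bar>?I (x - t m *\<^sub>R w) - ?I x\<bar> \<partial>lborel)" for m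
    proof -
      let ?h = "t m"
      \<comment> \<open>The defect is the second difference (F (x + h w) - F x) / h, and the bound
        of \<open>F\<close> cancels the division by h.\<close>
      define F where "F x = f (x + ?h *\<^sub>R v) - f x" for x
      have [measurable]: "F \<in> borel_measurable borel" unfolding F_def by measurable
      have Fb: "\<bar>F x\<bar> \<le> L * norm v * ?h" for x
        using lip[of "x + ?h *\<^sub>R v" x] t0(2)[of m] by (simp add: F_def mult_ac)
      have Fb': "norm (F x * c) \<le> norm (L * norm v * ?h * c)" for x c
        using mult_right_mono[OF Fb[of x], of "\<bar>c\<bar>"] L t0(2)[of m] by (simp add: abs_mult)
      have Iw: "integrable lborel (\<lambda>x. ?I (x - ?h *\<^sub>R w))"
      proof -
        have "integrable (distr lborel borel ((+) (- (?h *\<^sub>R w)))) ?I" using ind by (simp add: lborel_distr_plus)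
        then show ?thesis by (subst (asm) integrable_distr_eq) auto
      qed
      have FI: "integrable lborel (\<lambda>x. F x * ?I x)"
        by (rule Bochner_Integration.integrable_bound[OF integrable_mult_right[OF ind, of "L * norm v * ?h"]])
           (use Fb' in auto)
      have FIw: "integrable lborel (\<lambda>x. F x * ?I (x - ?h *\<^sub>R w))"
        by (rule Bochner_Integration.integrable_bound[OF integrable_mult_right[OF Iw, of "L * norm v * ?h"]])
           (use Fb' in auto)
      have eqw: "has_bochner_integral lborel (\<lambda>x. F (x + ?h *\<^sub>R w) * ?I x) (\<integral>x. F x * ?I (x - ?h *\<^sub>R w) \<partial>lborel)"
      proof -
        have m1: "(\<lambda>x. F x * ?I (x - ?h *\<^sub>R w)) \<in> borel_measurable borel" by measurable
        have "integrable lborel (\<lambda>x. F (?h *\<^sub>R w + x) * ?I (?h *\<^sub>R w + x - ?h *\<^sub>R w))"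
          using FIw m1 integrable_distr_eq[of "(+) (?h *\<^sub>R w)" lborel borel "\<lambda>x. F x * ?I (x - ?h *\<^sub>R w)"]
          by (simp add: lborel_distr_plus)
        moreover have "(\<integral>x. F x * ?I (x - ?h *\<^sub>R w) \<partial>lborel) = (\<integral>x. F (?h *\<^sub>R w + x) * ?I (?h *\<^sub>R w + x - ?h *\<^sub>R w) \<partial>lborel)"
          using m1 integral_distr[of "(+) (?h *\<^sub>R w)" lborel borel "\<lambda>x. F x * ?I (x - ?h *\<^sub>R w)"]
          by (simp add: lborel_distr_plus)
        ultimately show ?thesis by (simp add: has_bochner_integral_iff add.commute)
      qed
      have "s m x * ?I x = (F (x + ?h *\<^sub>R w) * ?I x - F x * ?I x) / ?h" for x
        by (simp add: s_def dir_quot_def F_def diff_divide_distrib scaleR_add_right add_ac left_diff_distrib)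
      then have "(\<integral>x. s m x * ?I x \<partial>lborel) = ((\<integral>x. F x * ?I (x - ?h *\<^sub>R w) \<partial>lborel) - (\<integral>x. F x * ?I x \<partial>lborel)) / ?h"
        using eqw FI by (simp add: has_bochner_integral_iff)
      also have "\<dots> = (\<integral>x. F x * (?I (x - ?h *\<^sub>R w) - ?I x) \<partial>lborel) / ?h"
        using FI FIw by (simp add: right_diff_distrib)
      finally have "norm (\<integral>x. s m x * ?I x \<partial>lborel) = \<bar>\<integral>x. F x * (?I (x - ?h *\<^sub>R w) - ?I x) \<partial>lborel\<bar> / ?h"
        using t0(2)[of m] by simp
      also have "\<bar>\<integral>x. F x * (?I (x - ?h *\<^sub>R w) - ?I x) \<partial>lborel\<bar> \<le> (\<integral>x. \<bar>F x * (?I (x - ?h *\<^sub>R w) - ?I x)\<bar> \<partial>lborel)"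
        by (rule integral_abs_bound)
      also have "\<dots> \<le> (\<integral>x. (L * norm v * ?h) * \<bar>?I (x - ?h *\<^sub>R w) - ?I x\<bar> \<partial>lborel)"
      proof (rule integral_mono)
        show "integrable lborel (\<lambda>x. \<bar>F x * (?I (x - ?h *\<^sub>R w) - ?I x)\<bar>)"
          using FI FIw by (simp add: right_diff_distrib)
        show "integrable lborel (\<lambda>x. (L * norm v * ?h) * \<bar>?I (x - ?h *\<^sub>R w) - ?I x\<bar>)"
          using ind Iw by (intro integrable_mult_right integrable_abs Bochner_Integration.integrable_diff)
        show "\<bar>F x * (?I (x - ?h *\<^sub>R w) - ?I x)\<bar> \<le> (L * norm v * ?h) * \<bar>?I (x - ?h *\<^sub>R w) - ?I x\<bar>" for x
          using Fb[of x] by (simp only: abs_mult) (intro mult_right_mono, auto)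
      qed
      also have "\<dots> = (L * norm v * ?h) * (\<integral>x. \<bar>?I (x - ?h *\<^sub>R w) - ?I x\<bar> \<partial>lborel)"
        by (rule integral_mult_right_zero)
      finally show ?thesis using t0(2)[of m] by (simp add: divide_right_mono)
    qed
    then have ev: "\<forall>\<^sub>F m in sequentially. norm (\<integral>x. s m x * ?I x \<partial>lborel) \<le> L * norm v * (\<integral>x. \<bar>?I (x - t m *\<^sub>R w) - ?I x\<bar> \<partial>lborel)"
      by (intro always_eventually allI)
    have lim2: "(\<lambda>m. \<integral>x. s m x * ?I x \<partial>lborel) \<longlonglongrightarrow> 0"
      by (rule Lim_null_comparison[OF ev])
         (rule tendsto_mult_right_zero[OF indicator_box_translate_integral_tendsto_0[OF t0(1)]])
    show "(\<integral>x. g x * ?I x \<partial>lborel) = 0"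
      using LIMSEQ_unique[OF lim1 lim2] .
  qed
  with D[of v] D[of w] D[of "v + w"] show ?thesis
  proof eventually_elim
    case (elim x)
    then have "D (v + w) x = D v x + D w x" by (simp add: g_def)
    with elim show ?case by metis
  qed
qed

lemma dir_quot_scale:
  assumes "(dir_quot f v x \<longlongrightarrow> l) (at 0)"
  shows "(dir_quot f (c *\<^sub>R v) x \<longlongrightarrow> c * l) (at 0)"
proof (cases "c = 0")
  case True
  then have "dir_quot f (c *\<^sub>R v) x = (\<lambda>h. 0)" by (simp add: dir_quot_def fun_eq_iff)
  with True show ?thesis by simp
next
  case False
  have "filterlim (\<lambda>h. c * h) (at 0) (at (0::real))"
    using False by (auto simp: filterlim_at eventually_at intro!: tendsto_eq_intros exI[of _ 1])
  then have "((\<lambda>h. c * dir_quot f v x (c * h)) \<longlongrightarrow> c * l) (at 0)"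
    by (intro tendsto_mult tendsto_const filterlim_compose[OF assms])
  moreover have "(\<lambda>h. c * dir_quot f v x (c * h)) = dir_quot f (c *\<^sub>R v) x"
    using False by (auto simp: dir_quot_def fun_eq_iff mult_ac)
  ultimately show ?thesis by simp
qed

text \<open>One null set has to serve all \<open>v\<close> in \<open>V\<close>, hence countability.
  The coefficients are obtained separately for each \<open>v\<close>; uniqueness of limits on the
  basis vectors identifies them.\<close>

lemma lipschitz_dir_deriv_linear_ae:
  fixes f :: "'a::euclidean_space \<Rightarrow> real"
  assumes lip: "\<And>x y. \<bar>f x - f y\<bar> \<le> L * norm (x - y)"
    and V: "countable V"
  shows "AE x in lborel. \<exists>D. \<forall>v\<in>V. (dir_quot f v x \<longlongrightarrow> D \<bullet> v) (at 0)"
proof -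
  have part: "AE x in lborel. \<exists>D. (\<forall>b\<in>B. (dir_quot f b x \<longlongrightarrow> D b) (at 0))
      \<and> (dir_quot f (\<Sum>b\<in>B. (v \<bullet> b) *\<^sub>R b) x \<longlongrightarrow> (\<Sum>b\<in>B. (v \<bullet> b) * D b)) (at 0)"
    if "finite B" for B v
    using that
  proof (induction B)
    case empty
    have "dir_quot f 0 x = (\<lambda>h. 0)" for x by (simp add: dir_quot_def fun_eq_iff)
    then show ?case by simp
  next
    case (insert b B)
    from insert.IH lipschitz_dir_quot_converges_ae[OF lip, of b]
      lipschitz_dir_deriv_additive_ae[OF lip, of "(v \<bullet> b) *\<^sub>R b" "\<Sum>b\<in>B. (v \<bullet> b) *\<^sub>R b"]
    show ?case
    proof eventually_elim
      case (elim x)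
      then obtain D l where D: "\<forall>b\<in>B. (dir_quot f b x \<longlongrightarrow> D b) (at 0)"
        "(dir_quot f (\<Sum>b\<in>B. (v \<bullet> b) *\<^sub>R b) x \<longlongrightarrow> (\<Sum>b\<in>B. (v \<bullet> b) * D b)) (at 0)"
        and l: "(dir_quot f b x \<longlongrightarrow> l) (at 0)" by blast
      from elim(3) obtain \<alpha> \<beta> where *: "(dir_quot f ((v \<bullet> b) *\<^sub>R b) x \<longlongrightarrow> \<alpha>) (at 0)"
        "(dir_quot f (\<Sum>b\<in>B. (v \<bullet> b) *\<^sub>R b) x \<longlongrightarrow> \<beta>) (at 0)"
        "(dir_quot f ((v \<bullet> b) *\<^sub>R b + (\<Sum>b\<in>B. (v \<bullet> b) *\<^sub>R b)) x \<longlongrightarrow> \<alpha> + \<beta>) (at 0)" by blast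
      have "\<alpha> = (v \<bullet> b) * l" using dir_quot_scale[OF l, of "v \<bullet> b"] *(1) tendsto_unique[OF at_neq_bot] by blast
      moreover have "\<beta> = (\<Sum>b\<in>B. (v \<bullet> b) * D b)" using D(2) *(2) tendsto_unique[OF at_neq_bot] by blast
      ultimately have "(dir_quot f (\<Sum>b\<in>insert b B. (v \<bullet> b) *\<^sub>R b) x \<longlongrightarrow> (v \<bullet> b) * l + (\<Sum>b\<in>B. (v \<bullet> b) * D b)) (at 0)"
        using *(3) insert.hyps by simp
      moreover have "(v \<bullet> b) * l + (\<Sum>b\<in>B. (v \<bullet> b) * D b) = (\<Sum>c\<in>insert b B. (v \<bullet> c) * (D(b := l)) c)"
        using insert.hyps by (auto intro!: sum.cong)
      ultimately show ?case
        using D(1) l insert.hyps by (intro exI[of _ "D(b := l)"]) auto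
    qed
  qed
  have "AE x in lborel. \<forall>v\<in>V. \<exists>D. (\<forall>b\<in>Basis. (dir_quot f b x \<longlongrightarrow> D b) (at 0))
      \<and> (dir_quot f v x \<longlongrightarrow> (\<Sum>b\<in>Basis. (v \<bullet> b) * D b)) (at 0)"
    using V part[OF finite_Basis] by (simp add: AE_ball_countable euclidean_representation)
  moreover have "AE x in lborel. \<exists>D. (\<forall>b\<in>Basis. (dir_quot f b x \<longlongrightarrow> D b) (at 0))"
    using part[OF finite_Basis, of 0] by eventually_elim blast
  ultimately show ?thesis
  proof eventually_elim
    case (elim x)
    from elim(2) obtain D where D: "\<forall>b\<in>Basis. (dir_quot f b x \<longlongrightarrow> D b) (at 0)" by blast
    have "(dir_quot f v x \<longlongrightarrow> (\<Sum>b\<in>Basis. D b *\<^sub>R b) \<bullet> v) (at 0)" if "v \<in> V" for v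
    proof -
      from elim(1) that obtain D' where D': "\<forall>b\<in>Basis. (dir_quot f b x \<longlongrightarrow> D' b) (at 0)"
        "(dir_quot f v x \<longlongrightarrow> (\<Sum>b\<in>Basis. (v \<bullet> b) * D' b)) (at 0)" by blast
      have "D' b = D b" if "b \<in> Basis" for b
        using D D' that tendsto_unique[OF at_neq_bot] by blast
      then have "(\<Sum>b\<in>Basis. (v \<bullet> b) * D' b) = (\<Sum>b\<in>Basis. D b *\<^sub>R b) \<bullet> v"
        by (simp add: inner_sum_left inner_commute[of v] mult.commute)
      with D' show ?thesis by simp
    qed
    then show ?case by blast
  qed
qed

text \<open>By compactness finitely many directions of \<open>V\<close> come within \<delta> of
  every unit vector. Their difference quotients converge uniformly, and the Lipschitz bound passes
  to the remaining directions.\<close>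

lemma differentiable_if_dense_dir_derivs:
  fixes f :: "'a::euclidean_space \<Rightarrow> real"
  assumes lip: "\<And>x y. \<bar>f x - f y\<bar> \<le> L * norm (x - y)"
    and dense: "\<And>u e. 0 < e \<Longrightarrow> \<exists>v\<in>V. norm (u - v) < e"
    and D: "\<And>v. v \<in> V \<Longrightarrow> (dir_quot f v x \<longlongrightarrow> D \<bullet> v) (at 0)"
  shows "(f has_derivative (\<lambda>v. D \<bullet> v)) (at x)"
proof -
  have L: "0 \<le> L" by (rule lipschitz_const_nonneg[OF lip])
  show ?thesis
    unfolding has_derivative_at_alt
  proof (intro conjI allI impI)
    show "bounded_linear (\<lambda>v. D \<bullet> v)" by (rule bounded_linear_inner_right)
    fix e :: real assume e: "0 < e"
    \<comment> \<open>Changing the direction by \<delta> costs (L + |D|) \<delta> \<le> e/3 per unit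
      length, and the difference quotient costs another e/3.\<close>
    define K where "K = L + norm D + 1"
    define \<delta> where "\<delta> = e / (3 * K)"
    have pos: "0 < K" unfolding K_def using L by (intro add_nonneg_pos) auto
    have \<delta>: "0 < \<delta>" using e pos by (simp add: \<delta>_def)
    have cov: "sphere 0 1 \<subseteq> (\<Union>v\<in>V. ball v \<delta>)"
    proof
      fix u :: 'a assume "u \<in> sphere 0 1"
      obtain v where "v \<in> V" "norm (u - v) < \<delta>" using dense[OF \<delta>] by blast
      then show "u \<in> (\<Union>v\<in>V. ball v \<delta>)" by (auto simp: dist_norm norm_minus_commute)
    qed
    have "compact (sphere (0::'a) 1)" by simp
    then obtain V0 where V0: "V0 \<subseteq> V" "finite V0" "sphere 0 1 \<subseteq> (\<Union>v\<in>V0. ball v \<delta>)"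
      by (rule compactE_image[OF _ _ cov]) auto
    have "eventually (\<lambda>h. \<forall>v\<in>V0. \<bar>dir_quot f v x h - D \<bullet> v\<bar> < e / 3) (at 0)"
    proof (rule eventually_ball_finite[OF V0(2)], rule ballI)
      fix v assume "v \<in> V0"
      then have "(dir_quot f v x \<longlongrightarrow> D \<bullet> v) (at 0)" using V0(1) D by blast
      then show "eventually (\<lambda>h. \<bar>dir_quot f v x h - D \<bullet> v\<bar> < e / 3) (at 0)"
        using e tendstoD[of "dir_quot f v x" "D \<bullet> v" "at 0" "e / 3"] by (simp add: dist_real_def)
    qed
    then obtain d where d: "d > 0" "\<And>h v. h \<noteq> 0 \<Longrightarrow> \<bar>h\<bar> < d \<Longrightarrow> v \<in> V0 \<Longrightarrow> \<bar>dir_quot f v x h - D \<bullet> v\<bar> < e / 3"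
      by (auto simp: eventually_at dist_real_def)
    show "\<exists>d>0. \<forall>y. norm (y - x) < d \<longrightarrow> norm (f y - f x - D \<bullet> (y - x)) \<le> e * norm (y - x)"
    proof (intro exI[of _ d] conjI allI impI)
      fix y assume y: "norm (y - x) < d"
      show "norm (f y - f x - D \<bullet> (y - x)) \<le> e * norm (y - x)"
      proof (cases "y = x")
        case False
        define h where "h = norm (y - x)"
        have h: "0 < h" "h < d" using y False by (auto simp: h_def)
        define u where "u = (y - x) /\<^sub>R h"
        have u: "norm u = 1" "y = x + h *\<^sub>R u" using h False by (auto simp: u_def h_def)
        then obtain v where v: "v \<in> V0" "norm (u - v) < \<delta>"
          using V0(3) by (auto simp: dist_norm norm_minus_commute subset_iff)
        have "\<bar>f y - f (x + h *\<^sub>R v)\<bar> \<le> L * (h * \<delta>)"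
        proof -
          have "\<bar>f y - f (x + h *\<^sub>R v)\<bar> \<le> L * norm (h *\<^sub>R (u - v))"
            using lip[of y "x + h *\<^sub>R v"] u by (simp add: scaleR_diff_right)
          also have "\<dots> \<le> L * (h * \<delta>)" using v h L by (auto intro!: mult_left_mono)
          finally show ?thesis .
        qed
        moreover have "\<bar>f (x + h *\<^sub>R v) - f x - h * (D \<bullet> v)\<bar> \<le> h * (e / 3)"
        proof -
          have "f (x + h *\<^sub>R v) - f x - h * (D \<bullet> v) = h * (dir_quot f v x h - D \<bullet> v)"
            using h by (simp add: dir_quot_def field_simps)
          then show ?thesis using d(2)[of h v] v h by (simp add: abs_mult)
        qed
        moreover have "\<bar>h * (D \<bullet> v) - D \<bullet> (y - x)\<bar> \<le> h * (norm D * \<delta>)"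
        proof -
          have "h * (D \<bullet> v) - D \<bullet> (y - x) = h * (D \<bullet> (v - u))"
            using u by (simp add: inner_diff_right algebra_simps)
          moreover have "\<bar>D \<bullet> (v - u)\<bar> \<le> norm D * \<delta>"
            using Cauchy_Schwarz_ineq2[of D "v - u"] v mult_left_mono[of "norm (v - u)" \<delta> "norm D"]
            by (simp add: norm_minus_commute)
          ultimately show ?thesis using h by (simp add: abs_mult)
        qed
        ultimately have "\<bar>f y - f x - D \<bullet> (y - x)\<bar> \<le> L * (h * \<delta>) + h * (e / 3) + h * (norm D * \<delta>)"
          by linarith
        also have "\<dots> = h * ((L + norm D) * \<delta> + e / 3)" by (simp add: algebra_simps)
        also have "\<dots> \<le> h * e"
        proof (rule mult_left_mono)
          have "(L + norm D) * \<delta> \<le> K * \<delta>" using \<delta> by (simp add: K_def)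
          also have "\<dots> = e / 3" using pos by (simp add: \<delta>_def)
          finally show "(L + norm D) * \<delta> + e / 3 \<le> e" using e by simp
        qed (use h in simp)
        finally show ?thesis by (simp add: h_def mult.commute)
      qed simp
    qed (use d in simp)
  qed
qed

theorem rademacher_real:
  fixes f :: "'a::euclidean_space \<Rightarrow> real"
  assumes lip: "\<And>x y. \<bar>f x - f y\<bar> \<le> L * norm (x - y)"
  shows "AE x in lborel. f differentiable (at x)"
proof -
  obtain V :: "'a set" where V: "countable V" "\<And>X. open X \<Longrightarrow> X \<noteq> {} \<Longrightarrow> \<exists>d\<in>V. d \<in> X"
    using countable_dense_setE by blast
  have dense: "\<exists>v\<in>V. norm (u - v) < e" if "0 < e" for u e
    using V(2)[of "ball u e"] that by (auto simp: dist_norm)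
  from lipschitz_dir_deriv_linear_ae[OF lip V(1)] show ?thesis
  proof eventually_elim
    case (elim x)
    then obtain D where "\<And>v. v \<in> V \<Longrightarrow> (dir_quot f v x \<longlongrightarrow> D \<bullet> v) (at 0)" by blast
    from differentiable_if_dense_dir_derivs[OF lip dense this] show ?case
      by (auto simp: differentiable_def)
  qed
qed

theorem rademacher:
  fixes f :: "'a::euclidean_space \<Rightarrow> 'b::euclidean_space"
  assumes lip: "\<And>x y. norm (f x - f y) \<le> L * norm (x - y)"
  shows "AE x in lborel. f differentiable (at x)"
proof -
  have "AE x in lborel. \<forall>b\<in>Basis. (\<lambda>x. f x \<bullet> b) differentiable (at x)"
  proof (rule AE_ball_countable')
    fix b :: 'b assume b: "b \<in> Basis"
    show "AE x in lborel. (\<lambda>x. f x \<bullet> b) differentiable (at x)"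
    proof (rule rademacher_real)
      fix x y
      show "\<bar>f x \<bullet> b - f y \<bullet> b\<bar> \<le> L * norm (x - y)"
        using Basis_le_norm[OF b, of "f x - f y"] lip[of x y] by (simp add: inner_diff_left)
    qed
  qed (simp add: countable_finite)
  then show ?thesis
    by eventually_elim (rule differentiable_componentwise_within[THEN iffD2])
qed

section \<open>Symmetric matrices and the Pucci operator\<close>

definition diag_mat :: "('n \<Rightarrow> 'a::zero) \<Rightarrow> 'a^'n^'n" where
  "diag_mat d = (\<chi> i j. if i = j then d i else 0)"

text \<open>The spectral theorem by induction on the dimension of an invariant subspace: a maximizer
  of the quadratic form on its unit sphere is an eigenvector, and the orthogonal complement within
  the subspace is again invariant.\<close>

lemma selfadjoint_orthonormal_eigenbasis:
  fixes f :: "'a::euclidean_space \<Rightarrow> 'a"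
  assumes f: "linear f" and sa: "\<And>x y. f x \<bullet> y = x \<bullet> f y"
  shows "subspace S \<Longrightarrow> f ` S \<subseteq> S \<Longrightarrow> dim S = m \<Longrightarrow>
    \<exists>B\<subseteq>S. finite B \<and> card B = m \<and> pairwise orthogonal B \<and> (\<forall>b\<in>B. norm b = 1 \<and> (\<exists>c. f b = c *\<^sub>R b))"
proof (induction m arbitrary: S)
  case 0
  then show ?case by (intro exI[of _ "{}"]) auto
next
  case (Suc m)
  have "S \<noteq> {0}" using Suc.prems(3) by auto
  then obtain z where z: "z \<in> S" "z \<noteq> 0" using subspace_0[OF Suc.prems(1)] by blast
  have sgn: "sgn w \<in> S" if "w \<in> S" for w
    using that Suc.prems(1) by (simp add: sgn_div_norm subspace_scale)
  have contf: "continuous_on UNIV f" by (rule linear_continuous_on[OF linear_conv_bounded_linear[THEN iffD1, OF f]])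
  have cpt: "compact (S \<inter> sphere 0 1)"
    using closed_subspace[OF Suc.prems(1)] by (intro closed_Int_compact) auto
  have "continuous_on (S \<inter> sphere 0 1) (\<lambda>x. x \<bullet> f x)"
    by (intro continuous_intros continuous_on_subset[OF contf]) auto
  moreover have "sgn z \<in> S \<inter> sphere 0 1" using z sgn by (simp add: norm_sgn)
  ultimately obtain x where x: "x \<in> S \<inter> sphere 0 1" and max: "\<And>y. y \<in> S \<inter> sphere 0 1 \<Longrightarrow> y \<bullet> f y \<le> x \<bullet> f x"
    using continuous_attains_sup[OF cpt] by blast
  define \<mu> where "\<mu> = x \<bullet> f x"
  have xn: "norm x = 1" "x \<in> S" "x \<bullet> x = 1" using x by (auto simp: norm_eq_1)
  have nonneg: "0 \<le> \<mu> * (w \<bullet> w) - w \<bullet> f w" if w: "w \<in> S" for w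
  proof (cases "w = 0")
    case False
    then have "sgn w \<bullet> f (sgn w) \<le> \<mu>" unfolding \<mu>_def using w sgn by (intro max) (auto simp: norm_sgn)
    moreover have "w \<bullet> f w = (norm w)\<^sup>2 * (sgn w \<bullet> f (sgn w))"
      using False by (simp add: sgn_div_norm linear_scale[OF f] power2_eq_square field_simps)
    ultimately show ?thesis
      using mult_left_mono[of "sgn w \<bullet> f (sgn w)" \<mu> "(norm w)\<^sup>2"] by (simp add: power2_norm_eq_inner mult.commute)
  qed (simp add: linear_0[OF f])
  have fx: "f x = \<mu> *\<^sub>R x"
  proof (rule ccontr)
    \<comment> \<open>The residual of the eigenvector equation. The form \<mu> |z|^2 - z \<bullet> f
      z is nonnegative on \<open>S\<close> and zero at \<open>x\<close>, and its first order term
      along x + t w is -2 t |w|^2, so \<open>w\<close> must vanish.\<close>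
    define w where "w = f x - \<mu> *\<^sub>R x"
    assume "f x \<noteq> \<mu> *\<^sub>R x"
    then have w0: "0 < w \<bullet> w" by (simp add: w_def)
    have wS: "w \<in> S" unfolding w_def using Suc.prems xn by (intro subspace_diff subspace_scale) auto
    define c where "c = \<mu> * (w \<bullet> w) - w \<bullet> f w"
    have c: "0 \<le> c" using nonneg[OF wS] by (simp add: c_def)
    have poly: "0 \<le> - 2 * t * (w \<bullet> w) + t\<^sup>2 * c" for t
    proof -
      have "x + t *\<^sub>R w \<in> S" using Suc.prems xn wS by (intro subspace_add subspace_scale) auto
      from nonneg[OF this] have "0 \<le> \<mu> * ((x + t *\<^sub>R w) \<bullet> (x + t *\<^sub>R w)) - (x + t *\<^sub>R w) \<bullet> f (x + t *\<^sub>R w)" .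
      also have "\<dots> = (\<mu> - x \<bullet> f x) + 2 * t * (\<mu> * (x \<bullet> w) - f x \<bullet> w) + t\<^sup>2 * c"
      proof -
        have "f (x + t *\<^sub>R w) = f x + t *\<^sub>R f w" by (simp add: linear_add[OF f] linear_scale[OF f])
        moreover have "x \<bullet> f w = w \<bullet> f x" "f x \<bullet> w = w \<bullet> f x" "w \<bullet> x = x \<bullet> w"
          using sa[of x w] by (simp_all add: inner_commute)
        ultimately show ?thesis
          using xn(3) by (simp add: inner_add_left inner_add_right c_def power2_eq_square) (simp add: algebra_simps)
      qed
      also have "\<mu> * (x \<bullet> w) - f x \<bullet> w = - (w \<bullet> w)"
        by (simp add: w_def inner_diff algebra_simps inner_commute)
      finally show ?thesis by (simp add: \<mu>_def)
    qed
    show False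
    proof (cases "c = 0")
      case True with poly[of 1] w0 show False by simp
    next
      case False
      with c have c: "0 < c" by simp
      from poly[of "(w \<bullet> w) / c"] have "0 \<le> - ((w \<bullet> w)\<^sup>2 / c)"
        using c by (simp add: power2_eq_square field_simps)
      moreover have "0 < (w \<bullet> w)\<^sup>2 / c" using w0 c by simp
      ultimately show False by linarith
    qed
  qed
  define S' where "S' = {y \<in> S. \<forall>v\<in>span {x}. orthogonal v y}"
  have S'eq: "S' = {y \<in> S. x \<bullet> y = 0}"
    by (auto simp: S'_def orthogonal_def span_singleton span_base)
  have "dim S' + dim (span {x}) = dim S"
    unfolding S'_def using Suc.prems(1) xn span_minimal[of "{x}" S] by (intro dim_subspace_orthogonal_to_vectors) auto
  moreover have "dim (span {x}) = 1"
    using xn dim_singleton[of x] by (auto simp: dim_span)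
  ultimately have dimS': "dim S' = m" using Suc.prems by simp
  have subS': "subspace S'"
    unfolding S'eq using Suc.prems(1) by (auto simp: subspace_def inner_add_right)
  have fS': "f ` S' \<subseteq> S'"
  proof
    fix y assume "y \<in> f ` S'"
    then obtain u where u: "u \<in> S" "x \<bullet> u = 0" "y = f u" by (auto simp: S'eq)
    have "x \<bullet> f u = 0" using sa[of x u] u by (simp add: fx)
    moreover have "f u \<in> S" using u Suc.prems(2) by blast
    ultimately show "y \<in> S'" using u by (simp add: S'eq)
  qed
  obtain B where B: "B \<subseteq> S'" "finite B" "card B = m" "pairwise orthogonal B" "\<And>b. b \<in> B \<Longrightarrow> norm b = 1 \<and> (\<exists>c. f b = c *\<^sub>R b)"
    using Suc.IH[OF subS' fS' dimS'] by blast
  have xB: "x \<bullet> b = 0 \<and> b \<in> S" if "b \<in> B" for b using B(1) that by (auto simp: S'eq)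
  then have "x \<notin> B" using xn by force
  show ?case
  proof (intro exI[of _ "insert x B"] conjI)
    show "insert x B \<subseteq> S" using xB xn by auto
    show "card (insert x B) = Suc m" using B \<open>x \<notin> B\<close> by simp
    show "pairwise orthogonal (insert x B)"
      using B(4) xB by (simp add: pairwise_insert orthogonal_def inner_commute)
    show "\<forall>b\<in>insert x B. norm b = 1 \<and> (\<exists>c. f b = c *\<^sub>R b)"
      using B(5) xn fx by blast
  qed (use B in simp)
qed

theorem symmetric_matrix_diagonalizable:
  fixes A :: "real^'n^'n"
  assumes "transpose A = A"
  obtains Q d where "orthogonal_matrix Q" "A = Q ** diag_mat d ** transpose Q"
proof -
  have lin: "linear ((*v) A)" by (rule matrix_vector_mul_linear)
  have sa: "(A *v x) \<bullet> y = x \<bullet> (A *v y)" for x y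
    using assms dot_lmul_matrix[of x A y] by (metis dot_lmul_matrix inner_commute transpose_matrix_vector vector_transpose_matrix)
  obtain B :: "(real^'n) set" where B: "finite B" "card B = CARD('n)" "pairwise orthogonal B"
    "\<And>b. b \<in> B \<Longrightarrow> norm b = 1 \<and> (\<exists>c. A *v b = c *\<^sub>R b)"
    using selfadjoint_orthonormal_eigenbasis[OF lin sa, of UNIV "CARD('n)"] by (auto simp: dim_UNIV)
  obtain g where g: "bij_betw g (UNIV :: 'n set) B"
    using finite_same_card_bij[of "UNIV :: 'n set" B] B by auto
  have gB: "g i \<in> B" for i using g by (auto simp: bij_betw_def)
  obtain d where d: "\<And>i. A *v g i = d i *\<^sub>R g i" using B(4)[OF gB] by metis
  define Q :: "real^'n^'n" where "Q = (\<chi> i j. g j $ i)"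
  have inner: "g i \<bullet> g j = (if i = j then 1 else 0)" for i j
  proof (cases "i = j")
    case True then show ?thesis using B(4)[OF gB[of j]] by (simp add: norm_eq_1)
  next
    case False
    then have "g i \<noteq> g j" using g by (auto simp: bij_betw_def inj_on_def)
    then show ?thesis using B(3) gB False by (auto simp: pairwise_def orthogonal_def)
  qed
  have Q: "orthogonal_matrix Q"
    unfolding orthogonal_matrix
    by (simp add: vec_eq_iff matrix_matrix_mult_def transpose_def Q_def mat_def inner[unfolded inner_vec_def, simplified])
  have "A ** Q = Q ** diag_mat d"
  proof -
    have "(A ** Q) $ i $ j = (Q ** diag_mat d) $ i $ j" for i j
    proof -
      have "(A ** Q) $ i $ j = (A *v g j) $ i"
        by (simp add: matrix_matrix_mult_def matrix_vector_mult_def Q_def)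
      also have "\<dots> = (Q ** diag_mat d) $ i $ j"
        by (simp add: d matrix_matrix_mult_def Q_def diag_mat_def if_distrib cong: if_cong)
      finally show ?thesis .
    qed
    then show ?thesis by (simp add: vec_eq_iff)
  qed
  then have "A = Q ** diag_mat d ** transpose Q"
    using Q by (metis matrix_mul_assoc matrix_mul_rid orthogonal_matrix_def)
  with Q show thesis by (rule that)
qed

text \<open>Embedding of real matrices as constant polynomial matrices. It is multiplicative, so
  conjugation by an orthogonal matrix can be carried out inside \<open>charpoly\<close>.\<close>

definition const_mat :: "real^'n^'n \<Rightarrow> real poly^'n^'n" where
  "const_mat M = (\<chi> i j. [:M $ i $ j:])"

lemma const_mat_mult: "const_mat (A ** B) = const_mat A ** const_mat B"
proof -
  have "[:\<Sum>k\<in>K. f k:] = (\<Sum>k\<in>K. [:f k:])" for f :: "'a \<Rightarrow> real" and K :: "'a set"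
  proof (induction K rule: infinite_finite_induct)
    case (insert k K)
    then have "(\<Sum>k\<in>insert k K. [:f k:]) = [:f k:] + [:\<Sum>k\<in>K. f k:]" by simp
    then show ?case using insert.hyps by simp
  qed auto
  then show ?thesis by (simp add: const_mat_def vec_eq_iff matrix_matrix_mult_def mult.commute)
qed

lemma mat_mult_commute: "mat c ** A = A ** mat (c::'a::comm_ring_1)"
  by (simp add: vec_eq_iff matrix_matrix_mult_def mat_def if_distrib if_distribR mult.commute cong: if_cong)

lemma matrix_diff_distrib:
  fixes A B C :: "'a::ring_1^'n^'n"
  shows "A ** (B - C) = A ** B - A ** C" "(A - B) ** C = A ** C - B ** C"
  by (simp_all add: vec_eq_iff matrix_matrix_mult_def right_diff_distrib left_diff_distrib sum_subtractf)

lemma charpoly_diagonalized: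
  fixes Q :: "real^'n^'n"
  assumes Q: "orthogonal_matrix Q"
  shows "charpoly (Q ** diag_mat d ** transpose Q) = (\<Prod>i\<in>UNIV. [:- d i, 1:])"
proof -
  have one: "const_mat (mat 1 :: real^'n^'n) = mat 1"
    by (simp add: const_mat_def mat_def vec_eq_iff one_pCons)
  have QQ: "const_mat Q ** const_mat (transpose Q) = mat 1"
    using Q by (simp add: const_mat_mult[symmetric] orthogonal_matrix_def one)
  have "mat [:0, 1:] - const_mat (Q ** diag_mat d ** transpose Q)
      = const_mat Q ** (mat [:0, 1:] - const_mat (diag_mat d)) ** const_mat (transpose Q)"
  proof -
    have "const_mat Q ** mat [:0, 1:] ** const_mat (transpose Q) = mat [:0, 1:]"
      using QQ by (metis mat_mult_commute matrix_mul_assoc matrix_mul_rid)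
    then show ?thesis
      by (simp add: const_mat_mult matrix_diff_distrib)
  qed
  then have "charpoly (Q ** diag_mat d ** transpose Q)
      = det (const_mat Q) * det (mat [:0, 1:] - const_mat (diag_mat d)) * det (const_mat (transpose Q))"
    by (simp add: charpoly_def const_mat_def[symmetric] det_mul)
  also have "\<dots> = det (mat [:0, 1:] - const_mat (diag_mat d)) * det (const_mat Q ** const_mat (transpose Q))"
    by (simp add: det_mul mult_ac)
  also have "\<dots> = (\<Prod>i\<in>UNIV. [:- d i, 1:])"
    unfolding QQ det_I mult_1_right
    by (subst det_diagonal) (auto simp: mat_def const_mat_def diag_mat_def)
  finally show ?thesis .
qed

lemma num_nonpos_eigenvalues_diagonalized:
  fixes Q :: "real^'n^'n"
  assumes Q: "orthogonal_matrix Q"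
  shows "num_nonpos_eigenvalues (Q ** diag_mat d ** transpose Q) = card {i. d i \<le> 0}"
proof -
  have "proots (\<Prod>i\<in>UNIV. [:- d i, 1:]) = (\<Sum>i\<in>UNIV. {#d i#})"
    by (subst proots_prod) auto
  moreover have "size {#t \<in># (\<Sum>i\<in>I. {#d i#}). t \<le> 0#} = card {i\<in>I. d i \<le> 0}" if "finite I" for I
    using that
  proof (induction I)
    case (insert i I)
    have "{j \<in> insert i I. d j \<le> 0} = (if d i \<le> 0 then insert i {j\<in>I. d j \<le> 0} else {j\<in>I. d j \<le> 0})" by auto
    with insert show ?case by simp
  qed simp
  ultimately show ?thesis
    by (simp add: num_nonpos_eigenvalues_def charpoly_diagonalized[OF Q])
qed

lemma mat_mult_vec: "mat c *v x = c *\<^sub>R x" for x :: "real^'n"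
  by (simp add: vec_eq_iff matrix_vector_mult_def mat_def if_distrib if_distribR cong: if_cong)

lemma pucci_minus_ge:
  fixes M :: "real^'n^'n"
  assumes lam: "lam \<le> Lam"
    and ge: "\<And>A. (\<And>x. lam * (x \<bullet> x) \<le> x \<bullet> (A *v x)) \<Longrightarrow> (\<And>x. x \<bullet> (A *v x) \<le> Lam * (x \<bullet> x)) \<Longrightarrow> c \<le> trace (A ** M)"
  shows "c \<le> pucci_minus lam Lam M"
  unfolding pucci_minus_def
proof (rule cINF_greatest)
  have "transpose (mat lam :: real^'n^'n) = mat lam" by (simp add: transpose_def mat_def vec_eq_iff)
  then have "mat lam \<in> {A :: real^'n^'n. transpose A = A \<and> loewner_le (mat lam) A \<and> loewner_le A (mat Lam)}"
    using lam by (auto simp: loewner_le_def mat_mult_vec intro: mult_right_mono)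
  then show "{A :: real^'n^'n. transpose A = A \<and> loewner_le (mat lam) A \<and> loewner_le A (mat Lam)} \<noteq> {}" by blast
  fix A :: "real^'n^'n" assume "A \<in> {A. transpose A = A \<and> loewner_le (mat lam) A \<and> loewner_le A (mat Lam)}"
  then show "c \<le> trace (A ** M)" by (intro ge) (auto simp: loewner_le_def mat_mult_vec)
qed

text \<open>With q the columns of \<open>Q\<close>, the trace is the sum of the \<open>d i\<close>
  weighted by the numbers q \<bullet> A q, and each weight lies between \<open>lam\<close> and
  \<open>Lam\<close>.\<close>

lemma pucci_minus_diagonalized_ge:
  fixes Q :: "real^'n^'n"
  assumes Q: "orthogonal_matrix Q" and lam: "0 < lam" "lam \<le> Lam"
  shows "(\<Sum>i\<in>UNIV. if 0 < d i then lam * d i else Lam * d i) \<le> pucci_minus lam Lam (Q ** diag_mat d ** transpose Q)"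
proof (rule pucci_minus_ge[OF lam(2)])
  fix A :: "real^'n^'n"
  assume A: "\<And>x. lam * (x \<bullet> x) \<le> x \<bullet> (A *v x)" "\<And>x. x \<bullet> (A *v x) \<le> Lam * (x \<bullet> x)"
  have col: "column i Q \<bullet> column i Q = 1" for i
  proof -
    have "(transpose Q ** Q) $ i $ i = 1" using Q by (simp add: orthogonal_matrix mat_def)
    then show ?thesis by (simp add: matrix_matrix_mult_def transpose_def column_def inner_vec_def)
  qed
  have "trace (A ** (Q ** diag_mat d ** transpose Q)) = trace (transpose Q ** A ** Q ** diag_mat d)"
    using trace_mul_sym[of "A ** Q ** diag_mat d" "transpose Q"] by (simp add: matrix_mul_assoc)
  also have "\<dots> = (\<Sum>i\<in>UNIV. (column i Q \<bullet> (A *v column i Q)) * d i)"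
    by (simp add: trace_def matrix_matrix_mult_def diag_mat_def transpose_def column_def inner_vec_def
        matrix_vector_mult_def sum_distrib_left sum_distrib_right if_distrib mult_ac cong: if_cong)
       (rule sum.cong[OF refl], subst sum.swap, simp add: mult_ac)
  finally have tr: "trace (A ** (Q ** diag_mat d ** transpose Q)) = (\<Sum>i\<in>UNIV. (column i Q \<bullet> (A *v column i Q)) * d i)" .
  show "(\<Sum>i\<in>UNIV. if 0 < d i then lam * d i else Lam * d i) \<le> trace (A ** (Q ** diag_mat d ** transpose Q))"
    unfolding tr
  proof (rule sum_mono)
    fix i
    have "lam \<le> column i Q \<bullet> (A *v column i Q)" "column i Q \<bullet> (A *v column i Q) \<le> Lam"
      using A(1)[of "column i Q"] A(2)[of "column i Q"] by (simp_all add: col)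
    then show "(if 0 < d i then lam * d i else Lam * d i) \<le> (column i Q \<bullet> (A *v column i Q)) * d i"
      by (auto intro: mult_right_mono mult_right_mono_neg)
  qed
qed

lemma prod_le_mean_power:
  fixes x :: "'n::finite \<Rightarrow> real"
  assumes "\<And>i. 0 < x i"
  shows "(\<Prod>i\<in>UNIV. x i) \<le> ((\<Sum>i\<in>UNIV. x i) / CARD('n)) ^ CARD('n)"
proof -
  let ?P = "\<Prod>i\<in>UNIV. x i" and ?n = "CARD('n)"
  have P: "0 < ?P" using assms by (simp add: prod_pos)
  have "?P powr (1 / ?n) \<le> (\<Sum>i\<in>UNIV. x i / ?n)"
    using arith_geom_mean[of "UNIV :: 'n set" x] assms by (simp add: less_imp_le)
  then have "(?P powr (1 / ?n)) ^ ?n \<le> (\<Sum>i\<in>UNIV. x i / ?n) ^ ?n"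
    by (intro power_mono) auto
  moreover have "(?P powr (1 / ?n)) ^ ?n = ?P"
    using powr_power[OF less_imp_neq[OF P, symmetric], where n="?n" and u="1 / real ?n"] P by (simp add: less_imp_le)
  ultimately show ?thesis by (simp add: sum_divide_distrib)
qed

text \<open>Here \<open>b = \<Lambda>/\<lambda>\<close> and the \<open>\<mu> i\<close> are the eigenvalues of \<open>I + D\<^sup>2u/a\<close>. The weights \<open>b\<close> for
  the eigenvalues at most 1 turn the Pucci inequality into a bound on the arithmetic mean.\<close>

lemma prod_eigenvalues_le:
  fixes \<mu> :: "'n::finite \<Rightarrow> real"
  assumes b: "1 \<le> b" and k: "k \<le> CARD('n)" and \<mu>: "\<And>i. 0 < \<mu> i"
    and card: "k \<le> card {i. \<mu> i \<le> 1}"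
    and pucci: "(\<Sum>i\<in>UNIV. if 1 < \<mu> i then \<mu> i - 1 else b * (\<mu> i - 1)) \<le> 0"
  shows "(\<Prod>i\<in>UNIV. \<mu> i) \<le> (b / (2 - 1 / b)) ^ (CARD('n) - k)"
proof -
  define n where "n = CARD('n)"
  \<comment> \<open>\<open>m\<close> counts the eigenvalues above 1, and \<open>d\<close> is 1 -
    \<lambda>/\<Lambda>. The weights add up to b (n - d m), which by the Pucci inequality bounds the
    weighted sum of the eigenvalues.\<close>
  define I where "I = {i. \<mu> i \<le> 1}"
  define m where "m = n - card I"
  define d where "d = 1 - 1 / b"
  have n0: "0 < n" by (simp add: n_def)
  have d: "0 \<le> d" "d < 1" using b by (auto simp: d_def)
  have cI: "card I \<le> n" unfolding n_def by (rule card_mono) auto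
  have "(\<Prod>i\<in>UNIV. if i \<in> I then b * \<mu> i else \<mu> i) \<le> ((\<Sum>i\<in>UNIV. if i \<in> I then b * \<mu> i else \<mu> i) / n) ^ n"
    unfolding n_def using b \<mu> by (intro prod_le_mean_power) auto
  also have "\<dots> \<le> (b * (n - d * m) / n) ^ n"
  proof (intro power_mono divide_right_mono)
    have "(\<Sum>i\<in>UNIV. if i \<in> I then b * \<mu> i else \<mu> i) \<le> (\<Sum>i\<in>(UNIV :: 'n set). if i \<in> I then b else 1)"
    proof -
      have "(\<Sum>i\<in>UNIV. if i \<in> I then b * \<mu> i else \<mu> i)
          = (\<Sum>i\<in>UNIV. (if 1 < \<mu> i then \<mu> i - 1 else b * (\<mu> i - 1)) + (if i \<in> I then b else 1))"
        by (intro sum.cong) (auto simp: I_def algebra_simps)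
      then show ?thesis using pucci by (simp add: sum.distrib)
    qed
    also have "(\<Sum>i\<in>(UNIV :: 'n set). if i \<in> I then b else 1) = b * (n - d * m)"
    proof -
      have "(\<Sum>i\<in>UNIV. if i \<in> I then b else 1) = (\<Sum>i\<in>(UNIV :: 'n set). 1) + (\<Sum>i\<in>I. b - 1)"
      proof -
        have "(\<Sum>i\<in>UNIV. if i \<in> I then b else 1) = (\<Sum>i\<in>(UNIV :: 'n set). 1 + (if i \<in> I then b - 1 else 0))"
          by (intro sum.cong) auto
        then show ?thesis by (simp only: sum.distrib) (simp add: sum.If_cases)
      qed
      also have "\<dots> = n + (real n - m) * (b - 1)" using cI by (simp add: n_def m_def of_nat_diff)
      also have "\<dots> = b * (n - d * m)" using b by (simp add: d_def field_simps)
      finally show ?thesis .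
    qed
    finally show "(\<Sum>i\<in>UNIV. if i \<in> I then b * \<mu> i else \<mu> i) \<le> b * (n - d * m)" .
    show "0 \<le> (\<Sum>i\<in>UNIV. if i \<in> I then b * \<mu> i else \<mu> i) / n"
      using b \<mu> by (intro divide_nonneg_nonneg sum_nonneg) (auto simp: less_imp_le)
  qed simp
  finally have 1: "(\<Prod>i\<in>UNIV. if i \<in> I then b * \<mu> i else \<mu> i) \<le> (b * (n - d * m) / n) ^ n" .
  have "(\<Prod>i\<in>UNIV. if i \<in> I then b * \<mu> i else \<mu> i) = (\<Prod>i\<in>UNIV. (if i \<in> I then b else 1) * \<mu> i)"
    by (intro prod.cong) auto
  also have "\<dots> = b ^ (n - m) * (\<Prod>i\<in>UNIV. \<mu> i)"
    using cI by (simp add: prod.distrib prod.If_cases m_def)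
  finally have 2: "b ^ (n - m) * (\<Prod>i\<in>UNIV. \<mu> i) \<le> b ^ n * (1 - d * (m / n)) ^ n"
    using 1 n0 by (simp add: power_mult_distrib[symmetric] field_simps)
  have mn: "m \<le> n" by (simp add: m_def)
  have "b ^ n = b ^ (n - m) * b ^ m" using mn by (simp add: power_add[symmetric])
  then have 3: "(\<Prod>i\<in>UNIV. \<mu> i) \<le> b ^ m * (1 - d * (m / n)) ^ n"
    using 2 b by (simp add: mult.assoc)
  \<comment> \<open>Because of ln (1 + d) \<le> d, the n-th power is at most (1 + d)^(-m); this
    produces the factor 1 + d = 2 - \<lambda>/\<Lambda> of the final bound.\<close>
  have "1 - d * (m / n) \<le> exp (- ln (1 + d) * (m / n))"
  proof -
    have "ln (1 + d) * (m / n) \<le> d * (m / n)"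
      using d ln_add_one_self_le_self[of d] by (intro mult_right_mono) auto
    then show ?thesis using exp_ge_add_one_self[of "- ln (1 + d) * (m / n)"] by simp
  qed
  moreover have "0 \<le> 1 - d * (m / n)"
    using d mn n0 mult_mono[of d 1 "m / n" 1] by simp
  ultimately have "(1 - d * (m / n)) ^ n \<le> exp (- ln (1 + d) * (m / n)) ^ n" by (intro power_mono)
  also have "\<dots> = exp (- (m * ln (1 + d)))" using n0 by (simp add: exp_of_nat_mult[symmetric])
  also have "\<dots> = 1 / (1 + d) ^ m" using d by (simp add: exp_minus exp_of_nat_mult inverse_eq_divide)
  finally have "b ^ m * (1 - d * (m / n)) ^ n \<le> b ^ m * (1 / (1 + d) ^ m)"
    using b by (intro mult_left_mono) auto
  also have "\<dots> = (b / (1 + d)) ^ m" by (simp add: power_divide)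
  \<comment> \<open>At least \<open>k\<close> eigenvalues are at most 1, so \<open>m\<close> may be
    raised to \<open>n - k\<close>. The base is at least 1 because 2 - 1/b \<le> b is the inequality
    (b - 1)^2 \<ge> 0.\<close>
  also have "\<dots> \<le> (b / (1 + d)) ^ (n - k)"
  proof (rule power_increasing)
    show "m \<le> n - k" using card by (simp add: m_def I_def)
    have "0 \<le> (b - 1)\<^sup>2" by simp
    then show "1 \<le> b / (1 + d)" using b by (simp add: d_def field_simps power2_eq_square)
  qed
  finally show ?thesis using 3 by (simp add: d_def n_def)
qed

lemma prod_eigenvalues_le_if_pucci:
  fixes Q :: "real^'n^'n"
  assumes Q: "orthogonal_matrix Q" and lam: "0 < lam" "lam \<le> Lam" and a: "0 < a" and k: "k \<le> CARD('n)"
    and \<mu>: "\<And>i. 0 < \<mu> i"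
    and pucci: "pucci_minus lam Lam (Q ** diag_mat (\<lambda>i. a * (\<mu> i - 1)) ** transpose Q) \<le> 0"
    and num: "k \<le> num_nonpos_eigenvalues (Q ** diag_mat (\<lambda>i. a * (\<mu> i - 1)) ** transpose Q)"
  shows "(\<Prod>i\<in>UNIV. \<mu> i) \<le> (Lam / lam / (2 - lam / Lam)) ^ (CARD('n) - k)"
proof -
  have "(\<Sum>i\<in>UNIV. if 0 < a * (\<mu> i - 1) then lam * (a * (\<mu> i - 1)) else Lam * (a * (\<mu> i - 1))) \<le> 0"
    using pucci_minus_diagonalized_ge[OF Q lam] pucci by (rule order_trans)
  also have "(\<Sum>i\<in>UNIV. if 0 < a * (\<mu> i - 1) then lam * (a * (\<mu> i - 1)) else Lam * (a * (\<mu> i - 1)))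
     = (\<Sum>i\<in>UNIV. lam * a * (if 1 < \<mu> i then \<mu> i - 1 else Lam / lam * (\<mu> i - 1)))"
    using a lam by (intro sum.cong) (auto simp: zero_less_mult_iff)
  finally have *: "(\<Sum>i\<in>UNIV. if 1 < \<mu> i then \<mu> i - 1 else Lam / lam * (\<mu> i - 1)) \<le> 0"
    using a lam by (simp add: sum_distrib_left[symmetric] mult_le_0_iff)
  have "{i. a * (\<mu> i - 1) \<le> 0} = {i. \<mu> i \<le> 1}" using a by (auto simp: mult_le_0_iff)
  then have "k \<le> card {i. \<mu> i \<le> 1}" using num by (simp add: num_nonpos_eigenvalues_diagonalized[OF Q])
  from prod_eigenvalues_le[OF _ k \<mu> this *] lam show ?thesis by simp
qed

section \<open>Quadratic test functions\<close>

text \<open>The value at \<open>x0\<close> is 0: an additive constant does not affect the local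
  minima of u - \<phi>.\<close>

definition quad_form :: "real^'n^'n \<Rightarrow> real^'n \<Rightarrow> real^'n \<Rightarrow> real^'n \<Rightarrow> real" where
  "quad_form M p x0 x = p \<bullet> (x - x0) + (x - x0) \<bullet> (M *v (x - x0)) / 2"

lemma transpose_mult_inner:
  fixes M :: "real^'n^'n"
  shows "(transpose M *v x) \<bullet> y = x \<bullet> (M *v y)"
  by (metis dot_lmul_matrix transpose_matrix_vector)

lemma matrix_vector_mult_shift_derivative:
  fixes M :: "real^'n^'n"
  shows "((\<lambda>x. M *v (x - x0)) has_derivative (\<lambda>h. M *v h)) (at x)"
proof -
  have "((\<lambda>x. M *v x - M *v x0) has_derivative (\<lambda>h. M *v h - 0)) (at x)"
    by (intro has_derivative_diff has_derivative_const bounded_linear_imp_has_derivative matrix_vector_mul_bounded_linear)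
  then show ?thesis by (simp add: matrix_vector_mult_diff_distrib)
qed

lemma quad_form_derivative:
  fixes M :: "real^'n^'n"
  assumes M: "transpose M = M"
  shows "(quad_form M p x0 has_derivative (\<lambda>h. (p + M *v (x - x0)) \<bullet> h)) (at x)"
proof -
  have sym: "(M *v x) \<bullet> y = x \<bullet> (M *v y)" for x y using transpose_mult_inner[of M x y] M by simp
  note lin = matrix_vector_mult_shift_derivative[of M x0 x]
  have "(quad_form M p x0 has_derivative (\<lambda>h. p \<bullet> h + ((x - x0) \<bullet> (M *v h) + h \<bullet> (M *v (x - x0))) / 2)) (at x)"
    unfolding quad_form_def[abs_def]
    by (rule has_derivative_eq_rhs) (auto intro!: derivative_eq_intros lin)
  moreover have "p \<bullet> h + ((x - x0) \<bullet> (M *v h) + h \<bullet> (M *v (x - x0))) / 2 = (p + M *v (x - x0)) \<bullet> h" for h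
    using sym[of "x - x0" h] inner_commute[of h "M *v (x - x0)"] by (simp add: inner_add_left)
  ultimately show ?thesis by simp
qed

lemma grad_quad_form:
  fixes M :: "real^'n^'n"
  assumes M: "transpose M = M"
  shows "grad (quad_form M p x0) x = p + M *v (x - x0)"
  using frechet_derivative_at[OF quad_form_derivative[OF M, of p x0 x], symmetric]
  by (simp add: grad_def vec_eq_iff inner_axis)

lemma grad_quad_form_derivative:
  fixes M :: "real^'n^'n"
  assumes M: "transpose M = M"
  shows "(grad (quad_form M p x0) has_derivative (\<lambda>h. M *v h)) (at x)"
proof -
  have "((\<lambda>x. M *v (x - x0)) has_derivative (\<lambda>h. M *v h)) (at x)"
    by (rule matrix_vector_mult_shift_derivative)
  then have "((\<lambda>x. p + M *v (x - x0)) has_derivative (\<lambda>h. 0 + M *v h)) (at x)"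
    by (intro has_derivative_add has_derivative_const)
  moreover have "grad (quad_form M p x0) = (\<lambda>x. p + M *v (x - x0))"
    using grad_quad_form[OF M] by blast
  ultimately show ?thesis by simp
qed

lemma hessian_quad_form:
  fixes M :: "real^'n^'n"
  assumes M: "transpose M = M"
  shows "hessian (quad_form M p x0) x = M"
  using frechet_derivative_at[OF grad_quad_form_derivative[OF M, of p x0 x], symmetric]
  by (simp add: hessian_def jacobian_def)

lemma C2_on_quad_form:
  fixes M :: "real^'n^'n"
  assumes M: "transpose M = M"
  shows "C2_on S (quad_form M p x0)"
  unfolding C2_on_def differentiable_def
proof (intro conjI ballI)
  show "\<exists>D. (quad_form M p x0 has_derivative D) (at x)" for x
    using quad_form_derivative[OF M] by blast
  show "\<exists>D. (grad (quad_form M p x0) has_derivative D) (at x)" for x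
    using grad_quad_form_derivative[OF M] by blast
qed (simp add: hessian_quad_form[OF M])

text \<open>Both viscosity hypotheses are used through this lemma only: a quadratic touching
  \<open>u\<close> from below near \<open>x0\<close> is itself an admissible test function, with
  constant Hessian \<open>M\<close>.\<close>

lemma viscosity_conditions_if_touching:
  fixes M :: "real^'n^'n"
  assumes M: "transpose M = M" and x0: "x0 \<in> S" and d: "0 < d"
    and touch: "\<And>x. norm (x - x0) < d \<Longrightarrow> u x0 + p \<bullet> (x - x0) + (x - x0) \<bullet> (M *v (x - x0)) / 2 \<le> u x"
  shows "viscosity_pucci_minus_le_0 lam Lam S u \<Longrightarrow> pucci_minus lam Lam M \<le> 0"
    and "viscosity_nonpos_eigenvalues_ge S u k \<Longrightarrow> k \<le> num_nonpos_eigenvalues M"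
proof -
  have "local_min_at (\<lambda>x. u x - quad_form M p x0 x) x0"
    unfolding local_min_at_def eventually_nhds_metric
    using d touch by (intro exI[of _ d]) (force simp: dist_norm quad_form_def)
  then show "viscosity_pucci_minus_le_0 lam Lam S u \<Longrightarrow> pucci_minus lam Lam M \<le> 0"
    "viscosity_nonpos_eigenvalues_ge S u k \<Longrightarrow> k \<le> num_nonpos_eigenvalues M"
    using x0 C2_on_quad_form[OF M, of S p x0] hessian_quad_form[OF M, of p x0 x0]
    unfolding viscosity_pucci_minus_le_0_def viscosity_nonpos_eigenvalues_ge_def by metis+
qed

text \<open>If the slopes differed, a quadratic that is very convex in the direction \<open>p - q\<close> would touch
  \<open>u\<close> from below at \<open>x0\<close>.\<close>

lemma touching_slope_unique:
  fixes u :: "real^'n \<Rightarrow> real"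
  assumes visc: "viscosity_pucci_minus_le_0 lam Lam S u" and lam: "0 < lam" "lam \<le> Lam"
    and x0: "x0 \<in> S" and d: "0 < d"
    and p: "\<And>x. norm (x - x0) < d \<Longrightarrow> u x0 + p \<bullet> (x - x0) - a / 2 * (norm (x - x0))\<^sup>2 \<le> u x"
    and q: "\<And>x. norm (x - x0) < d \<Longrightarrow> u x0 + q \<bullet> (x - x0) - a / 2 * (norm (x - x0))\<^sup>2 \<le> u x"
  shows "p = q"
proof (rule ccontr)
  assume pq: "p \<noteq> q"
  define e where "e = p - q"
  have e: "0 < e \<bullet> e" using pq by (simp add: e_def)
  \<comment> \<open>Chosen so that N lam |e|^2 = |a| n Lam + 1: in every admissible trace the
    rank-one part of \<open>M\<close> outweighs the part -a I by at least 1.\<close>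
  define N where "N = (\<bar>a\<bar> * (CARD('n) * Lam) + 1) / (lam * (e \<bullet> e))"
  have N: "0 < N" unfolding N_def using e lam by (intro divide_pos_pos add_nonneg_pos) auto
  define M :: "real^'n^'n" where "M = (\<chi> i j. N * e $ i * e $ j - (if i = j then a else 0))"
  have Mt: "transpose M = M" by (simp add: M_def transpose_def vec_eq_iff)
  have Mv: "M *v w = N *\<^sub>R ((e \<bullet> w) *\<^sub>R e) - a *\<^sub>R w" for w
  proof -
    have "M $ i $ j * w $ j = N * e $ i * (e $ j * w $ j) - (if i = j then a * w $ j else 0)" for i j
      by (simp add: M_def left_diff_distrib)
    then show ?thesis
      by (simp add: vec_eq_iff matrix_vector_mult_def inner_vec_def sum_subtractf sum_distrib_left[symmetric] mult_ac)
  qed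
  have "pucci_minus lam Lam M \<le> 0"
  proof (rule viscosity_conditions_if_touching(1)[OF Mt x0 _ _ visc, of "min d (1 / (N * norm e))" "(p + q) /\<^sub>R 2"])
    show "0 < min d (1 / (N * norm e))" using d N e by simp
    fix x assume x: "norm (x - x0) < min d (1 / (N * norm e))"
    let ?w = "x - x0"
    \<comment> \<open>On the ball of radius 1 / (N |e|) the convex term N (e \<bullet> w)^2 / 2 does
      not exceed |e \<bullet> w| / 2, the gap between the mean of p \<bullet> w and q \<bullet> w
      and their maximum.\<close>
    have "\<bar>e \<bullet> ?w\<bar> \<le> norm e * norm ?w" by (rule Cauchy_Schwarz_ineq2)
    also have "\<dots> \<le> norm e * (1 / (N * norm e))" using x by (intro mult_left_mono) auto
    also have "\<dots> = 1 / N" using e by simp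
    finally have "N * \<bar>e \<bullet> ?w\<bar> \<le> 1" using N by (simp add: field_simps)
    then have sq: "N * (e \<bullet> ?w)\<^sup>2 \<le> \<bar>e \<bullet> ?w\<bar>"
      using mult_right_mono[of "N * \<bar>e \<bullet> ?w\<bar>" 1 "\<bar>e \<bullet> ?w\<bar>"] by (simp add: power2_eq_square mult.assoc)
    have "w \<bullet> (M *v w) / 2 = N * (e \<bullet> w)\<^sup>2 / 2 - a / 2 * (norm w)\<^sup>2" for w
      by (simp add: Mv inner_diff_right power2_norm_eq_inner power2_eq_square[of "e \<bullet> w"] inner_commute[of w e] diff_divide_distrib)
    note this[of ?w]
    moreover have "((p + q) /\<^sub>R 2) \<bullet> ?w + \<bar>e \<bullet> ?w\<bar> / 2 = max (p \<bullet> ?w) (q \<bullet> ?w)"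
      by (simp add: e_def inner_add_left inner_diff_left max_def abs_if field_simps)
    ultimately have "u x0 + ((p + q) /\<^sub>R 2) \<bullet> ?w + ?w \<bullet> (M *v ?w) / 2
        \<le> u x0 + max (p \<bullet> ?w) (q \<bullet> ?w) - a / 2 * (norm ?w)\<^sup>2"
      using sq by linarith
    also have "\<dots> \<le> u x" using p[of x] q[of x] x by (simp add: max_def)
    finally show "u x0 + ((p + q) /\<^sub>R 2) \<bullet> ?w + ?w \<bullet> (M *v ?w) / 2 \<le> u x" .
  qed
  moreover have "1 \<le> pucci_minus lam Lam M"
  proof (rule pucci_minus_ge[OF lam(2)])
    fix A :: "real^'n^'n"
    assume A: "\<And>x. lam * (x \<bullet> x) \<le> x \<bullet> (A *v x)" "\<And>x. x \<bullet> (A *v x) \<le> Lam * (x \<bullet> x)"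
    have "0 \<le> trace A \<and> trace A \<le> CARD('n) * Lam"
    proof -
      have "axis i 1 \<bullet> (A *v axis i 1) = A $ i $ i" for i
        by (simp add: inner_axis' matrix_vector_mult_basis column_def)
      then have "lam \<le> A $ i $ i" "A $ i $ i \<le> Lam" for i
        using A(1)[of "axis i 1"] A(2)[of "axis i 1"] by (simp_all add: inner_axis_axis)
      then have "0 \<le> A $ i $ i" "A $ i $ i \<le> Lam" for i
        using lam by (meson less_imp_le order_trans)+
      then show ?thesis
        using sum_bounded_above[of UNIV "\<lambda>i. A $ i $ i" Lam] by (auto simp: trace_def intro: sum_nonneg)
    qed
    then have trA: "a * trace A \<le> \<bar>a\<bar> * (CARD('n) * Lam)"
      by (meson abs_ge_self abs_ge_zero mult_mono mult_right_mono order_trans)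
    have "trace (A ** M) = N * (e \<bullet> (A *v e)) - a * trace A"
    proof -
      have "A $ i $ k * M $ k $ i = N * (e $ i * (A $ i $ k * e $ k)) - (if k = i then a * A $ i $ i else 0)" for i k
        by (simp add: M_def right_diff_distrib)
      then show ?thesis
        by (simp add: trace_def matrix_matrix_mult_def inner_vec_def matrix_vector_mult_def
            sum_subtractf sum_distrib_left[symmetric])
    qed
    moreover have "N * (lam * (e \<bullet> e)) \<le> N * (e \<bullet> (A *v e))"
      using A(1)[of e] N by (intro mult_left_mono) auto
    moreover have "N * (lam * (e \<bullet> e)) = \<bar>a\<bar> * (CARD('n) * Lam) + 1"
      using e lam by (simp add: N_def)
    ultimately show "1 \<le> trace (A ** M)" using trA by linarith
  qed
  ultimately show False by simp
qed

section \<open>Convex duality\<close>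

text \<open>The point precedes the slope. In the application \<open>H\<close> is a function of
  vertices, so \<open>z\<close> is a vertex and the subgradient \<open>x\<close> a point of the
  closed ball.\<close>

definition subgrad :: "('a::euclidean_space \<Rightarrow> real) \<Rightarrow> 'a \<Rightarrow> 'a \<Rightarrow> bool" where
  "subgrad H z x \<longleftrightarrow> (\<forall>z'. H z + x \<bullet> (z' - z) \<le> H z')"

lemma subgrad_mono:
  assumes "subgrad H z x" "subgrad H z' x'"
  shows "0 \<le> (x - x') \<bullet> (z - z')"
proof -
  have "H z + x \<bullet> (z' - z) \<le> H z'" "H z' + x' \<bullet> (z - z') \<le> H z"
    using assms by (auto simp: subgrad_def)
  then show ?thesis by (simp add: inner_diff_left inner_diff_right algebra_simps)
qed

text \<open>Monotonicity makes the cross term in the squared norm of s u + t w nonnegative, so each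
  summand alone is bounded by the whole. This gives uniqueness and the Lipschitz bound for the
  splitting of a point into s x + t z.\<close>

lemma subgrad_resolvent_expansion:
  assumes "subgrad H z x" "subgrad H z' x'" and st: "0 < s" "0 < t"
  shows "s * norm (x - x') \<le> norm (s *\<^sub>R x + t *\<^sub>R z - (s *\<^sub>R x' + t *\<^sub>R z'))"
    and "t * norm (z - z') \<le> norm (s *\<^sub>R x + t *\<^sub>R z - (s *\<^sub>R x' + t *\<^sub>R z'))"
proof -
  have eq: "s *\<^sub>R x + t *\<^sub>R z - (s *\<^sub>R x' + t *\<^sub>R z') = s *\<^sub>R (x - x') + t *\<^sub>R (z - z')"
    by (simp add: algebra_simps)
  have "(norm (s *\<^sub>R u + t *\<^sub>R w))\<^sup>2 = (s * norm u)\<^sup>2 + (t * norm w)\<^sup>2 + 2 * s * t * (u \<bullet> w)" for u w :: 'a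
    unfolding power_mult_distrib power2_norm_eq_inner
    by (simp add: inner_add_left inner_add_right inner_commute[of w u] power2_eq_square algebra_simps)
  note this[of "x - x'" "z - z'"]
  moreover have "0 \<le> 2 * s * t * ((x - x') \<bullet> (z - z'))"
    using subgrad_mono[OF assms(1,2)] st by simp
  ultimately have "(s * norm (x - x'))\<^sup>2 \<le> (norm (s *\<^sub>R (x - x') + t *\<^sub>R (z - z')))\<^sup>2"
    "(t * norm (z - z'))\<^sup>2 \<le> (norm (s *\<^sub>R (x - x') + t *\<^sub>R (z - z')))\<^sup>2"
    using zero_le_power2[of "s * norm (x - x')"] zero_le_power2[of "t * norm (z - z')"] by linarith+
  then show "s * norm (x - x') \<le> norm (s *\<^sub>R x + t *\<^sub>R z - (s *\<^sub>R x' + t *\<^sub>R z'))"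
    "t * norm (z - z') \<le> norm (s *\<^sub>R x + t *\<^sub>R z - (s *\<^sub>R x' + t *\<^sub>R z'))"
    unfolding eq by (auto intro: power2_le_imp_le)
qed

text \<open>Minty's theorem by minimization: at a minimum \<open>z\<close> of t H z + |y - t z|^2 /
  (2 s) the vector (y - t z) / s is a subgradient of \<open>H\<close>. The lower bound on
  \<open>H\<close> makes this functional coercive.\<close>

lemma minty_surjective:
  fixes H :: "'a::euclidean_space \<Rightarrow> real"
  assumes conv: "convex_on UNIV H" and cont: "continuous_on UNIV H" and low: "\<And>z. c \<le> H z"
    and st: "0 < s" "0 < t"
  shows "\<exists>x z. y = s *\<^sub>R x + t *\<^sub>R z \<and> subgrad H z x"
proof -
  define J where "J z = t * H z + (norm (y - t *\<^sub>R z))\<^sup>2 / (2 * s)" for z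
  have contJ: "continuous_on UNIV J" unfolding J_def using st by (intro continuous_intros cont) auto
  \<comment> \<open>Outside the ball of this radius the quadratic term is at least |J 0 - t c|, so
    no value below \<open>J 0\<close> occurs there.\<close>
  define R where "R = (norm y + sqrt (2 * s * \<bar>J 0 - t * c\<bar>)) / t + 1"
  have R: "0 < R" unfolding R_def using st by (intro add_nonneg_pos divide_nonneg_pos add_nonneg_nonneg) auto
  obtain z where z: "z \<in> cball 0 R" "\<And>z'. z' \<in> cball 0 R \<Longrightarrow> J z \<le> J z'"
    using continuous_attains_inf[of "cball 0 R" J] R continuous_on_subset[OF contJ subset_UNIV] by auto
  have zmin: "J z \<le> J z'" for z'
  proof (cases "z' \<in> cball 0 R")
    case False
    then have "norm y + sqrt (2 * s * \<bar>J 0 - t * c\<bar>) \<le> t * norm z'"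
      using st by (simp add: R_def field_simps)
    moreover have "t * norm z' - norm y \<le> norm (y - t *\<^sub>R z')"
      using norm_triangle_ineq2[of "t *\<^sub>R z'" y] st by (simp add: norm_minus_commute)
    ultimately have "sqrt (2 * s * \<bar>J 0 - t * c\<bar>) \<le> norm (y - t *\<^sub>R z')" by linarith
    then have "(sqrt (2 * s * \<bar>J 0 - t * c\<bar>))\<^sup>2 \<le> (norm (y - t *\<^sub>R z'))\<^sup>2" using st by (intro power_mono) auto
    then have "\<bar>J 0 - t * c\<bar> \<le> (norm (y - t *\<^sub>R z'))\<^sup>2 / (2 * s)" using st by (simp add: field_simps)
    moreover have "t * c \<le> t * H z'" using low st by simp
    ultimately have "J 0 \<le> J z'" unfolding J_def[of z'] by linarith
    moreover have "J z \<le> J 0" using R by (intro z) auto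
    ultimately show ?thesis by simp
  qed (use z in auto)
  define x where "x = (y - t *\<^sub>R z) /\<^sub>R s"
  have y: "y = s *\<^sub>R x + t *\<^sub>R z" using st by (simp add: x_def)
  have "H z + x \<bullet> (z' - z) \<le> H z'" for z'
  proof -
    define w where "w = z' - z"
    \<comment> \<open>Comparing \<open>J\<close> at z and at z + l w and dividing by t l leaves the
      error l C, which vanishes as l tends to 0 from the right.\<close>
    define C where "C = t * (norm w)\<^sup>2 / (2 * s)"
    have "x \<bullet> w \<le> H z' - H z + l * C" if l: "0 < l" "l \<le> 1" for l
    proof -
      have "H (z + l *\<^sub>R w) \<le> (1 - l) * H z + l * H z'"
        using convex_onD[OF conv, of l z z'] l by (simp add: w_def algebra_simps)
      then have 1: "t * H (z + l *\<^sub>R w) \<le> t * ((1 - l) * H z + l * H z')" using st by simp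
      have 2: "(norm (y - t *\<^sub>R (z + l *\<^sub>R w)))\<^sup>2 / (2 * s)
          = (norm (y - t *\<^sub>R z))\<^sup>2 / (2 * s) - t * l * (x \<bullet> w) + t * l * (l * C)"
      proof -
        have "y - t *\<^sub>R (z + l *\<^sub>R w) = s *\<^sub>R x - (t * l) *\<^sub>R w" "y - t *\<^sub>R z = s *\<^sub>R x"
          by (simp_all add: y algebra_simps)
        moreover have "(norm (s *\<^sub>R x - (t * l) *\<^sub>R w))\<^sup>2
            = s\<^sup>2 * (x \<bullet> x) - 2 * s * t * l * (x \<bullet> w) + t\<^sup>2 * l\<^sup>2 * (w \<bullet> w)"
          unfolding power2_norm_eq_inner
          by (simp add: inner_diff_left inner_diff_right inner_commute[of w x] power2_eq_square algebra_simps)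
        moreover have "(norm (s *\<^sub>R x))\<^sup>2 = s\<^sup>2 * (x \<bullet> x)"
          unfolding power2_norm_eq_inner by (simp add: power2_eq_square)
        ultimately show ?thesis using st
          unfolding C_def power2_norm_eq_inner[of w] by (simp add: field_simps power2_eq_square)
      qed
      have "J z \<le> J (z + l *\<^sub>R w)" by (rule zmin)
      then have "0 \<le> t * ((1 - l) * H z + l * H z') - t * H z - t * l * (x \<bullet> w) + t * l * (l * C)"
        using 1 2 unfolding J_def by linarith
      also have "\<dots> = t * l * (H z' - H z - x \<bullet> w + l * C)" by (simp add: algebra_simps)
      finally have "0 \<le> t * l * (H z' - H z - x \<bullet> w + l * C)" .
      moreover have "0 < t * l" using st l by simp
      ultimately have "0 \<le> H z' - H z - x \<bullet> w + l * C" by (auto simp: zero_le_mult_iff)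
      then show ?thesis by simp
    qed
    then have "\<forall>\<^sub>F l in at_right 0. x \<bullet> w \<le> H z' - H z + l * C"
      unfolding eventually_at_right_field by (intro exI[of _ 1]) auto
    moreover have "((\<lambda>l. H z' - H z + l * C) \<longlongrightarrow> H z' - H z + 0 * C) (at_right 0)"
      by (intro tendsto_intros)
    ultimately have "x \<bullet> w \<le> H z' - H z + 0 * C"
      by (intro tendsto_lowerbound[of _ _ "at_right (0::real)"]) auto
    then show ?thesis by (simp add: w_def)
  qed
  with y show ?thesis unfolding subgrad_def by blast
qed

text \<open>The mean value theorem in direction \<open>k\<close> reduces the second difference to a
  difference of two gradients near \<open>y\<close>, so differentiability of the gradient at the
  single point \<open>y\<close> is enough.\<close>

lemma second_difference_approx:
  fixes \<Psi> :: "'a::euclidean_space \<Rightarrow> 'a"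
  assumes G: "\<And>y. (G has_derivative (\<lambda>h. \<Psi> y \<bullet> h)) (at y)"
    and D: "(\<Psi> has_derivative D) (at y)" and e: "0 < e"
  shows "\<forall>\<^sub>F \<tau> in at_right 0. \<bar>(G (y + \<tau> *\<^sub>R h + \<tau> *\<^sub>R k) - G (y + \<tau> *\<^sub>R h) - G (y + \<tau> *\<^sub>R k) + G y) / \<tau>\<^sup>2 - D h \<bullet> k\<bar> \<le> e"
proof -
  define B where "B = (norm h + 2 * norm k + 1) * (norm k + 1)"
  have B: "0 < B" unfolding B_def by (intro mult_pos_pos add_nonneg_pos) auto
  define e' where "e' = e / B"
  have e': "0 < e'" using e B by (simp add: e'_def)
  have lin: "linear D" using D has_derivative_linear by blast
  obtain d where d: "d > 0" "\<And>y'. norm (y' - y) < d \<Longrightarrow> norm (\<Psi> y' - \<Psi> y - D (y' - y)) \<le> e' * norm (y' - y)"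
    using D[unfolded has_derivative_at_alt] e' by blast
  define N where "N = norm h + norm k + 1"
  have N: "0 < N" unfolding N_def by (intro add_nonneg_pos) auto
  have "\<bar>(G (y + \<tau> *\<^sub>R h + \<tau> *\<^sub>R k) - G (y + \<tau> *\<^sub>R h) - G (y + \<tau> *\<^sub>R k) + G y) / \<tau>\<^sup>2 - D h \<bullet> k\<bar> \<le> e"
    if \<tau>: "0 < \<tau>" "\<tau> < d / N" for \<tau>
  proof -
    define \<phi> where "\<phi> \<sigma> = G (y + \<tau> *\<^sub>R h + \<sigma> *\<^sub>R k) - G (y + \<sigma> *\<^sub>R k)" for \<sigma>
    have "(\<phi> has_real_derivative (\<Psi> (y + \<tau> *\<^sub>R h + \<sigma> *\<^sub>R k) - \<Psi> (y + \<sigma> *\<^sub>R k)) \<bullet> k) (at \<sigma>)" for \<sigma>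
    proof -
      have "((\<lambda>\<sigma>. G (z + \<sigma> *\<^sub>R k)) has_derivative (\<lambda>h. \<Psi> (z + \<sigma> *\<^sub>R k) \<bullet> (h *\<^sub>R k))) (at \<sigma>)" for z
        by (rule has_derivative_compose[of "\<lambda>\<sigma>. z + \<sigma> *\<^sub>R k" _ \<sigma> UNIV G, OF _ G])
           (auto intro!: derivative_eq_intros)
      from has_derivative_diff[OF this[of "y + \<tau> *\<^sub>R h"] this[of y]]
      show ?thesis unfolding \<phi>_def has_field_derivative_def
        by (rule has_derivative_eq_rhs) (simp add: fun_eq_iff inner_diff_left algebra_simps)
    qed
    then obtain \<sigma> where \<sigma>: "0 < \<sigma>" "\<sigma> < \<tau>" "\<phi> \<tau> - \<phi> 0 = (\<tau> - 0) * ((\<Psi> (y + \<tau> *\<^sub>R h + \<sigma> *\<^sub>R k) - \<Psi> (y + \<sigma> *\<^sub>R k)) \<bullet> k)"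
      using MVT2[OF \<tau>(1), of \<phi> "\<lambda>\<sigma>. (\<Psi> (y + \<tau> *\<^sub>R h + \<sigma> *\<^sub>R k) - \<Psi> (y + \<sigma> *\<^sub>R k)) \<bullet> k"] by blast
    define w1 w2 where "w1 = \<tau> *\<^sub>R h + \<sigma> *\<^sub>R k" and "w2 = \<sigma> *\<^sub>R k"
    have n1: "norm w1 \<le> \<tau> * (norm h + norm k)"
      unfolding w1_def using \<tau> \<sigma> mult_right_mono[of \<sigma> \<tau> "norm k"]
      by (intro order_trans[OF norm_triangle_ineq]) (simp add: algebra_simps)
    have n2: "norm w2 \<le> \<tau> * norm k"
      unfolding w2_def using \<tau> \<sigma> mult_right_mono[of \<sigma> \<tau> "norm k"] by simp
    have "\<tau> * N < d" using \<tau> N by (simp add: field_simps)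
    moreover have "\<tau> * (norm h + norm k) \<le> \<tau> * N" "\<tau> * norm k \<le> \<tau> * N" using \<tau> by (auto simp: N_def)
    ultimately have "norm w1 < d" "norm w2 < d" using n1 n2 by linarith+
    then have r: "norm (\<Psi> (y + w1) - \<Psi> y - D w1) \<le> e' * norm w1" "norm (\<Psi> (y + w2) - \<Psi> y - D w2) \<le> e' * norm w2"
      using d(2)[of "y + w1"] d(2)[of "y + w2"] by simp_all
    have "D w1 - D w2 = \<tau> *\<^sub>R D h" unfolding w1_def w2_def by (simp add: linear_add[OF lin] linear_scale[OF lin])
    then have "norm (\<Psi> (y + w1) - \<Psi> (y + w2) - \<tau> *\<^sub>R D h) \<le> norm (\<Psi> (y + w1) - \<Psi> y - D w1) + norm (\<Psi> (y + w2) - \<Psi> y - D w2)"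
      using norm_triangle_ineq4[of "\<Psi> (y + w1) - \<Psi> y - D w1" "\<Psi> (y + w2) - \<Psi> y - D w2"] by (simp add: algebra_simps)
    also have "\<dots> \<le> e' * (\<tau> * (norm h + norm k)) + e' * (\<tau> * norm k)"
      using r n1 n2 e' by (intro add_mono order_trans[OF r(1)] order_trans[OF r(2)] mult_left_mono) auto
    also have "\<dots> \<le> e' * \<tau> * (norm h + 2 * norm k + 1)" using e' \<tau> by (simp add: algebra_simps)
    finally have n: "norm (\<Psi> (y + w1) - \<Psi> (y + w2) - \<tau> *\<^sub>R D h) \<le> e' * \<tau> * (norm h + 2 * norm k + 1)" .
    have "\<phi> \<tau> - \<phi> 0 - \<tau>\<^sup>2 * (D h \<bullet> k) = \<tau> * ((\<Psi> (y + w1) - \<Psi> (y + w2) - \<tau> *\<^sub>R D h) \<bullet> k)"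
      unfolding \<sigma>(3) by (simp add: w1_def w2_def inner_diff_left power2_eq_square algebra_simps)
    also have "\<bar>\<dots>\<bar> \<le> \<tau> * (e' * \<tau> * (norm h + 2 * norm k + 1) * (norm k + 1))"
    proof -
      have "\<bar>(\<Psi> (y + w1) - \<Psi> (y + w2) - \<tau> *\<^sub>R D h) \<bullet> k\<bar> \<le> norm (\<Psi> (y + w1) - \<Psi> (y + w2) - \<tau> *\<^sub>R D h) * norm k"
        by (rule Cauchy_Schwarz_ineq2)
      also have "\<dots> \<le> e' * \<tau> * (norm h + 2 * norm k + 1) * (norm k + 1)"
        using n e' \<tau> by (intro mult_mono) auto
      finally show ?thesis using \<tau> by (simp add: abs_mult)
    qed
    also have "\<dots> = \<tau>\<^sup>2 * (e' * B)" by (simp add: B_def power2_eq_square)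
    also have "e' * B = e" using B by (simp add: e'_def)
    finally have "\<bar>\<phi> \<tau> - \<phi> 0 - \<tau>\<^sup>2 * (D h \<bullet> k)\<bar> \<le> \<tau>\<^sup>2 * e" .
    moreover have "(\<phi> \<tau> - \<phi> 0) / \<tau>\<^sup>2 - D h \<bullet> k = (\<phi> \<tau> - \<phi> 0 - \<tau>\<^sup>2 * (D h \<bullet> k)) / \<tau>\<^sup>2"
      using \<tau> by (simp add: field_simps)
    ultimately have "\<bar>(\<phi> \<tau> - \<phi> 0) / \<tau>\<^sup>2 - D h \<bullet> k\<bar> \<le> e" using \<tau> by (simp add: field_simps)
    then show ?thesis by (simp add: \<phi>_def algebra_simps)
  qed
  then show ?thesis
    unfolding eventually_at_right_field using d N by (intro exI[of _ "d / N"]) auto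
qed

text \<open>The second difference is unchanged when \<open>h\<close> and \<open>k\<close> are
  exchanged, so its two limits agree.\<close>

lemma gradient_derivative_symmetric:
  fixes \<Psi> :: "'a::euclidean_space \<Rightarrow> 'a"
  assumes G: "\<And>y. (G has_derivative (\<lambda>h. \<Psi> y \<bullet> h)) (at y)" and D: "(\<Psi> has_derivative D) (at y)"
  shows "D h \<bullet> k = h \<bullet> D k"
proof (rule ccontr)
  assume "D h \<bullet> k \<noteq> h \<bullet> D k"
  define e where "e = \<bar>D h \<bullet> k - D k \<bullet> h\<bar> / 3"
  have e: "0 < e" using \<open>D h \<bullet> k \<noteq> h \<bullet> D k\<close> by (simp add: e_def inner_commute)
  have "\<forall>\<^sub>F \<tau> in at_right (0::real). False"
    using second_difference_approx[OF G D e, of h k] second_difference_approx[OF G D e, of k h]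
  proof eventually_elim
    case (elim \<tau>)
    let ?S = "(G (y + \<tau> *\<^sub>R h + \<tau> *\<^sub>R k) - G (y + \<tau> *\<^sub>R h) - G (y + \<tau> *\<^sub>R k) + G y) / \<tau>\<^sup>2"
    have "(G (y + \<tau> *\<^sub>R k + \<tau> *\<^sub>R h) - G (y + \<tau> *\<^sub>R k) - G (y + \<tau> *\<^sub>R h) + G y) / \<tau>\<^sup>2 = ?S"
      by (simp add: algebra_simps)
    then have "\<bar>D h \<bullet> k - D k \<bullet> h\<bar> \<le> 2 * e" using elim by linarith
    with e show False by (simp add: e_def)
  qed
  then show False by simp
qed

text \<open>Along the segment, \<open>G\<close> minus the claimed quadratic majorant has nonpositive
  derivative.\<close>

lemma gradient_taylor_upper:
  fixes \<Psi> :: "'a::euclidean_space \<Rightarrow> 'a"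
  assumes G: "\<And>y. (G has_derivative (\<lambda>h. \<Psi> y \<bullet> h)) (at y)" and D: "(\<Psi> has_derivative D) (at y)" and e: "0 < e"
  shows "\<exists>d>0. \<forall>w. norm w < d \<longrightarrow> G (y + w) \<le> G y + \<Psi> y \<bullet> w + (D w \<bullet> w + e * (w \<bullet> w)) / 2"
proof -
  have lin: "linear D" using D has_derivative_linear by blast
  obtain d where d: "d > 0" "\<And>y'. norm (y' - y) < d \<Longrightarrow> norm (\<Psi> y' - \<Psi> y - D (y' - y)) \<le> e * norm (y' - y)"
    using D[unfolded has_derivative_at_alt] e by blast
  have "G (y + w) \<le> G y + \<Psi> y \<bullet> w + (D w \<bullet> w + e * (w \<bullet> w)) / 2" if w: "norm w < d" for w
  proof -
    define \<phi> where "\<phi> \<tau> = G (y + \<tau> *\<^sub>R w) - \<tau> * (\<Psi> y \<bullet> w) - \<tau>\<^sup>2 / 2 * (D w \<bullet> w + e * (w \<bullet> w))" for \<tau>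
    have der: "(\<phi> has_real_derivative (\<Psi> (y + \<tau> *\<^sub>R w) - \<Psi> y - \<tau> *\<^sub>R D w) \<bullet> w - e * \<tau> * (w \<bullet> w)) (at \<tau>)" for \<tau>
    proof -
      have "((\<lambda>\<sigma>. G (y + \<sigma> *\<^sub>R w)) has_derivative (\<lambda>h. \<Psi> (y + \<tau> *\<^sub>R w) \<bullet> (h *\<^sub>R w))) (at \<tau>)"
        by (rule has_derivative_compose[of "\<lambda>\<sigma>. y + \<sigma> *\<^sub>R w" _ \<tau> UNIV G, OF _ G])
           (auto intro!: derivative_eq_intros)
      then have 1: "((\<lambda>\<sigma>. G (y + \<sigma> *\<^sub>R w)) has_real_derivative \<Psi> (y + \<tau> *\<^sub>R w) \<bullet> w) (at \<tau>)"
        unfolding has_field_derivative_def by (rule has_derivative_eq_rhs) (simp add: fun_eq_iff)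
      show ?thesis unfolding \<phi>_def
        by (rule DERIV_cong) (auto intro!: derivative_eq_intros 1 simp: inner_diff_left algebra_simps)
    qed
    have "\<phi> 1 \<le> \<phi> 0"
    proof (rule DERIV_nonpos_imp_nonincreasing[of 0 1 \<phi>])
      fix \<tau> :: real assume \<tau>: "0 \<le> \<tau>" "\<tau> \<le> 1"
      have "norm (\<tau> *\<^sub>R w) < d" using \<tau> w mult_right_mono[of \<tau> 1 "norm w"] by simp
      then have "norm (\<Psi> (y + \<tau> *\<^sub>R w) - \<Psi> y - D (\<tau> *\<^sub>R w)) \<le> e * norm (\<tau> *\<^sub>R w)"
        using d(2)[of "y + \<tau> *\<^sub>R w"] by simp
      then have "norm (\<Psi> (y + \<tau> *\<^sub>R w) - \<Psi> y - \<tau> *\<^sub>R D w) \<le> e * \<tau> * norm w"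
        using \<tau> by (simp add: linear_scale[OF lin] mult.assoc)
      then have "(\<Psi> (y + \<tau> *\<^sub>R w) - \<Psi> y - \<tau> *\<^sub>R D w) \<bullet> w \<le> e * \<tau> * norm w * norm w"
        using Cauchy_Schwarz_ineq2[of "\<Psi> (y + \<tau> *\<^sub>R w) - \<Psi> y - \<tau> *\<^sub>R D w" w] mult_right_mono[of _ _ "norm w"]
        by (meson abs_ge_self norm_ge_zero order_trans)
      then have "(\<Psi> (y + \<tau> *\<^sub>R w) - \<Psi> y - \<tau> *\<^sub>R D w) \<bullet> w - e * \<tau> * (w \<bullet> w) \<le> 0"
        by (simp add: power2_norm_eq_inner[symmetric] power2_eq_square mult.assoc)
      then show "\<exists>y. (\<phi> has_real_derivative y) (at \<tau>) \<and> y \<le> 0" using der by blast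
    qed simp
    then show ?thesis by (simp add: \<phi>_def)
  qed
  with d show ?thesis by blast
qed

section \<open>Orthogonally diagonalized matrices and the volume of ellipsoids\<close>

lemma diag_mat_mult_vec: "(diag_mat d *v x) $ i = d i * x $ i" for d :: "'n::finite \<Rightarrow> real" and x :: "real^'n"
  by (simp add: diag_mat_def matrix_vector_mult_def if_distrib if_distribR cong: if_cong)

lemma diag_mat_mult: "diag_mat d ** diag_mat d' = diag_mat (\<lambda>i. d i * d' i)" for d d' :: "'n::finite \<Rightarrow> real"
  by (simp add: diag_mat_def matrix_matrix_mult_def vec_eq_iff mult_delta_left)

lemma conj_diag_mult:
  fixes Q :: "real^'n^'n"
  assumes Q: "orthogonal_matrix Q"
  shows "(Q ** diag_mat d ** transpose Q) *v ((Q ** diag_mat d' ** transpose Q) *v x)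
      = (Q ** diag_mat (\<lambda>i. d i * d' i) ** transpose Q) *v x"
proof -
  have "Q ** diag_mat d ** transpose Q ** (Q ** diag_mat d' ** transpose Q)
      = Q ** diag_mat d ** (transpose Q ** Q) ** diag_mat d' ** transpose Q"
    by (simp add: matrix_mul_assoc)
  also have "\<dots> = Q ** diag_mat (\<lambda>i. d i * d' i) ** transpose Q"
    using Q by (simp add: orthogonal_matrix_def matrix_mul_assoc[symmetric] diag_mat_mult)
  finally show ?thesis by (simp add: matrix_vector_mul_assoc)
qed

lemma conj_diag_one:
  fixes Q :: "real^'n^'n"
  assumes Q: "orthogonal_matrix Q" and d: "\<And>i. d i = 1"
  shows "(Q ** diag_mat d ** transpose Q) *v x = x"
proof -
  have "diag_mat d = (mat 1 :: real^'n^'n)" using d by (simp add: diag_mat_def mat_def vec_eq_iff)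
  then show ?thesis using Q by (simp add: orthogonal_matrix_def)
qed

lemma conj_diag_linear:
  fixes Q :: "real^'n^'n"
  shows "(Q ** diag_mat (\<lambda>i. c * d i) ** transpose Q) *v x = c *\<^sub>R ((Q ** diag_mat d ** transpose Q) *v x)"
    and "(Q ** diag_mat (\<lambda>i. d i + d' i) ** transpose Q) *v x
       = (Q ** diag_mat d ** transpose Q) *v x + (Q ** diag_mat d' ** transpose Q) *v x"
proof -
  have *: "(Q ** diag_mat d ** transpose Q) *v x = Q *v (diag_mat d *v (transpose Q *v x))" for d
    by (simp only: matrix_vector_mul_assoc matrix_mul_assoc)
  have "diag_mat (\<lambda>i. c * d i) *v z = c *\<^sub>R (diag_mat d *v z)"
    "diag_mat (\<lambda>i. d i + d' i) *v z = diag_mat d *v z + diag_mat d' *v z" for z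
    by (simp_all add: vec_eq_iff diag_mat_mult_vec algebra_simps)
  then show "(Q ** diag_mat (\<lambda>i. c * d i) ** transpose Q) *v x = c *\<^sub>R ((Q ** diag_mat d ** transpose Q) *v x)"
    "(Q ** diag_mat (\<lambda>i. d i + d' i) ** transpose Q) *v x
       = (Q ** diag_mat d ** transpose Q) *v x + (Q ** diag_mat d' ** transpose Q) *v x"
    by (simp_all only: * matrix_vector_mult_scaleR matrix_vector_right_distrib)
qed

lemma conj_diag_symmetric:
  fixes Q :: "real^'n^'n"
  shows "transpose (Q ** diag_mat d ** transpose Q) = Q ** diag_mat d ** transpose Q"
proof -
  have "transpose (diag_mat d) = diag_mat d" by (simp add: diag_mat_def transpose_def vec_eq_iff)
  then show ?thesis by (simp add: matrix_transpose_mul matrix_mul_assoc)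
qed

lemma orthogonal_matrix_norm:
  fixes Q :: "real^'n^'n"
  assumes "orthogonal_matrix Q"
  shows "norm (Q *v x) = norm x" "norm (transpose Q *v x) = norm x"
proof -
  have "norm (R *v x) = norm x" if "orthogonal_matrix R" for R :: "real^'n^'n"
  proof -
    have "(R *v x) \<bullet> (R *v x) = x \<bullet> (transpose R *v (R *v x))"
      using transpose_mult_inner[of "transpose R" x "R *v x"] by simp
    then show ?thesis using that by (simp add: norm_eq_sqrt_inner matrix_vector_mul_assoc orthogonal_matrix_def)
  qed
  then show "norm (Q *v x) = norm x" "norm (transpose Q *v x) = norm x"
    using assms by (simp_all only: orthogonal_matrix_transpose)
qed

lemma measure_diag_image_cball:
  fixes d :: "'n::finite \<Rightarrow> real"
  assumes d: "\<And>i. 0 < d i"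
  shows "(\<lambda>x. diag_mat d *v x) ` cball 0 R \<in> lmeasurable"
    and "measure lebesgue ((\<lambda>x. diag_mat d *v x) ` cball 0 R) = (\<Prod>i\<in>UNIV. d i) * measure lebesgue (cball (0::real^'n) R)"
proof -
  let ?T = "\<lambda>x. diag_mat d *v x" and ?T' = "\<lambda>x. diag_mat (\<lambda>i. 1 / d i) *v x"
  let ?B = "cball (0::real^'n) R"
  \<comment> \<open>The affine change of variables for \<open>lborel\<close> takes its coefficients
    as a function on basis vectors; \<open>c\<close> is the linear function with value
    \<open>d i\<close> at the i-th one.\<close>
  define c :: "real^'n \<Rightarrow> real" where "c b = (\<Sum>i\<in>UNIV. d i * b $ i)" for b
  have c: "c (axis i 1) = d i" for i
    by (simp add: c_def axis_def if_distrib if_distribR cong: if_cong)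
  have basis: "(Basis :: (real^'n) set) = range (\<lambda>i. axis i 1)" by (auto simp: Basis_vec_def)
  have inj: "inj (\<lambda>i. axis i (1::real) :: real^'n)" by (auto simp: inj_on_def axis_eq_axis)
  have T: "0 + (\<Sum>j\<in>Basis. (c j * (x \<bullet> j)) *\<^sub>R j) = ?T x" for x :: "real^'n"
    unfolding basis sum.reindex[OF inj]
    by (simp add: c inner_axis vec_eq_iff diag_mat_mult_vec)
       (simp add: axis_def if_distrib if_distribR cong: if_cong)
  have TT': "?T (?T' x) = x" "?T' (?T x) = x" for x :: "real^'n"
    using d by (simp_all add: vec_eq_iff diag_mat_mult_vec less_imp_neq[symmetric])
  have cont: "continuous_on UNIV ?T" for d :: "'n \<Rightarrow> real"
    by (intro linear_continuous_on matrix_vector_mul_bounded_linear)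
  have "compact (?T ` ?B)"
    by (intro compact_continuous_image continuous_on_subset[OF cont]) auto
  then show m: "?T ` ?B \<in> lmeasurable" by (rule lmeasurable_compact)
  have b: "?T ` ?B \<in> sets borel" using \<open>compact (?T ` ?B)\<close> by (simp add: compact_imp_closed borel_closed)
  have "lborel = density (distr lborel borel (\<lambda>x. 0 + (\<Sum>j\<in>Basis. (c j * (x \<bullet> j)) *\<^sub>R j))) (\<lambda>_. ennreal (\<Prod>j\<in>(Basis :: (real^'n) set). \<bar>c j\<bar>))"
    using d by (intro lborel_affine_euclidean) (auto simp: basis c less_imp_neq[symmetric])
  also have "(\<Prod>j\<in>(Basis :: (real^'n) set). \<bar>c j\<bar>) = (\<Prod>i\<in>UNIV. d i)"
    unfolding basis prod.reindex[OF inj] using d by (simp add: c less_imp_le)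
  finally have leb: "(lborel :: (real^'n) measure) = density (distr lborel borel ?T) (\<lambda>_. ennreal (\<Prod>i\<in>UNIV. d i))"
    unfolding T .
  have [measurable]: "?T \<in> borel_measurable borel" using cont by (rule borel_measurable_continuous_onI)
  have "emeasure lborel (?T ` ?B) = ennreal (\<Prod>i\<in>UNIV. d i) * emeasure (distr lborel borel ?T) (?T ` ?B)"
    using b by (subst leb) (simp add: emeasure_density nn_integral_cmult)
  also have "emeasure (distr lborel borel ?T) (?T ` ?B) = emeasure lborel (?T -` (?T ` ?B))"
    using b by (subst emeasure_distr) auto
  also have "?T -` (?T ` ?B) = ?B"
  proof -
    have "inj ?T" using TT'(2) by (rule inj_on_inverseI)
    then show ?thesis by (rule inj_vimage_image_eq)
  qed
  finally have "measure lborel (?T ` ?B) = (\<Prod>i\<in>UNIV. d i) * measure lborel ?B"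
    using d by (simp add: measure_def enn2real_mult prod_nonneg less_imp_le)
  then show "measure lebesgue (?T ` ?B) = (\<Prod>i\<in>UNIV. d i) * measure lebesgue ?B"
    using b by (simp add: measure_completion)
qed

text \<open>\<open>transpose Q\<close> preserves the ball, the diagonal matrix scales its volume by
  the product, and \<open>Q\<close> is an isometry, to which the Lipschitz image bound with constant
  1 applies.\<close>

lemma conj_diag_image_cball_measure:
  fixes Q :: "real^'n^'n"
  assumes Q: "orthogonal_matrix Q" and d: "\<And>i. 0 < d i"
  shows "(\<lambda>x. (Q ** diag_mat d ** transpose Q) *v x) ` cball 0 R \<in> lmeasurable" (is "?T \<in> _")
    and "measure lebesgue ((\<lambda>x. (Q ** diag_mat d ** transpose Q) *v x) ` cball 0 R)
      \<le> (\<Prod>i\<in>UNIV. d i) * measure lebesgue (cball (0::real^'n) R)"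
proof -
  let ?S = "(\<lambda>x. diag_mat d *v x) ` cball (0::real^'n) R"
  have "compact ?T"
    by (intro compact_continuous_image linear_continuous_on matrix_vector_mul_bounded_linear compact_cball)
  then show Tm: "?T \<in> lmeasurable" by (rule lmeasurable_compact)
  have sub: "?T \<subseteq> (\<lambda>x. Q *v x) ` ?S"
  proof
    fix z assume "z \<in> ?T"
    then obtain x where x: "norm x \<le> R" "z = (Q ** diag_mat d ** transpose Q) *v x" by auto
    then have "z = Q *v (diag_mat d *v (transpose Q *v x))" by (simp only: matrix_vector_mul_assoc matrix_mul_assoc)
    moreover have "transpose Q *v x \<in> cball 0 R" using orthogonal_matrix_norm(2)[OF Q, of x] x(1) by (simp only: mem_cball_0)
    ultimately show "z \<in> (\<lambda>x. Q *v x) ` ?S" by blast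
  qed
  have "measure lebesgue ?T \<le> (\<Prod>i\<in>UNIV. d i) * measure lebesgue (cball (0::real^'n) R) + e" if e: "0 < e" for e
  proof -
    have lip: "norm (Q *v x - Q *v y) \<le> 1 * norm (x - y)" for x y
      using orthogonal_matrix_norm(1)[OF Q, of "x - y"] by (simp add: matrix_vector_mult_diff_distrib)
    obtain V where V: "V \<in> lmeasurable" "(\<lambda>x. Q *v x) ` ?S \<subseteq> V" "measure lebesgue V \<le> 1 ^ DIM(real^'n) * measure lebesgue ?S + e"
      by (rule lipschitz_image_bound[OF measure_diag_image_cball(1)[where d=d and R=R, OF d] order_refl _ e lip]) auto
    have "measure lebesgue ?T \<le> measure lebesgue V"
      using sub V(2) Tm V(1) by (intro measure_mono_fmeasurable) auto
    then show ?thesis using V(3) measure_diag_image_cball(2)[where d=d and R=R, OF d] by simp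
  qed
  then show "measure lebesgue ?T \<le> (\<Prod>i\<in>UNIV. d i) * measure lebesgue (cball (0::real^'n) R)"
    by (rule field_le_epsilon)
qed

lemma conj_diag_coercive:
  fixes Q :: "real^'n^'n"
  assumes Q: "orthogonal_matrix Q" and e: "\<And>i. 0 < e i"
  obtains \<delta> where "0 < \<delta>" "\<And>w. \<delta> * (w \<bullet> w) \<le> ((Q ** diag_mat e ** transpose Q) *v w) \<bullet> w"
proof
  define \<delta> where "\<delta> = Min (range e)"
  show "0 < \<delta>" unfolding \<delta>_def using e by (subst Min_gr_iff) auto
  have le: "\<delta> \<le> e i" for i unfolding \<delta>_def by (rule Min_le) auto
  fix w
  define z where "z = transpose Q *v w"
  have "((Q ** diag_mat e ** transpose Q) *v w) \<bullet> w = (Q *v (diag_mat e *v z)) \<bullet> w"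
    by (simp only: z_def matrix_vector_mul_assoc matrix_mul_assoc)
  also have "\<dots> = (diag_mat e *v z) \<bullet> z"
    using transpose_mult_inner[of "transpose Q" "diag_mat e *v z" w] by (simp only: transpose_transpose z_def)
  also have "\<dots> = (\<Sum>i\<in>UNIV. e i * (z $ i)\<^sup>2)"
    by (simp add: inner_vec_def diag_mat_mult_vec power2_eq_square mult.assoc)
  also have "\<dots> \<ge> (\<Sum>i\<in>UNIV. \<delta> * (z $ i)\<^sup>2)"
    using le by (intro sum_mono mult_right_mono) auto
  also have "(\<Sum>i\<in>UNIV. \<delta> * (z $ i)\<^sup>2) = \<delta> * (z \<bullet> z)"
    by (simp add: inner_vec_def power2_eq_square sum_distrib_left)
  also have "z \<bullet> z = w \<bullet> w" using orthogonal_matrix_norm(2)[OF Q, of w] by (simp only: z_def norm_eq)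
  finally show "\<delta> * (w \<bullet> w) \<le> ((Q ** diag_mat e ** transpose Q) *v w) \<bullet> w" .
qed

text \<open>A quantitative inverse at one point of differentiability. Monotonicity excludes far
  points whose image is near \<open>\<Psi> y\<close>, which is impossible to exclude for a general
  map; near points are then controlled by the derivative.\<close>

lemma monotone_preimage_near:
  fixes \<Psi> :: "real^'n \<Rightarrow> real^'n"
  assumes mono: "\<And>y y'. 0 \<le> (\<Psi> y - \<Psi> y') \<bullet> (y - y')"
    and Q: "orthogonal_matrix Q" and e: "\<And>i. 0 < e i"
    and D: "(\<Psi> has_derivative (\<lambda>w. (Q ** diag_mat e ** transpose Q) *v w)) (at y)" and \<eta>: "0 < \<eta>"
  obtains r where "0 < r" "\<And>y'. norm (\<Psi> y' - \<Psi> y) < r \<Longrightarrow> \<exists>z. norm z \<le> (1 + \<eta>) * norm (\<Psi> y' - \<Psi> y)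
       \<and> y' = y + (Q ** diag_mat (\<lambda>i. 1 / e i) ** transpose Q) *v z"
proof -
  let ?M = "\<lambda>w. (Q ** diag_mat e ** transpose Q) *v w" and ?L = "\<lambda>w. (Q ** diag_mat (\<lambda>i. 1 / e i) ** transpose Q) *v w"
  have LM: "?L (?M w) = w" for w
    unfolding conj_diag_mult[OF Q] using e by (intro conj_diag_one[OF Q]) (simp add: less_imp_neq[symmetric])
  obtain \<delta> where \<delta>: "0 < \<delta>" "\<And>w. \<delta> * (w \<bullet> w) \<le> ?M w \<bullet> w" by (rule conj_diag_coercive[where Q=Q and e=e, OF Q e]) blast
  have M\<delta>: "\<delta> * norm w \<le> norm (?M w)" for w
  proof (cases "w = 0")
    case False
    have "\<delta> * norm w * norm w \<le> norm (?M w) * norm w"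
      using \<delta>(2)[of w] norm_cauchy_schwarz[of "?M w" w] by (simp add: power2_norm_eq_inner[symmetric] power2_eq_square mult.assoc)
    then show ?thesis using False by simp
  qed simp
  \<comment> \<open>The bound \<delta>/2 keeps half of the coercivity when far points are excluded;
    the other bound lets the linearization error \<epsilon> |w| be absorbed by |M w| \<ge> \<delta>
    |w| at the cost of the factor 1 + \<eta>.\<close>
  define \<epsilon> where "\<epsilon> = min (\<delta> / 2) (\<delta> * \<eta> / (1 + \<eta>))"
  have \<epsilon>: "0 < \<epsilon>" "\<epsilon> \<le> \<delta> / 2" "\<epsilon> * (1 + \<eta>) \<le> \<delta> * \<eta>"
  proof -
    show "0 < \<epsilon>" using \<delta> \<eta> by (simp add: \<epsilon>_def)
    show "\<epsilon> \<le> \<delta> / 2" by (simp only: \<epsilon>_def min.cobounded1)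
    have "\<epsilon> \<le> \<delta> * \<eta> / (1 + \<eta>)" by (simp only: \<epsilon>_def min.cobounded2)
    then show "\<epsilon> * (1 + \<eta>) \<le> \<delta> * \<eta>" using \<eta> by (simp add: field_simps)
  qed
  obtain d where d: "d > 0" "\<And>y'. norm (y' - y) < d \<Longrightarrow> norm (\<Psi> y' - \<Psi> y - ?M (y' - y)) \<le> \<epsilon> * norm (y' - y)"
    using D[unfolded has_derivative_at_alt] \<epsilon>(1) by blast
  show thesis
  proof
    show "0 < \<delta> * d / 4" using \<delta> d by simp
    fix y' assume y': "norm (\<Psi> y' - \<Psi> y) < \<delta> * d / 4"
    let ?\<rho> = "norm (\<Psi> y' - \<Psi> y)"
    have near: "norm (y' - y) < d"
    proof (rule ccontr)
      assume "\<not> norm (y' - y) < d"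
      then have far: "d \<le> norm (y' - y)" by simp
      then have ypos: "0 < norm (y' - y)" using d(1) by linarith
      \<comment> \<open>The point y + w lies on the segment from \<open>y\<close> to
        \<open>y'\<close> at distance d/2. Up to there \<Psi> has moved by at least \<delta> d / 4
        in the direction of \<open>w\<close>, and by monotonicity it cannot move back on the way to
        \<open>y'\<close>.\<close>
      define c where "c = (d / 2) / norm (y' - y)"
      have c: "0 < c" "c < 1" using d(1) far ypos by (simp_all add: c_def divide_less_eq)
      define w where "w = c *\<^sub>R (y' - y)"
      have nw: "norm w = d / 2" using d(1) ypos by (simp add: w_def c_def)
      have "((1 - c) / c) *\<^sub>R w = (1 - c) *\<^sub>R (y' - y)" using c by (simp add: w_def)
      then have "y' - (y + w) = ((1 - c) / c) *\<^sub>R w" by (simp add: w_def algebra_simps)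
      then have "0 \<le> ((1 - c) / c) * ((\<Psi> y' - \<Psi> (y + w)) \<bullet> w)" using mono[of y' "y + w"] by simp
      moreover have "0 < (1 - c) / c" using c by simp
      ultimately have "0 \<le> (\<Psi> y' - \<Psi> (y + w)) \<bullet> w" by (metis mult_zero_right mult_le_cancel_left_pos)
      moreover have "?M w \<bullet> w - (\<Psi> (y + w) - \<Psi> y) \<bullet> w \<le> \<epsilon> * norm w * norm w"
      proof -
        have "norm (\<Psi> (y + w) - \<Psi> y - ?M w) \<le> \<epsilon> * norm w"
        proof -
          have "norm w < d" using nw d(1) by simp
          then show ?thesis using d(2)[of "y + w"] by simp
        qed
        moreover have "- ((\<Psi> (y + w) - \<Psi> y - ?M w) \<bullet> w) \<le> norm (\<Psi> (y + w) - \<Psi> y - ?M w) * norm w"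
          using Cauchy_Schwarz_ineq2[of "\<Psi> (y + w) - \<Psi> y - ?M w" w] by linarith
        ultimately have "- ((\<Psi> (y + w) - \<Psi> y - ?M w) \<bullet> w) \<le> \<epsilon> * norm w * norm w"
          using mult_right_mono[of _ _ "norm w"] norm_ge_zero order_trans by blast
        then show ?thesis by (simp add: inner_diff_left)
      qed
      moreover have "\<epsilon> * norm w * norm w \<le> \<delta> / 2 * (w \<bullet> w)"
        using mult_right_mono[OF \<epsilon>(2), of "w \<bullet> w"] by (simp add: power2_norm_eq_inner[symmetric] power2_eq_square mult.assoc)
      moreover have "(\<Psi> y' - \<Psi> y) \<bullet> w \<le> ?\<rho> * norm w" by (rule norm_cauchy_schwarz)
      ultimately have "\<delta> / 2 * (w \<bullet> w) \<le> ?\<rho> * norm w"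
        using \<delta>(2)[of w] by (simp add: inner_diff_left)
      then have "\<delta> / 2 * norm w * norm w \<le> ?\<rho> * norm w"
        by (simp add: power2_norm_eq_inner[symmetric] power2_eq_square mult.assoc)
      then have "\<delta> * d / 4 \<le> ?\<rho>" using nw d(1) by (simp add: field_simps)
      with y' show False by simp
    qed
    define w where "w = y' - y"
    have "norm (?M w) \<le> ?\<rho> + \<epsilon> * norm w"
      using d(2)[OF near] norm_triangle_ineq4[of "\<Psi> y' - \<Psi> y" "\<Psi> y' - \<Psi> y - ?M w"] by (simp add: w_def)
    then have "(1 + \<eta>) * norm (?M w) \<le> (1 + \<eta>) * ?\<rho> + \<epsilon> * (1 + \<eta>) * norm w"
      using mult_left_mono[of "norm (?M w)" "?\<rho> + \<epsilon> * norm w" "1 + \<eta>"] \<eta> by (simp add: algebra_simps)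
    also have "\<epsilon> * (1 + \<eta>) * norm w \<le> \<eta> * (\<delta> * norm w)"
      using mult_right_mono[OF \<epsilon>(3), of "norm w"] by (simp add: mult_ac)
    also have "\<eta> * (\<delta> * norm w) \<le> \<eta> * norm (?M w)"
      using M\<delta>[of w] \<eta> by (intro mult_left_mono) auto
    finally have "norm (?M w) \<le> (1 + \<eta>) * ?\<rho>" by (simp add: algebra_simps)
    moreover have "y' = y + ?L (?M w)" by (simp only: LM) (simp add: w_def)
    ultimately show "\<exists>z. norm z \<le> (1 + \<eta>) * ?\<rho> \<and> y' = y + ?L z" by blast
  qed
qed

text \<open>This stands in for the area formula: the change of variables theorems of HOL-Analysis require a
  well-ordered index type.\<close>

lemma monotone_preimage_measure:
  fixes \<Psi> :: "real^'n \<Rightarrow> real^'n"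
  assumes mono: "\<And>y y'. 0 \<le> (\<Psi> y - \<Psi> y') \<bullet> (y - y')"
    and D: "\<And>y. y \<in> Y \<Longrightarrow> \<exists>Q e. orthogonal_matrix Q \<and> (\<forall>i. 0 < e i) \<and> 1 \<le> J * (\<Prod>i\<in>UNIV. e i)
        \<and> (\<Psi> has_derivative (\<lambda>w. (Q ** diag_mat e ** transpose Q) *v w)) (at y)"
    and J: "0 < J" and K: "K \<in> lmeasurable" and YK: "\<Psi> ` Y \<subseteq> K" and \<epsilon>: "0 < \<epsilon>" and \<eta>: "0 < \<eta>"
  obtains V where "V \<in> lmeasurable" "Y \<subseteq> V" "measure lebesgue V \<le> (1 + \<eta>) ^ CARD('n) * J * measure lebesgue K + \<epsilon>"
proof -
  let ?L = "\<lambda>Q e w. (Q ** diag_mat (\<lambda>i. 1 / e i :: real) ** transpose Q) *v w"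
  have near: "\<exists>Q e r. orthogonal_matrix Q \<and> (\<forall>i. 0 < e i) \<and> 1 \<le> J * (\<Prod>i\<in>UNIV. e i) \<and> 0 < r
     \<and> (\<forall>y'. norm (\<Psi> y' - \<Psi> y) < r \<longrightarrow> (\<exists>z. norm z \<le> (1 + \<eta>) * norm (\<Psi> y' - \<Psi> y) \<and> y' = y + ?L Q e z))"
    if "y \<in> Y" for y
  proof -
    from D[OF that] obtain Q e where Qe: "orthogonal_matrix Q" "\<And>i. 0 < e i" "1 \<le> J * (\<Prod>i\<in>UNIV. e i)"
      "(\<Psi> has_derivative (\<lambda>w. (Q ** diag_mat e ** transpose Q) *v w)) (at y)" by blast
    obtain r where "0 < r" "\<And>y'. norm (\<Psi> y' - \<Psi> y) < r \<Longrightarrow> \<exists>z. norm z \<le> (1 + \<eta>) * norm (\<Psi> y' - \<Psi> y)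
       \<and> y' = y + ?L Q e z"
      by (rule monotone_preimage_near[OF mono Qe(1,2,4) \<eta>]) blast
    with Qe show ?thesis by blast
  qed
  define P where "P y Q e r \<longleftrightarrow> orthogonal_matrix Q \<and> (\<forall>i. 0 < e i) \<and> 1 \<le> J * (\<Prod>i\<in>UNIV. e i) \<and> 0 < r
     \<and> (\<forall>y'. norm (\<Psi> y' - \<Psi> y) < r \<longrightarrow> (\<exists>z. norm z \<le> (1 + \<eta>) * norm (\<Psi> y' - \<Psi> y) \<and> y' = y + ?L Q e z))" for y Q e r
  have near: "\<exists>Q e r. P y Q e r" if "y \<in> Y" for y
    unfolding P_def by (rule near[OF that])
  \<comment> \<open>\<open>y'\<close> is arbitrary: no other point at all shares its image with a
    point of \<open>Y\<close>, so \<open>f\<close> below is a genuine inverse on the image.\<close>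
  have inj: "y' = y" if y: "y \<in> Y" "\<Psi> y' = \<Psi> y" for y y'
  proof -
    obtain Q e r where "P y Q e r" using near[OF y(1)] by blast
    then have "0 < r" "norm (\<Psi> y' - \<Psi> y) < r \<longrightarrow> (\<exists>z. norm z \<le> (1 + \<eta>) * norm (\<Psi> y' - \<Psi> y) \<and> y' = y + ?L Q e z)"
      by (simp_all add: P_def)
    then obtain z where "norm z \<le> 0" "y' = y + ?L Q e z" using y(2) by auto
    then show ?thesis by simp
  qed
  define f where "f = inv_into Y \<Psi>"
  have f: "f (\<Psi> y) = y" if "y \<in> Y" for y
    unfolding f_def using inj that by (intro inv_into_f_f) (auto simp: inj_on_def)
  have p: "0 \<le> (1 + \<eta>) ^ CARD('n) * J" using J \<eta> by simp
  obtain V where V: "V \<in> lmeasurable" "f ` \<Psi> ` Y \<subseteq> V" "measure lebesgue V \<le> (1 + \<eta>) ^ CARD('n) * J * measure lebesgue K + \<epsilon>"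
  proof (rule vitali_image_bound[OF K YK p \<epsilon>, of f])
    fix N assume N: "N \<subseteq> \<Psi> ` Y" "negligible N"
    show "negligible (f ` N)"
    proof (rule negligible_locally_Lipschitz_image[OF order_refl N(2)])
      fix x assume "x \<in> N"
      then obtain y where y: "y \<in> Y" "x = \<Psi> y" using N by blast
      obtain Q e r where "P y Q e r" using near[OF y(1)] by blast
      then have r: "0 < r" "\<And>y'. norm (\<Psi> y' - \<Psi> y) < r \<longrightarrow> (\<exists>z. norm z \<le> (1 + \<eta>) * norm (\<Psi> y' - \<Psi> y) \<and> y' = y + ?L Q e z)"
        by (simp_all add: P_def)
      obtain B where B: "B > 0" "\<And>z. norm (?L Q e z) \<le> norm z * B"
        using bounded_linear.pos_bounded[OF matrix_vector_mul_bounded_linear[of "Q ** diag_mat (\<lambda>i. 1 / e i) ** transpose Q"]] by blast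
      have "norm (f x' - f x) \<le> (1 + \<eta>) * B * norm (x' - x)" if x': "x' \<in> N \<inter> ball x r" for x'
      proof -
        obtain y' where y': "y' \<in> Y" "x' = \<Psi> y'" using x' N by blast
        then have "norm (\<Psi> y' - \<Psi> y) < r" using x' y by (simp add: dist_norm norm_minus_commute)
        then obtain z where z: "norm z \<le> (1 + \<eta>) * norm (\<Psi> y' - \<Psi> y)" "y' = y + ?L Q e z" using r by blast
        have "norm (f x' - f x) = norm (?L Q e z)" using y y' z(2) f by simp
        also have "\<dots> \<le> (1 + \<eta>) * norm (\<Psi> y' - \<Psi> y) * B"
          by (rule order_trans[OF B(2) mult_right_mono[OF z(1) less_imp_le[OF B(1)]]])
        finally show ?thesis using y y' by (simp add: mult_ac)
      qed
      then show "\<exists>T B. open T \<and> x \<in> T \<and> (\<forall>y\<in>N \<inter> T. norm (f y - f x) \<le> B * norm (y - x))"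
        using r by (intro exI[of _ "ball x r"] exI[of _ "(1 + \<eta>) * B"]) auto
    qed
  next
    fix x and d :: real assume "x \<in> \<Psi> ` Y" and d: "0 < d"
    then obtain y where y: "y \<in> Y" "x = \<Psi> y" by blast
    obtain Q e r where "P y Q e r" using near[OF y(1)] by blast
    then have Qe: "orthogonal_matrix Q" "\<And>i. 0 < e i" "1 \<le> J * (\<Prod>i\<in>UNIV. e i)"
      and r: "0 < r" "\<And>y'. norm (\<Psi> y' - \<Psi> y) < r \<longrightarrow> (\<exists>z. norm z \<le> (1 + \<eta>) * norm (\<Psi> y' - \<Psi> y) \<and> y' = y + ?L Q e z)"
      by (simp_all add: P_def)
    define \<rho> where "\<rho> = min d r / 2"
    have \<rho>: "0 < \<rho>" "\<rho> < d" "\<rho> < r" using d r by (auto simp: \<rho>_def)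
    \<comment> \<open>Points of \<open>Y\<close> with image within \<rho> of \<open>x\<close> lie in
      the translated ellipsoid \<open>W\<close>. Its volume is at most the reciprocal of the product
      of the \<open>e i\<close>, hence at most J, times that of a ball of radius (1 + \<eta>)
      \<rho>.\<close>
    define E where "E = ?L Q e ` cball 0 ((1 + \<eta>) * \<rho>)"
    define W where "W = (+) y ` E"
    have pos: "0 < 1 / e i" for i using Qe(2) by simp
    note E = conj_diag_image_cball_measure[where d = "\<lambda>i. 1 / e i", OF Qe(1) pos, where R = "(1 + \<eta>) * \<rho>", folded E_def]
    have "measure lebesgue W \<le> (\<Prod>i\<in>UNIV. 1 / e i) * measure lebesgue (cball (0::real^'n) ((1 + \<eta>) * \<rho>))"
      unfolding W_def using E by (simp add: measure_translation)
    also have "\<dots> \<le> J * measure lebesgue (cball (0::real^'n) ((1 + \<eta>) * \<rho>))"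
    proof (rule mult_right_mono)
      have "0 < (\<Prod>i\<in>UNIV. e i)" using Qe(2) by (simp add: prod_pos)
      then show "(\<Prod>i\<in>UNIV. 1 / e i) \<le> J" using Qe(3) by (simp add: prod_dividef field_simps)
    qed simp
    also have "\<dots> = (1 + \<eta>) ^ CARD('n) * J * measure lebesgue (cball x \<rho>)"
      using \<rho> \<eta> by (simp add: content_cball power_mult_distrib)
    finally have m: "measure lebesgue W \<le> (1 + \<eta>) ^ CARD('n) * J * measure lebesgue (cball x \<rho>)" .
    have "f ` (\<Psi> ` Y \<inter> cball x \<rho>) \<subseteq> W"
    proof
      fix y' assume "y' \<in> f ` (\<Psi> ` Y \<inter> cball x \<rho>)"
      then have y': "y' \<in> Y" "norm (\<Psi> y' - \<Psi> y) \<le> \<rho>" using f y by (auto simp: dist_norm norm_minus_commute)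
      then obtain z where z: "norm z \<le> (1 + \<eta>) * norm (\<Psi> y' - \<Psi> y)" "y' = y + ?L Q e z" using r \<rho> by force
      have "norm z \<le> (1 + \<eta>) * \<rho>" using z(1) mult_left_mono[OF y'(2), of "1 + \<eta>"] \<eta> by linarith
      then have "z \<in> cball 0 ((1 + \<eta>) * \<rho>)" by simp
      then show "y' \<in> W" unfolding W_def E_def z(2) by blast
    qed
    moreover have "W \<in> lmeasurable" unfolding W_def using E(1) by (rule measurable_translation)
    ultimately show "\<exists>a r W. 0 < r \<and> r < d \<and> x \<in> cball a r \<and> W \<in> lmeasurable
       \<and> f ` (\<Psi> ` Y \<inter> cball a r) \<subseteq> W \<and> measure lebesgue W \<le> (1 + \<eta>) ^ CARD('n) * J * measure lebesgue (cball a r)"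
      using \<rho> m by (intro exI[of _ x] exI[of _ \<rho>] exI[of _ W]) auto
  qed (use that in auto)
  moreover have "f ` \<Psi> ` Y = Y" using f by (force simp: image_image)
  ultimately show thesis using that by auto
qed

section \<open>Contact sets and their dual functions\<close>

text \<open>Here \<open>y\<close> is the vertex of the touching paraboloid, so its slope at \<open>x\<close> is \<open>a (y - x)\<close>.\<close>

definition touches_at :: "(real^'n \<Rightarrow> real) \<Rightarrow> real \<Rightarrow> real^'n \<Rightarrow> real^'n \<Rightarrow> bool" where
  "touches_at u a x y \<longleftrightarrow> (\<forall>x'\<in>cball 0 1. u x + a / 2 * (norm (x - y))\<^sup>2 \<le> u x' + a / 2 * (norm (x' - y))\<^sup>2)"

definition contact_set :: "(real^'n \<Rightarrow> real) \<Rightarrow> real \<Rightarrow> (real^'n) set" where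
  "contact_set u a = {x \<in> ball 0 1. \<exists>y. touches_at u a x y}"

lemma paraboloid_vertex_form:
  fixes x x' y :: "'a::real_inner"
  shows "a / 2 * (norm (x - y))\<^sup>2 - a / 2 * (norm (x' - y))\<^sup>2 = (a *\<^sub>R (y - x)) \<bullet> (x' - x) - a / 2 * (norm (x' - x))\<^sup>2"
proof -
  have "a / 2 * (norm g)\<^sup>2 - a / 2 * (norm (h - g))\<^sup>2 = (a *\<^sub>R g) \<bullet> h - a / 2 * (norm h)\<^sup>2" for g h :: 'a
    by (simp add: power2_norm_eq_inner inner_diff_left inner_diff_right inner_commute[of h g] algebra_simps)
  from this[of "y - x" "x' - x"] show ?thesis by (simp add: norm_minus_commute)
qed

lemma touches_at_iff_slope:
  "touches_at u a x y \<longleftrightarrow> (\<forall>x'\<in>cball 0 1. u x + (a *\<^sub>R (y - x)) \<bullet> (x' - x) - a / 2 * (norm (x' - x))\<^sup>2 \<le> u x')"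
  unfolding touches_at_def
proof (intro ball_cong refl)
  fix x'
  show "(u x + a / 2 * (norm (x - y))\<^sup>2 \<le> u x' + a / 2 * (norm (x' - y))\<^sup>2)
      = (u x + (a *\<^sub>R (y - x)) \<bullet> (x' - x) - a / 2 * (norm (x' - x))\<^sup>2 \<le> u x')"
    using paraboloid_vertex_form[of a x y x'] by linarith
qed

lemma contact_set_Theta_le:
  assumes "x \<in> contact_set u a" "0 < a"
  shows "Theta_lower (ball 0 1) u x \<le> ennreal a"
proof -
  obtain y where "touches_at u a x y" using assms by (auto simp: contact_set_def)
  then have "\<forall>x'\<in>ball 0 1. u x' \<ge> u x + (a *\<^sub>R (y - x)) \<bullet> (x' - x) - a / 2 * (norm (x' - x))\<^sup>2"
    unfolding touches_at_iff_slope using ball_subset_cball by blast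
  then show ?thesis
    unfolding Theta_lower_def using assms(2) by (intro Inf_lower) blast
qed

text \<open>Adding a |x|^2 / 2 turns paraboloids of opening \<open>a\<close> into affine functions:
  the vertex \<open>z\<close> becomes the slope of an affine function that supports u/a + |x|^2/2 at
  \<open>x\<close> on the closed ball.\<close>

lemma touches_at_affine:
  assumes a: "0 < a"
  shows "touches_at u a x z \<longleftrightarrow> (\<forall>x'\<in>cball 0 1. x' \<bullet> z - (u x' / a + x' \<bullet> x' / 2) \<le> x \<bullet> z - (u x / a + x \<bullet> x / 2))"
proof -
  have "u x + a / 2 * (norm (x - z))\<^sup>2 \<le> u x' + a / 2 * (norm (x' - z))\<^sup>2
      \<longleftrightarrow> x' \<bullet> z - (u x' / a + x' \<bullet> x' / 2) \<le> x \<bullet> z - (u x / a + x \<bullet> x / 2)" for x'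
  proof -
    have "u w + a / 2 * (norm (w - z))\<^sup>2 = a * (z \<bullet> z / 2 - (w \<bullet> z - (u w / a + w \<bullet> w / 2)))" for w
      using a by (simp add: power2_norm_eq_inner inner_diff_left inner_diff_right inner_commute[of z w] field_simps)
    then have "u x + a / 2 * (norm (x - z))\<^sup>2 \<le> u x' + a / 2 * (norm (x' - z))\<^sup>2
      \<longleftrightarrow> z \<bullet> z / 2 - (x \<bullet> z - (u x / a + x \<bullet> x / 2)) \<le> z \<bullet> z / 2 - (x' \<bullet> z - (u x' / a + x' \<bullet> x' / 2))"
      using a by (simp only: mult_le_cancel_left_pos)
    then show ?thesis by linarith
  qed
  then show ?thesis by (simp add: touches_at_def)
qed

text \<open>\<open>G\<close> is the conjugate of \<open>w/a' + |x|\<^sup>2/2\<close> for the \<open>a\<close>-envelope \<open>w\<close> of \<open>u\<close>, and \<open>\<Psi>\<close> its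
  gradient; \<open>a < a'\<close> makes that function uniformly convex and \<open>\<Psi>\<close> Lipschitz.\<close>

lemma contact_dual:
  fixes u :: "real^'n \<Rightarrow> real"
  assumes u: "continuous_on (cball 0 1) u" and a: "0 < a" "a < a'"
  defines "s \<equiv> 1 - a / a'" and "t \<equiv> a / a'"
  shows "\<exists>\<Psi> G. (\<forall>x\<in>cball 0 1. \<forall>z. touches_at u a x z \<longrightarrow> \<Psi> (s *\<^sub>R x + t *\<^sub>R z) = x
        \<and> G (s *\<^sub>R x + t *\<^sub>R z) = x \<bullet> (s *\<^sub>R x + t *\<^sub>R z) - u x / a' - x \<bullet> x / 2)
    \<and> (\<forall>x\<in>cball 0 1. \<forall>y. x \<bullet> y - u x / a' - x \<bullet> x / 2 \<le> G y)
    \<and> (\<forall>y y'. 0 \<le> (\<Psi> y - \<Psi> y') \<bullet> (y - y'))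
    \<and> (\<forall>y y'. norm (\<Psi> y - \<Psi> y') \<le> (1 / s) * norm (y - y'))
    \<and> (\<forall>y. (G has_derivative (\<lambda>h. \<Psi> y \<bullet> h)) (at y))"
proof -
  have st: "0 < s" "0 < t" "s + t = 1" using a by (auto simp: s_def t_def field_simps)
  define v where "v x = u x / a + x \<bullet> x / 2" for x
  have contv: "continuous_on (cball 0 1) v" unfolding v_def using a by (intro continuous_intros u) auto
  have sup: "\<exists>x\<in>cball 0 1. \<forall>x'\<in>cball 0 1. x' \<bullet> z - v x' \<le> x \<bullet> z - v x" for z
    by (rule continuous_attains_sup) (auto intro!: continuous_intros contv)
  define xm where "xm z = (SOME x. x \<in> cball 0 1 \<and> (\<forall>x'\<in>cball 0 1. x' \<bullet> z - v x' \<le> x \<bullet> z - v x))" for z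
  have xm: "xm z \<in> cball 0 1" "\<And>x'. x' \<in> cball 0 1 \<Longrightarrow> x' \<bullet> z - v x' \<le> xm z \<bullet> z - v (xm z)" for z
  proof -
    have "xm z \<in> cball 0 1 \<and> (\<forall>x'\<in>cball 0 1. x' \<bullet> z - v x' \<le> xm z \<bullet> z - v (xm z))"
      unfolding xm_def by (rule someI_ex) (use sup in blast)
    then show "xm z \<in> cball 0 1" "\<And>x'. x' \<in> cball 0 1 \<Longrightarrow> x' \<bullet> z - v x' \<le> xm z \<bullet> z - v (xm z)" by auto
  qed
  \<comment> \<open>The convex conjugate of \<open>v\<close> on the closed ball. The supremum is
    attained at \<open>xm z\<close>, of norm at most 1, so \<open>H\<close> is 1-Lipschitz.\<close>
  define H where "H z = xm z \<bullet> z - v (xm z)" for z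
  have Hge: "x \<bullet> z - v x \<le> H z" if "x \<in> cball 0 1" for x z unfolding H_def by (rule xm(2)[OF that])
  have conv: "convex_on UNIV H"
  proof (rule convex_onI)
    fix l and z z' :: "real^'n" assume l: "0 < l" "l < (1::real)"
    let ?z = "(1 - l) *\<^sub>R z + l *\<^sub>R z'"
    have "H ?z = (1 - l) * (xm ?z \<bullet> z - v (xm ?z)) + l * (xm ?z \<bullet> z' - v (xm ?z))"
      unfolding H_def by (simp add: inner_add_right algebra_simps)
    also have "\<dots> \<le> (1 - l) * H z + l * H z'"
      using l Hge[OF xm(1)] by (intro add_mono mult_left_mono) auto
    finally show "H ?z \<le> (1 - l) * H z + l * H z'" .
  qed simp
  have lipH: "H z - H z' \<le> norm (z - z')" for z z' :: "real^'n"
  proof -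
    have "H z - H z' \<le> xm z \<bullet> (z - z')" using Hge[OF xm(1)[of z], of z'] by (simp add: H_def inner_diff_right)
    also have "\<dots> \<le> norm (xm z) * norm (z - z')" by (rule norm_cauchy_schwarz)
    also have "\<dots> \<le> 1 * norm (z - z')" using xm(1)[of z] by (intro mult_right_mono) auto
    finally show ?thesis by simp
  qed
  have contH: "continuous_on UNIV H"
  proof (rule lipschitz_on_continuous_on[of 1])
    show "1-lipschitz_on UNIV H"
    proof (rule lipschitz_onI)
      fix z z'
      show "dist (H z) (H z') \<le> 1 * dist z z'"
        using lipH[of z z'] lipH[of z' z] by (simp add: dist_norm norm_minus_commute abs_le_iff)
    qed simp
  qed
  have low: "- v 0 \<le> H z" for z using Hge[of 0 z] by simp
  have "\<exists>x z. y = s *\<^sub>R x + t *\<^sub>R z \<and> subgrad H z x" for y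
    by (rule minty_surjective[OF conv contH low st(1,2)])
  then obtain \<Psi> P where sol: "\<And>y. y = s *\<^sub>R \<Psi> y + t *\<^sub>R P y \<and> subgrad H (P y) (\<Psi> y)" by metis
  have uniq: "\<Psi> (s *\<^sub>R x + t *\<^sub>R z) = x \<and> P (s *\<^sub>R x + t *\<^sub>R z) = z" if "subgrad H z x" for x z
  proof -
    let ?y = "s *\<^sub>R x + t *\<^sub>R z"
    have eq: "s *\<^sub>R x + t *\<^sub>R z - (s *\<^sub>R \<Psi> ?y + t *\<^sub>R P ?y) = 0" using sol[of ?y] by simp
    have "s * norm (x - \<Psi> ?y) \<le> 0" "t * norm (z - P ?y) \<le> 0"
      using subgrad_resolvent_expansion[OF that _ st(1,2), of "P ?y" "\<Psi> ?y"] sol[of ?y] unfolding eq by auto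
    then show ?thesis using st by (auto simp: mult_le_0_iff)
  qed
  \<comment> \<open>The conjugate of t times the envelope of \<open>v\<close> plus s |x|^2 / 2,
    evaluated through the splitting of y: the part t P y goes to the envelope, the part s \<Psi> y
    to the quadratic.\<close>
  define G where "G y = t * H (P y) + s * (\<Psi> y \<bullet> \<Psi> y) / 2" for y
  have lowerG: "\<Psi> y \<bullet> (y' - y) \<le> G y' - G y" for y y'
  proof -
    have "t * (\<Psi> y \<bullet> (P y' - P y)) \<le> t * (H (P y') - H (P y))"
      using sol[of y] st by (intro mult_left_mono) (auto simp: subgrad_def algebra_simps)
    moreover have "s * (\<Psi> y \<bullet> (\<Psi> y' - \<Psi> y)) \<le> s * ((\<Psi> y' \<bullet> \<Psi> y' - \<Psi> y \<bullet> \<Psi> y) / 2)"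
    proof (rule mult_left_mono)
      have "0 \<le> (\<Psi> y' - \<Psi> y) \<bullet> (\<Psi> y' - \<Psi> y)" by simp
      then show "\<Psi> y \<bullet> (\<Psi> y' - \<Psi> y) \<le> (\<Psi> y' \<bullet> \<Psi> y' - \<Psi> y \<bullet> \<Psi> y) / 2"
        by (simp add: inner_diff_left inner_diff_right inner_commute[of "\<Psi> y'" "\<Psi> y"])
    qed (use st in simp)
    moreover have "\<Psi> y \<bullet> (y' - y) = s * (\<Psi> y \<bullet> (\<Psi> y' - \<Psi> y)) + t * (\<Psi> y \<bullet> (P y' - P y))"
    proof -
      have "y' - y = s *\<^sub>R (\<Psi> y' - \<Psi> y) + t *\<^sub>R (P y' - P y)"
        using sol[of y] sol[of y'] by (metis (no_types, lifting) add_diff_add scaleR_diff_right)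
      then show ?thesis by (simp only: inner_add_right inner_scaleR_right)
    qed
    ultimately show ?thesis unfolding G_def by (simp add: algebra_simps diff_divide_distrib)
  qed
  have mono: "0 \<le> (\<Psi> y - \<Psi> y') \<bullet> (y - y')" for y y'
    using lowerG[of y y'] lowerG[of y' y] by (simp add: inner_diff_left inner_diff_right)
  have lip: "norm (\<Psi> y - \<Psi> y') \<le> (1 / s) * norm (y - y')" for y y'
  proof -
    have "s * norm (\<Psi> y - \<Psi> y') \<le> norm (s *\<^sub>R \<Psi> y + t *\<^sub>R P y - (s *\<^sub>R \<Psi> y' + t *\<^sub>R P y'))"
      using sol by (intro subgrad_resolvent_expansion(1) st) auto
    also have "\<dots> = norm (y - y')" using sol by metis
    finally show ?thesis using st by (simp add: field_simps)
  qed
  \<comment> \<open>Both bounds come from \<open>lowerG\<close>, applied from \<open>y\<close> and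
    from \<open>y'\<close>; the remainder lies between 0 and |y' - y|^2 / s.\<close>
  have der: "(G has_derivative (\<lambda>h. \<Psi> y \<bullet> h)) (at y)" for y
    unfolding has_derivative_at_alt
  proof (intro conjI allI impI)
    show "bounded_linear (\<lambda>h. \<Psi> y \<bullet> h)" by (rule bounded_linear_inner_right)
    fix e :: real assume e: "0 < e"
    show "\<exists>d>0. \<forall>y'. norm (y' - y) < d \<longrightarrow> norm (G y' - G y - \<Psi> y \<bullet> (y' - y)) \<le> e * norm (y' - y)"
    proof (intro exI[of _ "e * s"] conjI allI impI)
      show "0 < e * s" using e st by simp
      fix y' assume y': "norm (y' - y) < e * s"
      have "G y' - G y \<le> \<Psi> y' \<bullet> (y' - y)" using lowerG[of y' y] by (simp add: inner_diff_right)
      then have "G y' - G y - \<Psi> y \<bullet> (y' - y) \<le> (\<Psi> y' - \<Psi> y) \<bullet> (y' - y)" by (simp add: inner_diff_left)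
      also have "\<dots> \<le> norm (\<Psi> y' - \<Psi> y) * norm (y' - y)" by (rule norm_cauchy_schwarz)
      also have "\<dots> \<le> e * norm (y' - y)"
      proof (rule mult_right_mono)
        have "norm (\<Psi> y' - \<Psi> y) \<le> (1 / s) * norm (y' - y)" by (rule lip)
        also have "\<dots> \<le> (1 / s) * (e * s)" using y' st by (intro mult_left_mono) auto
        finally show "norm (\<Psi> y' - \<Psi> y) \<le> e" using st by simp
      qed simp
      finally show "norm (G y' - G y - \<Psi> y \<bullet> (y' - y)) \<le> e * norm (y' - y)"
        using lowerG[of y y'] by simp
    qed
  qed
  have ta: "t / a = 1 / a'" using a by (simp add: t_def)
  \<comment> \<open>Because of t / a = 1 / a', mixing \<open>v\<close> with |x|^2 / 2 yields the
    analogous function for the larger opening.\<close>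
  have tv: "t * v x + s * (x \<bullet> x) / 2 = u x / a' + x \<bullet> x / 2" for x
  proof -
    have "t * v x + s * (x \<bullet> x) / 2 = u x * (t / a) + (s + t) * (x \<bullet> x) / 2"
      by (simp add: v_def algebra_simps add_divide_distrib)
    then show ?thesis using st by (simp add: ta)
  qed
  have fenchel: "x \<bullet> y - u x / a' - x \<bullet> x / 2 \<le> G y" if x: "x \<in> cball 0 1" for x y
  proof -
    have 1: "t * (x \<bullet> P y - v x) \<le> t * H (P y)" using Hge[OF x] st by simp
    have 2: "s * (x \<bullet> \<Psi> y - x \<bullet> x / 2) \<le> s * (\<Psi> y \<bullet> \<Psi> y / 2)"
    proof (rule mult_left_mono)
      have "0 \<le> (x - \<Psi> y) \<bullet> (x - \<Psi> y)" by simp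
      then show "x \<bullet> \<Psi> y - x \<bullet> x / 2 \<le> \<Psi> y \<bullet> \<Psi> y / 2"
        by (simp add: inner_diff_left inner_diff_right inner_commute[of "\<Psi> y" x])
    qed (use st in simp)
    have "x \<bullet> y = s * (x \<bullet> \<Psi> y) + t * (x \<bullet> P y)"
      using sol[of y] by (metis inner_add_right inner_scaleR_right)
    then show ?thesis using 1 2 tv[of x] unfolding G_def by (simp add: algebra_simps)
  qed
  have contact: "\<Psi> (s *\<^sub>R x + t *\<^sub>R z) = x
        \<and> G (s *\<^sub>R x + t *\<^sub>R z) = x \<bullet> (s *\<^sub>R x + t *\<^sub>R z) - u x / a' - x \<bullet> x / 2"
    if x: "x \<in> cball 0 1" and touch: "touches_at u a x z" for x z
  proof -
    have max: "\<And>x'. x' \<in> cball 0 1 \<Longrightarrow> x' \<bullet> z - v x' \<le> x \<bullet> z - v x"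
      using touch unfolding touches_at_affine[OF a(1)] v_def by blast
    have Hz: "H z = x \<bullet> z - v x" using max[OF xm(1)[of z]] Hge[OF x, of z] by (simp add: H_def)
    have "subgrad H z x"
      unfolding subgrad_def Hz using Hge[OF x] by (simp add: inner_diff_right)
    from uniq[OF this] have *: "\<Psi> (s *\<^sub>R x + t *\<^sub>R z) = x" "P (s *\<^sub>R x + t *\<^sub>R z) = z" by auto
    then show ?thesis
      using tv[of x] unfolding G_def * Hz by (simp add: inner_add_right algebra_simps)
  qed
  show ?thesis
    by (intro exI[of _ \<Psi>] exI[of _ G] conjI[OF _ conjI[OF _ conjI[OF _ conjI]]] ballI allI impI; fact contact fenchel mono lip der)
qed

text \<open>The derivative D of \<Psi> is symmetric, being a second derivative, and nonnegative by
  monotonicity. With X = \<Psi> y, inserting y + (D + \<epsilon>)^(-1) (x' - X) into the Fenchel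
  inequality converts the second order upper bound for \<open>G\<close> into a quadratic below
  \<open>u\<close> with Hessian a ((D + \<epsilon>)^(-1) - I). The viscosity conditions for it bound
  the product of the inverse eigenvalues, which also rules out a zero eigenvalue of D in the
  limit.\<close>

lemma contact_dual_derivative:
  fixes u :: "real^'n \<Rightarrow> real"
  assumes visc: "viscosity_pucci_minus_le_0 lam Lam (ball 0 1) u" and num: "viscosity_nonpos_eigenvalues_ge (ball 0 1) u k"
    and lam: "0 < lam" "lam \<le> Lam" and k: "k \<le> CARD('n)" and a: "0 < a"
    and fenchel: "\<And>x y. x \<in> cball 0 1 \<Longrightarrow> x \<bullet> y - u x / a - x \<bullet> x / 2 \<le> G y"
    and mono: "\<And>y y'. 0 \<le> (\<Psi> y - \<Psi> y') \<bullet> (y - y')"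
    and G: "\<And>y. (G has_derivative (\<lambda>h. \<Psi> y \<bullet> h)) (at y)"
    and x: "\<Psi> y \<in> ball 0 1" and Gy: "G y = \<Psi> y \<bullet> y - u (\<Psi> y) / a - \<Psi> y \<bullet> \<Psi> y / 2"
    and diff: "\<Psi> differentiable (at y)"
  shows "\<exists>Q e. orthogonal_matrix Q \<and> (\<forall>i. 0 < e i)
      \<and> 1 \<le> (Lam / lam / (2 - lam / Lam)) ^ (CARD('n) - k) * (\<Prod>i\<in>UNIV. e i)
      \<and> (\<Psi> has_derivative (\<lambda>w. (Q ** diag_mat e ** transpose Q) *v w)) (at y)"
proof -
  define J where "J = (Lam / lam / (2 - lam / Lam)) ^ (CARD('n) - k)"
  obtain D where D: "(\<Psi> has_derivative D) (at y)" using diff by (auto simp: differentiable_def)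
  have lin: "linear D" using D has_derivative_linear by blast
  define A where "A = matrix D"
  have DA: "D w = A *v w" for w using lin by (simp add: A_def matrix_works)
  have sym: "(A *v h) \<bullet> k = h \<bullet> (A *v k)" for h k
    using gradient_derivative_symmetric[OF G D, of h k] by (simp add: DA)
  have "transpose A = A"
  proof -
    have "(A *v axis j 1) \<bullet> axis i 1 = axis j 1 \<bullet> (A *v axis i 1)" for i j by (rule sym)
    then show ?thesis
      by (simp add: vec_eq_iff transpose_def inner_axis inner_axis' matrix_vector_mult_basis column_def)
  qed
  then obtain Q e where Q: "orthogonal_matrix Q" and A: "A = Q ** diag_mat e ** transpose Q"
    using symmetric_matrix_diagonalizable by blast
  have psd: "0 \<le> D w \<bullet> w" for w
  proof -
    have "((\<lambda>\<tau>. \<Psi> (y + \<tau> *\<^sub>R w)) has_derivative (\<lambda>h. D (h *\<^sub>R w))) (at 0)"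
      by (rule has_derivative_compose[of "\<lambda>\<tau>. y + \<tau> *\<^sub>R w" _ 0 UNIV \<Psi>]) (use D in \<open>auto intro!: derivative_eq_intros\<close>)
    then have "((\<lambda>\<tau>. \<Psi> (y + \<tau> *\<^sub>R w) \<bullet> w) has_derivative (\<lambda>h. D (h *\<^sub>R w) \<bullet> w)) (at 0)"
      by (rule has_derivative_inner_left)
    then have "((\<lambda>\<tau>. \<Psi> (y + \<tau> *\<^sub>R w) \<bullet> w) has_real_derivative D w \<bullet> w) (at 0)"
      unfolding has_field_derivative_def
      by (rule has_derivative_eq_rhs) (simp add: fun_eq_iff linear_scale[OF lin] mult.commute)
    then have "(\<lambda>h. (\<Psi> (y + (0 + h) *\<^sub>R w) \<bullet> w - \<Psi> (y + 0 *\<^sub>R w) \<bullet> w) / h) \<midarrow>0\<rightarrow> D w \<bullet> w"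
      unfolding DERIV_def by simp
    moreover have "\<forall>\<^sub>F h in at 0. 0 \<le> (\<Psi> (y + (0 + h) *\<^sub>R w) \<bullet> w - \<Psi> (y + 0 *\<^sub>R w) \<bullet> w) / h"
    proof (intro always_eventually allI)
      fix h :: real
      have "0 \<le> (\<Psi> (y + h *\<^sub>R w) \<bullet> w - \<Psi> y \<bullet> w) * h"
        using mono[of "y + h *\<^sub>R w" y] by (simp add: inner_diff_left mult.commute)
      then show "0 \<le> (\<Psi> (y + (0 + h) *\<^sub>R w) \<bullet> w - \<Psi> (y + 0 *\<^sub>R w) \<bullet> w) / h"
        by (auto simp: zero_le_mult_iff zero_le_divide_iff)
    qed
    ultimately show ?thesis by (rule tendsto_lowerbound) simp
  qed
  have e0: "0 \<le> e i" for i
  proof -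
    have "transpose Q *v (Q *v axis i 1) = axis i 1"
      using Q by (simp only: matrix_vector_mul_assoc orthogonal_matrix matrix_vector_mul_lid)
    then have "D (Q *v axis i 1) = Q *v (diag_mat e *v axis i 1)"
      unfolding DA A by (simp only: matrix_vector_mul_assoc[symmetric])
    then have "D (Q *v axis i 1) \<bullet> (Q *v axis i 1) = (diag_mat e *v axis i 1) \<bullet> (transpose Q *v (Q *v axis i 1))"
      using transpose_mult_inner[of "transpose Q" "diag_mat e *v axis i 1" "Q *v axis i 1"] by (simp only: transpose_transpose)
    also have "\<dots> = e i"
      unfolding \<open>transpose Q *v (Q *v axis i 1) = axis i 1\<close> by (simp add: inner_axis diag_mat_mult_vec)
    finally show ?thesis using psd[of "Q *v axis i 1"] by simp
  qed
  define X where "X = \<Psi> y"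
  have bound: "1 \<le> J * (\<Prod>i\<in>UNIV. e i + \<epsilon>)" if \<epsilon>: "0 < \<epsilon>" for \<epsilon>
  proof -
    \<comment> \<open>The eigenvalues of (D + \<epsilon>)^(-1). The shift is there because D is so
      far only known to be nonnegative.\<close>
    define \<mu> where "\<mu> i = 1 / (e i + \<epsilon>)" for i
    have ep: "0 < e i + \<epsilon>" for i using e0[of i] \<epsilon> by simp
    have \<mu>: "0 < \<mu> i" for i using ep by (simp add: \<mu>_def)
    let ?L = "\<lambda>w. (Q ** diag_mat \<mu> ** transpose Q) *v w"
    define M where "M = Q ** diag_mat (\<lambda>i. a * (\<mu> i - 1)) ** transpose Q"
    have Mv: "M *v w = a *\<^sub>R (?L w - w)" for w
    proof -
      have "M *v w = a *\<^sub>R ((Q ** diag_mat (\<lambda>i. \<mu> i + (- 1)) ** transpose Q) *v w)"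
        unfolding M_def conj_diag_linear(1)[symmetric] by simp
      also have "(Q ** diag_mat (\<lambda>i. \<mu> i + (- 1)) ** transpose Q) *v w = ?L w + (Q ** diag_mat (\<lambda>i. - 1) ** transpose Q) *v w"
        by (rule conj_diag_linear(2))
      also have "(Q ** diag_mat (\<lambda>i. - 1) ** transpose Q) *v w = - w"
        using conj_diag_linear(1)[of Q "- 1" "\<lambda>i. 1" w] conj_diag_one[OF Q, of "\<lambda>i. 1" w] by simp
      finally show ?thesis by simp
    qed
    have inv: "D (?L z) + \<epsilon> *\<^sub>R ?L z = z" for z
    proof -
      have "D (?L z) + \<epsilon> *\<^sub>R ?L z = (Q ** diag_mat (\<lambda>i. e i * \<mu> i + \<epsilon> * \<mu> i) ** transpose Q) *v z"
        unfolding DA A by (simp only: conj_diag_linear conj_diag_mult[OF Q])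
      also have "\<dots> = z"
      proof (rule conj_diag_one[OF Q])
        show "e i * \<mu> i + \<epsilon> * \<mu> i = 1" for i using ep[of i] by (simp add: \<mu>_def add_divide_distrib[symmetric])
      qed
      finally show ?thesis .
    qed
    obtain d where d: "d > 0" "\<And>w. norm w < d \<Longrightarrow> G (y + w) \<le> G y + \<Psi> y \<bullet> w + (D w \<bullet> w + \<epsilon> * (w \<bullet> w)) / 2"
      using gradient_taylor_upper[OF G D \<epsilon>] by blast
    obtain B where B: "B > 0" "\<And>z. norm (?L z) \<le> norm z * B"
      using bounded_linear.pos_bounded[OF matrix_vector_mul_bounded_linear[of "Q ** diag_mat \<mu> ** transpose Q"]] by blast
    \<comment> \<open>The first bound keeps \<open>?L z\<close> within reach of the expansion of
      \<open>G\<close>, the second keeps \<open>x'\<close> in the ball where \<open>fenchel\<close>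
      holds.\<close>
    define r where "r = min (d / B) (1 - norm X)"
    have r: "0 < r" using d B x by (simp add: r_def X_def)
    have touch: "u X + (a *\<^sub>R (y - X)) \<bullet> (x' - X) + (x' - X) \<bullet> (M *v (x' - X)) / 2 \<le> u x'"
      if x': "norm (x' - X) < r" for x'
    proof -
      define z where "z = x' - X"
      have "norm (?L z) < d"
      proof -
        have "norm (?L z) \<le> norm z * B" by (rule B)
        also have "\<dots> < d / B * B" using x' B by (intro mult_strict_right_mono) (auto simp: z_def r_def)
        finally show ?thesis using B by simp
      qed
      from d(2)[OF this] have "G (y + ?L z) \<le> G y + X \<bullet> ?L z + (D (?L z) + \<epsilon> *\<^sub>R ?L z) \<bullet> ?L z / 2"
        by (simp add: X_def inner_add_left)
      then have 1: "G (y + ?L z) \<le> G y + X \<bullet> ?L z + z \<bullet> ?L z / 2" unfolding inv .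
      have "norm x' \<le> norm X + norm z" unfolding z_def using norm_triangle_sub by (simp add: norm_triangle_sub add.commute)
      then have "x' \<in> cball 0 1" using x' by (simp add: r_def z_def)
      from fenchel[OF this, of "y + ?L z"] have 2: "x' \<bullet> (y + ?L z) - u x' / a - x' \<bullet> x' / 2 \<le> G (y + ?L z)" .
      have 3: "G y = X \<bullet> y - u X / a - X \<bullet> X / 2" using Gy by (simp add: X_def)
      have x'z: "x' = X + z" by (simp add: z_def)
      have "u X / a + z \<bullet> (y - X) - z \<bullet> z / 2 + z \<bullet> ?L z / 2 \<le> u x' / a"
      proof -
        have arith: "B + (F - H) - I / 2 + E / 2 \<le> U"
          if "g \<le> A - B - C / 2 + D + E / 2" "A + F + (D + E) - U - (C + H + (H + I)) / 2 \<le> g" for A B C D E F g H I U :: real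
          using that by (simp add: field_simps)
        show ?thesis
          using arith[OF 1[unfolded 3] 2[unfolded x'z inner_add_left inner_add_right inner_commute[of z X]]]
          by (simp only: x'z inner_diff_right inner_commute[of z X])
      qed
      then have "a * (u X / a + z \<bullet> (y - X) - z \<bullet> z / 2 + z \<bullet> ?L z / 2) \<le> a * (u x' / a)"
        using a by (intro mult_left_mono) auto
      moreover have "(a *\<^sub>R (y - X)) \<bullet> z + z \<bullet> (M *v z) / 2 = a * (z \<bullet> (y - X) - z \<bullet> z / 2 + z \<bullet> ?L z / 2)"
        unfolding Mv inner_commute[of z "y - X"]
        by (simp add: inner_diff_right[of z "?L z" z] algebra_simps diff_divide_distrib)
      ultimately show ?thesis using a by (simp add: z_def[symmetric] algebra_simps)
    qed
    have Mt: "transpose M = M" unfolding M_def by (rule conj_diag_symmetric)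
    have X: "X \<in> ball 0 1" using x by (simp add: X_def)
    have "pucci_minus lam Lam M \<le> 0" "k \<le> num_nonpos_eigenvalues M"
      using viscosity_conditions_if_touching[OF Mt X r touch] visc num by blast+
    then have "(\<Prod>i\<in>UNIV. \<mu> i) \<le> J"
      unfolding M_def J_def by (intro prod_eigenvalues_le_if_pucci[OF Q lam a k \<mu>])
    moreover have "(\<Prod>i\<in>UNIV. \<mu> i) = 1 / (\<Prod>i\<in>UNIV. e i + \<epsilon>)" by (simp add: \<mu>_def prod_dividef)
    moreover have "0 < (\<Prod>i\<in>UNIV. e i + \<epsilon>)" using ep by (simp add: prod_pos)
    ultimately show ?thesis by (simp add: field_simps)
  qed
  have lim: "((\<lambda>\<epsilon>. J * (\<Prod>i\<in>UNIV. e i + \<epsilon>)) \<longlongrightarrow> J * (\<Prod>i\<in>UNIV. e i + 0)) (at_right 0)"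
    by (intro tendsto_intros)
  have ev: "\<forall>\<^sub>F \<epsilon> in at_right 0. 1 \<le> J * (\<Prod>i\<in>UNIV. e i + \<epsilon>)"
    unfolding eventually_at_right_field using bound by (intro exI[of _ 1]) auto
  have J1: "1 \<le> J * (\<Prod>i\<in>UNIV. e i)"
    using tendsto_lowerbound[OF lim ev] by simp
  have "e i \<noteq> 0" for i
  proof
    assume "e i = 0"
    then have "(\<Prod>i\<in>UNIV. e i) = 0" by (intro prod_zero) auto
    with J1 show False by (simp only: mult_zero_right)
  qed
  then have "0 < e i" for i using e0[of i] by (simp add: order_le_less)
  moreover have "(\<Psi> has_derivative (\<lambda>w. (Q ** diag_mat e ** transpose Q) *v w)) (at y)"
    using D by (simp only: DA[abs_def] A[symmetric])
  ultimately show ?thesis using Q J1 unfolding J_def by blast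
qed

text \<open>\<open>c\<close> is the value at \<open>x\<close> of the convex envelope of
  \<open>v\<close> over \<open>S\<close>, and \<open>y\<close> a subgradient of the envelope there.
  Maximality among affine minorants says this without introducing the envelope.\<close>

definition max_support :: "(real^'n) set \<Rightarrow> (real^'n \<Rightarrow> real) \<Rightarrow> real^'n \<Rightarrow> real \<Rightarrow> real^'n \<Rightarrow> bool" where
  "max_support S v x c y \<longleftrightarrow> (\<forall>x'\<in>S. c + y \<bullet> (x' - x) \<le> v x')
     \<and> (\<forall>c' y'. (\<forall>x'\<in>S. c' + y' \<bullet> (x' - x) \<le> v x') \<longrightarrow> c' \<le> c)"

text \<open>Compactness: the constant min v is an admissible minorant, and a minorant of at least
  that height at \<open>x\<close> has slope at most the oscillation of \<open>v\<close> divided by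
  the distance of \<open>x\<close> from the boundary.\<close>

lemma max_support_exists:
  assumes v: "continuous_on (cball 0 1) v" and x: "x \<in> ball 0 1"
  obtains c y where "max_support (cball 0 1) v x c y"
proof -
  let ?S = "cball (0 :: real^'n) 1"
  obtain x1 where x1: "x1 \<in> ?S" "\<And>x'. x' \<in> ?S \<Longrightarrow> v x1 \<le> v x'"
    using continuous_attains_inf[OF compact_cball _ v] by auto
  obtain x2 where x2: "x2 \<in> ?S" "\<And>x'. x' \<in> ?S \<Longrightarrow> v x' \<le> v x2"
    using continuous_attains_sup[OF compact_cball _ v] by auto
  define r where "r = 1 - norm x"
  have r: "0 < r" using x by (simp add: r_def)
  define R where "R = (v x2 - v x1) / r"
  define C where "C = {p \<in> {v x1..v x2} \<times> cball 0 R. \<forall>x'\<in>?S. fst p + snd p \<bullet> (x' - x) \<le> v x'}"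
  have R: "0 \<le> R" using x1(2)[OF x2(1)] r by (simp add: R_def)
  have "closed C"
  proof -
    have "C = ({v x1..v x2} \<times> cball 0 R) \<inter> (\<Inter>x'\<in>?S. {p. fst p + snd p \<bullet> (x' - x) \<le> v x'})"
      by (auto simp: C_def)
    moreover have "closed {p. fst p + snd p \<bullet> (x' - x) \<le> v x'}" for x'
      by (intro closed_Collect_le continuous_intros)
    ultimately show ?thesis by (auto intro!: closed_Int closed_Times)
  qed
  moreover have "bounded C"
    by (rule bounded_subset[of "{v x1..v x2} \<times> cball 0 R"]) (auto simp: C_def intro: bounded_Times)
  ultimately have "compact C" by (simp add: compact_eq_bounded_closed)
  moreover have "(v x1, 0) \<in> C" using x1 x1(2)[OF x2(1)] R by (auto simp: C_def)
  ultimately obtain p where p: "p \<in> C" "\<And>q. q \<in> C \<Longrightarrow> fst q \<le> fst p"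
    using continuous_attains_sup[OF _ _ continuous_on_fst[OF continuous_on_id], of C] by blast
  have "max_support ?S v x (fst p) (snd p)"
    unfolding max_support_def
  proof (intro conjI allI impI)
    show "\<forall>x'\<in>?S. fst p + snd p \<bullet> (x' - x) \<le> v x'" using p(1) by (simp add: C_def)
    fix c' y' assume adm: "\<forall>x'\<in>?S. c' + y' \<bullet> (x' - x) \<le> v x'"
    show "c' \<le> fst p"
    proof (cases "v x1 \<le> c'")
      case False
      then show ?thesis using p(2)[OF \<open>(v x1, 0) \<in> C\<close>] by simp
    next
      case True
      have "x + r *\<^sub>R sgn y' \<in> ?S"
      proof -
        have "norm (x + r *\<^sub>R sgn y') \<le> norm x + r"
          using norm_triangle_ineq[of x "r *\<^sub>R sgn y'"] r by (simp add: norm_sgn split: if_splits)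
        then show ?thesis by (simp add: r_def)
      qed
      then have "c' + y' \<bullet> (r *\<^sub>R sgn y') \<le> v x2"
        using bspec[OF adm, of "x + r *\<^sub>R sgn y'"] x2(2)[of "x + r *\<^sub>R sgn y'"] by simp
      moreover have "y' \<bullet> sgn y' = norm y'"
        by (cases "y' = 0") (simp_all add: sgn_div_norm power2_norm_eq_inner[symmetric] power2_eq_square)
      ultimately have "norm y' \<le> R" using True r by (simp add: R_def field_simps)
      moreover have "c' \<le> v x2" using bspec[OF adm, of x] x x2(2)[of x] by simp
      ultimately have "(c', y') \<in> C" using True adm by (auto simp: C_def)
      from p(2)[OF this] show ?thesis by simp
    qed
  qed
  then show thesis by (rule that)
qed

text \<open>Each of the two affine functions is a competitor at the point of the other; the two
  resulting inequalities are added.\<close>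

lemma max_support_mono:
  assumes "max_support S v x c y" "max_support S v x' c' y'"
  shows "0 \<le> (y - y') \<bullet> (x - x')"
proof -
  have "\<forall>z\<in>S. (c' + y' \<bullet> (x - x')) + y' \<bullet> (z - x) \<le> v z" "\<forall>z\<in>S. (c + y \<bullet> (x' - x)) + y \<bullet> (z - x') \<le> v z"
    using assms by (auto simp: max_support_def inner_diff_right algebra_simps)
  then have "c' + y' \<bullet> (x - x') \<le> c" "c + y \<bullet> (x' - x) \<le> c'"
    using assms unfolding max_support_def by blast+
  then show ?thesis by (simp add: inner_diff_left inner_diff_right)
qed

text \<open>At a contact point the envelope equals the function itself, so maximality is read off by
  evaluating a competitor at \<open>x\<close>.\<close>

lemma touches_at_max_support:
  assumes a: "0 < a" and x: "x \<in> cball 0 1" and touch: "touches_at u a x z"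
  shows "max_support (cball 0 1) (\<lambda>x. u x / a + x \<bullet> x / 2) x (u x / a + x \<bullet> x / 2) z"
  unfolding max_support_def
proof (intro conjI allI impI)
  show "\<forall>x'\<in>cball 0 1. u x / a + x \<bullet> x / 2 + z \<bullet> (x' - x) \<le> u x' / a + x' \<bullet> x' / 2"
    using touch unfolding touches_at_affine[OF a]
    by (auto simp: inner_diff_right inner_commute[of z] algebra_simps)
  fix c' y' assume "\<forall>x'\<in>cball 0 1. c' + y' \<bullet> (x' - x) \<le> u x' / a + x' \<bullet> x' / 2"
  from bspec[OF this x] show "c' \<le> u x / a + x \<bullet> x / 2" by simp
qed

text \<open>Both paraboloids stay below \<open>u\<close> when their openings are raised to the
  larger one with unchanged slopes at \<open>x\<close>, and a supersolution admits only one
  slope.\<close>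

lemma touches_at_unique:
  fixes u :: "real^'n \<Rightarrow> real"
  assumes visc: "viscosity_pucci_minus_le_0 lam Lam (ball 0 1) u" and lam: "0 < lam" "lam \<le> Lam"
    and x: "x \<in> ball 0 1" and "touches_at u a x y" "touches_at u b x z"
  shows "a *\<^sub>R (y - x) = b *\<^sub>R (z - x)"
proof (rule touching_slope_unique[OF visc lam x, where d = "1 - norm x" and a = "max a b"])
  show "0 < 1 - norm x" using x by simp
  fix x' assume x': "norm (x' - x) < 1 - norm x"
  then have "x' \<in> cball 0 1" using norm_triangle_ineq[of x "x' - x"] by simp
  then have "u x + (a *\<^sub>R (y - x)) \<bullet> (x' - x) - a / 2 * (norm (x' - x))\<^sup>2 \<le> u x'"
    "u x + (b *\<^sub>R (z - x)) \<bullet> (x' - x) - b / 2 * (norm (x' - x))\<^sup>2 \<le> u x'"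
    using assms(5,6) unfolding touches_at_iff_slope by blast+
  moreover have "a / 2 * (norm (x' - x))\<^sup>2 \<le> max a b / 2 * (norm (x' - x))\<^sup>2"
    "b / 2 * (norm (x' - x))\<^sup>2 \<le> max a b / 2 * (norm (x' - x))\<^sup>2"
    by (intro mult_right_mono; simp)+
  ultimately show "u x + (a *\<^sub>R (y - x)) \<bullet> (x' - x) - max a b / 2 * (norm (x' - x))\<^sup>2 \<le> u x'"
    "u x + (b *\<^sub>R (z - x)) \<bullet> (x' - x) - max a b / 2 * (norm (x' - x))\<^sup>2 \<le> u x'"
    by linarith+
qed

text \<open>The vertex is an unbounded witness and \<open>x\<close> ranges over an open ball, so the
  set is exhibited as a countable union of projections of compact sets of pairs.\<close>

lemma contact_set_borel:
  fixes u :: "real^'n \<Rightarrow> real"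
  assumes u: "continuous_on (cball 0 1) u"
  shows "contact_set u a \<in> sets borel"
proof -
  define K where "K n = cball (0::real^'n) (1 - 1 / Suc n) \<times> cball (0::real^'n) (real n)" for n
  define C where "C n = {p \<in> K n. touches_at u a (fst p) (snd p)}" for n
  have "compact (C n)" for n
  proof -
    have sub: "fst ` K n \<subseteq> cball 0 1"
    proof
      fix x assume "x \<in> fst ` K n"
      then have "norm x \<le> 1 - 1 / Suc n" by (auto simp: K_def)
      moreover have "0 \<le> 1 / real (Suc n)" by simp
      ultimately have "norm x \<le> 1" by linarith
      then show "x \<in> cball 0 1" by simp
    qed
    have cont: "continuous_on (K n) (\<lambda>p. u (fst p) + a / 2 * (norm (fst p - snd p))\<^sup>2)"
      by (intro continuous_intros continuous_on_compose2[OF u _ sub])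
    have K: "compact (K n)" unfolding K_def by (intro compact_Times compact_cball)
    have "C n = K n \<inter> (\<Inter>x'\<in>cball 0 1. {p \<in> K n. u (fst p) + a / 2 * (norm (fst p - snd p))\<^sup>2 \<le> u x' + a / 2 * (norm (x' - snd p))\<^sup>2})"
      by (auto simp: C_def touches_at_def)
    moreover have "closed {p \<in> K n. u (fst p) + a / 2 * (norm (fst p - snd p))\<^sup>2 \<le> u x' + a / 2 * (norm (x' - snd p))\<^sup>2}" for x'
      by (intro continuous_on_closed_Collect_le cont compact_imp_closed[OF K] continuous_intros)
    ultimately have "closed (C n)" using compact_imp_closed[OF K] by (auto intro!: closed_Int closed_INT)
    moreover have "C n = K n \<inter> C n" by (auto simp: C_def)
    ultimately show ?thesis using compact_Int_closed[OF K] by metis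
  qed
  then have "compact (fst ` C n)" for n by (intro compact_continuous_image continuous_intros)
  then have "fst ` C n \<in> sets borel" for n by (intro borel_closed compact_imp_closed)
  then have "(\<Union>n. fst ` C n) \<in> sets borel" by (intro sets.countable_UN) auto
  moreover have "contact_set u a = (\<Union>n. fst ` C n)"
  proof (intro equalityI subsetI)
    fix x assume "x \<in> contact_set u a"
    then obtain y where x: "norm x < 1" and y: "touches_at u a x y" by (auto simp: contact_set_def)
    obtain n1 where n1: "1 / Suc n1 < 1 - norm x" using x nat_approx_posE[of "1 - norm x"] by auto
    obtain n2 where n2: "norm y \<le> real n2" using real_arch_simple by blast
    define n where "n = max n1 n2"
    have "1 / Suc n \<le> 1 / Suc n1" by (intro divide_left_mono) (auto simp: n_def)
    then have "norm x \<le> 1 - 1 / Suc n" using n1 by linarith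
    moreover have "norm y \<le> real n" using n2 by (simp add: n_def)
    ultimately have "(x, y) \<in> C n" using y by (auto simp: C_def K_def)
    then show "x \<in> (\<Union>n. fst ` C n)" by force
  next
    fix x assume "x \<in> (\<Union>n. fst ` C n)"
    then obtain n y where *: "norm x \<le> 1 - 1 / Suc n" "touches_at u a x y" by (auto simp: C_def K_def)
    have "0 < 1 / real (Suc n)" by simp
    then have "norm x < 1" using *(1) by linarith
    with * show "x \<in> contact_set u a" by (auto simp: contact_set_def)
  qed
  ultimately show ?thesis by simp
qed

section \<open>Measure decay\<close>

text \<open>The tangent plane of |x|^2 / 2 shows that the envelope at \<open>x\<close> is at least
  |x|^2/2 - m/a. Testing the support at distance \<open>r\<close> from \<open>x\<close> in the
  direction y - x gives r |y - x| \<le> 2 m/a + r^2/2 \<le> r^2.\<close>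

lemma max_support_displacement:
  fixes u :: "real^'n \<Rightarrow> real"
  assumes m: "\<And>x. x \<in> cball 0 1 \<Longrightarrow> \<bar>u x\<bar> \<le> m" and a: "0 < a" and r: "0 < r" "m / a \<le> r\<^sup>2 / 4"
    and x: "norm x + r \<le> 1" and supp: "max_support (cball 0 1) (\<lambda>x. u x / a + x \<bullet> x / 2) x c y"
  shows "norm (y - x) \<le> r"
proof -
  have "\<forall>x'\<in>cball 0 1. (x \<bullet> x / 2 - m / a) + x \<bullet> (x' - x) \<le> u x' / a + x' \<bullet> x' / 2"
  proof
    fix x' :: "real^'n" assume x': "x' \<in> cball 0 1"
    have "- (m / a) \<le> u x' / a" using m[OF x'] a by (simp add: field_simps abs_le_iff)
    moreover have "0 \<le> (x' - x) \<bullet> (x' - x)" by simp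
    ultimately show "(x \<bullet> x / 2 - m / a) + x \<bullet> (x' - x) \<le> u x' / a + x' \<bullet> x' / 2"
      by (simp add: inner_diff_left inner_diff_right inner_commute[of x' x])
  qed
  then have c: "x \<bullet> x / 2 - m / a \<le> c" using supp unfolding max_support_def by blast
  define w where "w = r *\<^sub>R sgn (y - x)"
  have nw: "norm w \<le> r" using r by (simp add: w_def norm_sgn)
  have xw: "x + w \<in> cball 0 1" using norm_triangle_ineq[of x w] nw x by simp
  have "c + y \<bullet> w \<le> u (x + w) / a + (x + w) \<bullet> (x + w) / 2"
    using supp xw unfolding max_support_def by (metis add_diff_cancel_left')
  have "u (x + w) / a \<le> m / a" using m[OF xw] a by (simp add: divide_right_mono abs_le_iff)
  then have "(y - x) \<bullet> w \<le> 2 * (m / a) + w \<bullet> w / 2"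
  proof -
    have "(x + w) \<bullet> (x + w) / 2 = x \<bullet> x / 2 + x \<bullet> w + w \<bullet> w / 2"
      by (simp add: inner_add_left inner_add_right inner_commute[of w x])
    moreover have "(y - x) \<bullet> w = y \<bullet> w - x \<bullet> w" by (rule inner_diff_left)
    ultimately show ?thesis using c
      \<open>c + y \<bullet> w \<le> u (x + w) / a + (x + w) \<bullet> (x + w) / 2\<close> \<open>u (x + w) / a \<le> m / a\<close> by linarith
  qed
  also have "\<dots> \<le> r\<^sup>2"
  proof -
    have "w \<bullet> w \<le> r\<^sup>2" using nw power_mono[of "norm w" r 2] by (simp add: power2_norm_eq_inner)
    then show ?thesis using r(2) by linarith
  qed
  finally have "r * norm (y - x) \<le> r * r"
  proof -
    have "(y - x) \<bullet> sgn (y - x) = norm (y - x)"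
      by (cases "y = x") (simp_all add: sgn_div_norm power2_norm_eq_inner[symmetric] power2_eq_square)
    moreover assume "(y - x) \<bullet> w \<le> r\<^sup>2"
    ultimately show ?thesis by (simp add: w_def power2_eq_square)
  qed
  then show ?thesis using r by simp
qed

text \<open>Comparison with the value at the vertex itself gives a/2 |x - z|^2 \<le> 2 m.\<close>

lemma touches_at_displacement:
  fixes u :: "real^'n \<Rightarrow> real"
  assumes m: "\<And>x. x \<in> cball 0 1 \<Longrightarrow> \<bar>u x\<bar> \<le> m" and a: "0 < a" and r: "0 < r" "m / a \<le> r\<^sup>2 / 4"
    and x: "x \<in> cball 0 1" and z: "z \<in> cball 0 1" and touch: "touches_at u a x z"
  shows "norm (x - z) \<le> r"
proof -
  have "u x + a / 2 * (norm (x - z))\<^sup>2 \<le> u z" using touch z by (force simp: touches_at_def)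
  then have "a / 2 * (norm (x - z))\<^sup>2 \<le> 2 * m" using m[OF x] m[OF z] by (simp add: abs_le_iff)
  then have "(norm (x - z))\<^sup>2 \<le> 4 * (m / a)" using a by (simp add: field_simps)
  also have "\<dots> \<le> r\<^sup>2" using r(2) by linarith
  finally show ?thesis using r by (auto intro: power2_le_imp_le)
qed

text \<open>A point outside the contact set for opening \<open>a\<close> is sent to a new contact point for
  opening \<open>a'\<close>: take the paraboloid of opening \<open>a'\<close> that touches the \<open>a\<close>-envelope of \<open>u\<close> there,
  and slide it until it touches \<open>u\<close>. If the new point were an old contact point, both
  paraboloids would have the same slope there, and injectivity of the vertex map of the
  envelope would identify the two points.\<close>

lemma new_contact_point:
  fixes u :: "real^'n \<Rightarrow> real"
  assumes u: "continuous_on (cball 0 1) u" and m: "\<And>x. x \<in> cball 0 1 \<Longrightarrow> \<bar>u x\<bar> \<le> m"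
    and visc: "viscosity_pucci_minus_le_0 lam Lam (ball 0 1) u" and lam: "0 < lam" "lam \<le> Lam"
    and a: "0 < a" "a < a'" and r: "0 < r" "m / a \<le> r\<^sup>2 / 4" and m0: "0 \<le> m"
    and x: "x \<in> ball 0 (1 / 2 - 2 * r) - contact_set u a"
  obtains c y x1 where "max_support (cball 0 1) (\<lambda>x. u x / a + x \<bullet> x / 2) x c y"
    "x1 \<in> ball 0 (1 / 2) \<inter> contact_set u a' - contact_set u a"
    "touches_at u a' x1 ((1 - a / a') *\<^sub>R x + (a / a') *\<^sub>R y)"
proof -
  let ?v = "\<lambda>x. u x / a + x \<bullet> x / 2"
  have xn: "norm x < 1 / 2 - 2 * r" using x by simp
  have contv: "continuous_on (cball 0 1) ?v" using a by (intro continuous_intros u) auto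
  obtain c y where supp: "max_support (cball 0 1) ?v x c y"
    using max_support_exists[OF contv, of x] xn r by auto
  define z where "z = (1 - a / a') *\<^sub>R x + (a / a') *\<^sub>R y"
  have t: "0 < a / a'" "a / a' < 1" using a by auto
  \<comment> \<open>The vertex \<open>z\<close> ends up within \<open>r\<close> of \<open>x\<close>,
    and the contact point \<open>x1\<close> within \<open>r\<close> of \<open>z\<close>; hence the
    starting radius 1/2 - 2 r.\<close>
  have "norm (y - x) \<le> r"
    by (rule max_support_displacement[OF m a(1) r _ supp]) (use xn r in auto)
  moreover have "z - x = (a / a') *\<^sub>R (y - x)" by (simp add: z_def algebra_simps)
  ultimately have zx: "norm (z - x) \<le> r"
    using t a mult_mono[of "a / a'" 1 "norm (y - x)" r] by (simp add: abs_of_pos)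
  have nz: "norm z \<le> norm x + r" using norm_triangle_ineq[of x "z - x"] zx by simp
  then have zc: "z \<in> cball 0 1" using xn r by simp
  have "continuous_on (cball 0 1) (\<lambda>x'. u x' + a' / 2 * (norm (x' - z))\<^sup>2)"
    by (intro continuous_intros u)
  from continuous_attains_inf[OF compact_cball _ this]
  obtain x1 where x1: "x1 \<in> cball 0 1" "touches_at u a' x1 z"
    unfolding touches_at_def by auto
  have ma': "m / a' \<le> r\<^sup>2 / 4"
    using r(2) m0 a by (intro order_trans[OF divide_left_mono r(2)]) auto
  have "norm (x1 - z) \<le> r"
    by (rule touches_at_displacement[OF m _ r(1) ma' x1(1) zc x1(2)]) (use a in auto)
  then have n1: "norm x1 < 1 / 2" using norm_triangle_ineq[of z "x1 - z"] nz xn by simp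
  then have x1b: "x1 \<in> ball 0 1" by simp
  have "x1 \<notin> contact_set u a"
  proof
    assume "x1 \<in> contact_set u a"
    then obtain q where q: "touches_at u a x1 q" by (auto simp: contact_set_def)
    have "a *\<^sub>R (q - x1) = a' *\<^sub>R (z - x1)" by (rule touches_at_unique[OF visc lam x1b q x1(2)])
    then have "(a / a') *\<^sub>R (q - x1) = z - x1"
    proof -
      have "(a / a') *\<^sub>R (q - x1) = (1 / a') *\<^sub>R (a *\<^sub>R (q - x1))" by simp
      also have "\<dots> = (1 / a') *\<^sub>R (a' *\<^sub>R (z - x1))" using \<open>a *\<^sub>R (q - x1) = a' *\<^sub>R (z - x1)\<close> by simp
      also have "\<dots> = z - x1" using a by simp
      finally show ?thesis .
    qed
    then have "z = (1 - a / a') *\<^sub>R x1 + (a / a') *\<^sub>R q" by (simp add: algebra_simps)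
    \<comment> \<open>Now \<open>x\<close> and \<open>x1\<close> have the same vertex
      \<open>z\<close>. In the inner product with x - x1 the second term is nonnegative by
      monotonicity, so the first one vanishes.\<close>
    then have "(1 - a / a') *\<^sub>R (x - x1) + (a / a') *\<^sub>R (y - q) = 0" by (simp add: z_def algebra_simps)
    then have "((1 - a / a') *\<^sub>R (x - x1) + (a / a') *\<^sub>R (y - q)) \<bullet> (x - x1) = 0" by simp
    then have "(1 - a / a') * ((x - x1) \<bullet> (x - x1)) + (a / a') * ((y - q) \<bullet> (x - x1)) = 0"
      by (simp only: inner_add_left inner_scaleR_left)
    moreover have "0 \<le> (a / a') * ((y - q) \<bullet> (x - x1))"
      using max_support_mono[OF supp touches_at_max_support[OF a(1) x1(1) q]] t
      by (intro mult_nonneg_nonneg) auto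
    ultimately have "(1 - a / a') * ((x - x1) \<bullet> (x - x1)) \<le> 0" by linarith
    then have "(x - x1) \<bullet> (x - x1) \<le> 0" using t by (simp add: mult_le_0_iff)
    then have "x = x1" by (metis inner_gt_zero_iff leD right_minus_eq)
    with \<open>x1 \<in> contact_set u a\<close> x show False by simp
  qed
  moreover have "x1 \<in> contact_set u a'" using x1b x1(2) by (auto simp: contact_set_def)
  ultimately show thesis using that[OF supp, of x1] n1 x1(2) by (simp add: z_def)
qed

text \<open>The opening of the dual problem is \<open>a' / (1 - \<epsilon>)\<close>.\<close>

lemma contact_step_approx:
  fixes u :: "real^'n \<Rightarrow> real"
  assumes u: "continuous_on (cball 0 1) u" and m: "\<And>x. x \<in> cball 0 1 \<Longrightarrow> \<bar>u x\<bar> \<le> m"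
    and visc: "viscosity_pucci_minus_le_0 lam Lam (ball 0 1) u" and num: "viscosity_nonpos_eigenvalues_ge (ball 0 1) u k"
    and lam: "0 < lam" "lam \<le> Lam" and k: "k \<le> CARD('n)"
    and a: "0 < a" "a < a'" and r: "0 < r" "m / a \<le> r\<^sup>2 / 4" and m0: "0 \<le> m" and \<epsilon>: "0 < \<epsilon>" "\<epsilon> < 1"
  defines "E \<equiv> ball 0 (1 / 2 - 2 * r) - contact_set u a"
    and "K \<equiv> ball 0 (1 / 2) \<inter> contact_set u a' - contact_set u a"
    and "J \<equiv> (Lam / lam / (2 - lam / Lam)) ^ (CARD('n) - k)"
  shows "measure lebesgue E \<le> (1 / ((1 - a / a') * (1 - \<epsilon>))) ^ CARD('n) * ((1 + \<epsilon>) ^ CARD('n) * J * measure lebesgue K + \<epsilon>) + \<epsilon>"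
proof -
  define \<gamma> where "\<gamma> = 1 - a / a'"
  have \<gamma>: "0 < \<gamma>" "\<gamma> < 1" using a by (auto simp: \<gamma>_def)
  \<comment> \<open>The dual gradient for this opening is Lipschitz with constant 1/\<epsilon>, so
    Rademacher's theorem applies to it.\<close>
  define a'' where "a'' = a' / (1 - \<epsilon>)"
  have a'': "0 < a'" "a' < a''" using a \<epsilon> by (auto simp: a''_def field_simps)
  have t: "a' / a'' = 1 - \<epsilon>" "1 - a' / a'' = \<epsilon>" using a \<epsilon> by (auto simp: a''_def)
  have \<epsilon>\<epsilon>: "1 - (1 - \<epsilon>) = \<epsilon>" by simp
  obtain \<Psi> G where dual: "(\<forall>x\<in>cball 0 1. \<forall>z. touches_at u a' x z \<longrightarrow> \<Psi> (\<epsilon> *\<^sub>R x + (1 - \<epsilon>) *\<^sub>R z) = x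
        \<and> G (\<epsilon> *\<^sub>R x + (1 - \<epsilon>) *\<^sub>R z) = x \<bullet> (\<epsilon> *\<^sub>R x + (1 - \<epsilon>) *\<^sub>R z) - u x / a'' - x \<bullet> x / 2)
    \<and> (\<forall>x\<in>cball 0 1. \<forall>y. x \<bullet> y - u x / a'' - x \<bullet> x / 2 \<le> G y)
    \<and> (\<forall>y y'. 0 \<le> (\<Psi> y - \<Psi> y') \<bullet> (y - y'))
    \<and> (\<forall>y y'. norm (\<Psi> y - \<Psi> y') \<le> (1 / \<epsilon>) * norm (y - y'))
    \<and> (\<forall>y. (G has_derivative (\<lambda>h. \<Psi> y \<bullet> h)) (at y))"
    using contact_dual[OF u a'', unfolded t \<epsilon>\<epsilon>] by (elim exE) (rule that)
  have contact: "\<Psi> (\<epsilon> *\<^sub>R x + (1 - \<epsilon>) *\<^sub>R z) = x"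
      "G (\<epsilon> *\<^sub>R x + (1 - \<epsilon>) *\<^sub>R z) = x \<bullet> (\<epsilon> *\<^sub>R x + (1 - \<epsilon>) *\<^sub>R z) - u x / a'' - x \<bullet> x / 2"
      if "x \<in> cball 0 1" "touches_at u a' x z" for x z
    using dual[THEN conjunct1] that by blast+
  have fenchel: "x \<bullet> y - u x / a'' - x \<bullet> x / 2 \<le> G y" if "x \<in> cball 0 1" for x y
    using dual[THEN conjunct2, THEN conjunct1] that by blast
  have mono: "0 \<le> (\<Psi> y - \<Psi> y') \<bullet> (y - y')" for y y'
    using dual[THEN conjunct2, THEN conjunct2, THEN conjunct1] by blast
  have lip: "norm (\<Psi> y - \<Psi> y') \<le> (1 / \<epsilon>) * norm (y - y')" for y y'
    using dual[THEN conjunct2, THEN conjunct2, THEN conjunct2, THEN conjunct1] by blast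
  have der: "(G has_derivative (\<lambda>h. \<Psi> y \<bullet> h)) (at y)" for y
    using dual[THEN conjunct2, THEN conjunct2, THEN conjunct2, THEN conjunct2] by blast
  define v where "v x = u x / a + x \<bullet> x / 2" for x
  define P where "P x y x1 \<longleftrightarrow> (\<exists>c. max_support (cball 0 1) v x c y) \<and> x1 \<in> K
      \<and> touches_at u a' x1 (\<gamma> *\<^sub>R x + (1 - \<gamma>) *\<^sub>R y)" for x y x1
  have "\<exists>y x1. P x y x1" if x: "x \<in> E" for x
  proof -
    obtain c y x1 where *: "max_support (cball 0 1) (\<lambda>x. u x / a + x \<bullet> x / 2) x c y"
      "x1 \<in> ball 0 (1 / 2) \<inter> contact_set u a' - contact_set u a"
      "touches_at u a' x1 ((1 - a / a') *\<^sub>R x + (a / a') *\<^sub>R y)"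
      by (rule new_contact_point[OF u m visc lam a r m0 x[unfolded E_def]])
    have g: "\<gamma> = 1 - a / a'" "1 - \<gamma> = a / a'" by (simp_all add: \<gamma>_def)
    have "touches_at u a' x1 (\<gamma> *\<^sub>R x + (1 - \<gamma>) *\<^sub>R y)"
      using *(3) unfolding g(1)[symmetric] unfolding g(2)[symmetric] .
    then have "P x y x1" unfolding P_def v_def[abs_def] K_def using * by blast
    then show ?thesis by blast
  qed
  then obtain Y X1 where "\<And>x. x \<in> E \<Longrightarrow> P x (Y x) (X1 x)" by metis
  then have YX: "\<And>x. x \<in> E \<Longrightarrow> (\<exists>c. max_support (cball 0 1) v x c (Y x)) \<and> X1 x \<in> K
      \<and> touches_at u a' (X1 x) (\<gamma> *\<^sub>R x + (1 - \<gamma>) *\<^sub>R Y x)" by (simp only: P_def)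
  \<comment> \<open>\<open>Z x\<close> is the vertex for opening a' of the paraboloid touching at
    \<open>X1 x\<close>; \<open>W x\<close> is the vertex for opening a'' of the one with the same
    slope there.\<close>
  define Z where "Z x = \<gamma> *\<^sub>R x + (1 - \<gamma>) *\<^sub>R Y x" for x
  define W where "W x = \<epsilon> *\<^sub>R X1 x + (1 - \<epsilon>) *\<^sub>R Z x" for x
  have X1c: "X1 x \<in> cball 0 1" "X1 x \<in> ball 0 1" if "x \<in> E" for x
    using YX[OF that] by (auto simp: K_def contact_set_def)
  \<comment> \<open>One monotonicity inequality for each convex combination: lengths shrink at most
    by the factor \<gamma> from x to \<open>Z x\<close>, and at most by 1 - \<epsilon> from
    \<open>Z x\<close> to \<open>W x\<close>.\<close>
  have expand: "\<gamma> * (1 - \<epsilon>) * norm (x - x') \<le> norm (W x - W x')" if x: "x \<in> E" "x' \<in> E" for x x'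
  proof -
    obtain c c' where c: "max_support (cball 0 1) v x c (Y x)" "max_support (cball 0 1) v x' c' (Y x')"
      using YX x by meson
    have "0 \<le> (Y x - Y x') \<bullet> (x - x')" by (rule max_support_mono[OF c])
    moreover have "Z x - Z x' = \<gamma> *\<^sub>R (x - x') + (1 - \<gamma>) *\<^sub>R (Y x - Y x')" by (simp add: Z_def algebra_simps)
    ultimately have "\<gamma> * (norm (x - x') * norm (x - x')) \<le> (Z x - Z x') \<bullet> (x - x')"
      using \<gamma> by (simp add: inner_add_left power2_norm_eq_inner[symmetric] power2_eq_square)
    also have "\<dots> \<le> norm (Z x - Z x') * norm (x - x')" by (rule norm_cauchy_schwarz)
    finally have 1: "\<gamma> * norm (x - x') \<le> norm (Z x - Z x')"
      by (cases "x = x'") (simp_all add: mult.assoc[symmetric])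
    have "max_support (cball 0 1) (\<lambda>x. u x / a' + x \<bullet> x / 2) (X1 x) (u (X1 x) / a' + X1 x \<bullet> X1 x / 2) (Z x)"
      "max_support (cball 0 1) (\<lambda>x. u x / a' + x \<bullet> x / 2) (X1 x') (u (X1 x') / a' + X1 x' \<bullet> X1 x' / 2) (Z x')"
      using YX x X1c a'' unfolding Z_def by (blast intro: touches_at_max_support)+
    then have "0 \<le> (Z x - Z x') \<bullet> (X1 x - X1 x')" by (rule max_support_mono)
    moreover have "W x - W x' = \<epsilon> *\<^sub>R (X1 x - X1 x') + (1 - \<epsilon>) *\<^sub>R (Z x - Z x')" by (simp add: W_def algebra_simps)
    ultimately have "(1 - \<epsilon>) * (norm (Z x - Z x') * norm (Z x - Z x')) \<le> (W x - W x') \<bullet> (Z x - Z x')"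
      using \<epsilon> by (simp add: inner_add_left power2_norm_eq_inner[symmetric] power2_eq_square inner_commute[of "X1 x - X1 x'"])
    also have "\<dots> \<le> norm (W x - W x') * norm (Z x - Z x')" by (rule norm_cauchy_schwarz)
    finally have "(1 - \<epsilon>) * norm (Z x - Z x') \<le> norm (W x - W x')"
      by (cases "Z x = Z x'") (simp_all add: mult.assoc[symmetric])
    moreover have "(1 - \<epsilon>) * (\<gamma> * norm (x - x')) \<le> (1 - \<epsilon>) * norm (Z x - Z x')"
      using mult_left_mono[OF 1, of "1 - \<epsilon>"] \<epsilon> by simp
    ultimately have "(1 - \<epsilon>) * (\<gamma> * norm (x - x')) \<le> norm (W x - W x')" by linarith
    then show ?thesis by (simp only: mult_ac)
  qed
  have pos: "0 < \<gamma> * (1 - \<epsilon>)" using \<gamma> \<epsilon> by simp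
  define F where "F = inv_into E W"
  have "inj_on W E"
  proof (rule inj_onI)
    fix x x' assume "x \<in> E" "x' \<in> E" "W x = W x'"
    then have "\<gamma> * (1 - \<epsilon>) * norm (x - x') \<le> 0" using expand[of x x'] by simp
    then have "norm (x - x') \<le> 0" using pos by (metis mult_le_cancel_left_pos mult_zero_right)
    then show "x = x'" by simp
  qed
  then have F: "F (W x) = x" if "x \<in> E" for x using that by (simp add: F_def)
  have Em: "E \<in> lmeasurable" "K \<in> lmeasurable"
  proof -
    have "E \<in> sets lebesgue" "K \<in> sets lebesgue"
      unfolding E_def K_def using contact_set_borel[OF u] by auto
    then show "E \<in> lmeasurable" "K \<in> lmeasurable"
      by (auto intro!: bounded_set_imp_lmeasurable simp: E_def K_def intro: bounded_subset[OF bounded_ball])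
  qed
  define N where "N = {y. \<not> \<Psi> differentiable (at y)}"
  have N: "negligible N"
  proof -
    have "AE y in lborel. \<Psi> differentiable (at y)" by (rule rademacher[OF lip])
    then obtain N' where N': "{y \<in> space lborel. \<not> \<Psi> differentiable (at y)} \<subseteq> N'" "N' \<in> null_sets lborel"
      by (auto elim!: AE_E simp: null_sets_def)
    have "negligible N'" unfolding negligible_iff_null_sets using N'(2) by (rule null_sets_completionI)
    then show ?thesis by (rule negligible_subset) (use N'(1) in \<open>auto simp: N_def\<close>)
  qed
  have J: "0 < J"
  proof -
    have "lam / Lam \<le> 1" using lam by simp
    then have "0 < 2 - lam / Lam" by linarith
    then show ?thesis unfolding J_def using lam by (intro zero_less_power divide_pos_pos) auto
  qed
  \<comment> \<open>At a vertex \<open>W x\<close> the map \<Psi> returns the contact point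
    \<open>X1 x\<close> in \<open>K\<close>, so the preimage estimate bounds the set of vertices by
    essentially J times the measure of \<open>K\<close>.\<close>
  obtain V where V: "V \<in> lmeasurable" "W ` E - N \<subseteq> V" "measure lebesgue V \<le> (1 + \<epsilon>) ^ CARD('n) * J * measure lebesgue K + \<epsilon>"
  proof (rule monotone_preimage_measure[OF mono _ J Em(2) _ \<epsilon>(1) \<epsilon>(1)])
    show "\<Psi> ` (W ` E - N) \<subseteq> K"
    proof clarify
      fix x assume x: "x \<in> E"
      have "\<Psi> (W x) = X1 x" unfolding W_def Z_def using YX[OF x] X1c[OF x] by (intro contact) auto
      then show "\<Psi> (W x) \<in> K" using YX[OF x] by simp
    qed
    fix y assume "y \<in> W ` E - N"
    then obtain x where x: "x \<in> E" "y = W x" "\<Psi> differentiable (at y)" by (auto simp: N_def)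
    have *: "\<Psi> y = X1 x" "G y = X1 x \<bullet> y - u (X1 x) / a'' - X1 x \<bullet> X1 x / 2"
      using contact[of "X1 x" "Z x"] YX[OF x(1)] X1c[OF x(1)] unfolding x(2) W_def Z_def by blast+
    show "\<exists>Q e. orthogonal_matrix Q \<and> (\<forall>i. 0 < e i) \<and> 1 \<le> J * (\<Prod>i\<in>UNIV. e i)
        \<and> (\<Psi> has_derivative (\<lambda>w. (Q ** diag_mat e ** transpose Q) *v w)) (at y)"
      unfolding J_def
      by (rule contact_dual_derivative[OF visc num lam k _ fenchel mono der _ _ x(3)])
         (use a'' X1c[OF x(1)] * in auto)
  qed (use that in auto)
  have VN: "V \<union> N \<in> lmeasurable" using V(1) N by (simp add: negligible_imp_measurable fmeasurable.Un)
  have mVN: "measure lebesgue (V \<union> N) = measure lebesgue V"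
    using N by (intro measure_negligible_symdiff) (use V in \<open>auto intro: negligible_subset\<close>)
  \<comment> \<open>By \<open>expand\<close> the inverse of \<open>W\<close> is Lipschitz on the
    vertices, which brings the estimate back to \<open>E\<close>.\<close>
  obtain U where U: "U \<in> lmeasurable" "F ` (W ` E) \<subseteq> U"
    "measure lebesgue U \<le> (1 / (\<gamma> * (1 - \<epsilon>))) ^ DIM(real^'n) * measure lebesgue (V \<union> N) + \<epsilon>"
  proof (rule lipschitz_image_bound[OF VN _ _ \<epsilon>(1)])
    show "W ` E \<subseteq> V \<union> N" using V(2) by auto
    show "0 \<le> 1 / (\<gamma> * (1 - \<epsilon>))" using pos by simp
    fix w w' assume "w \<in> W ` E" "w' \<in> W ` E"
    then obtain x x' where x: "x \<in> E" "x' \<in> E" "w = W x" "w' = W x'" by auto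
    then show "norm (F w - F w') \<le> 1 / (\<gamma> * (1 - \<epsilon>)) * norm (w - w')"
      using expand[OF x(1,2)] F pos by (simp add: field_simps)
  qed (use that in auto)
  have "measure lebesgue E \<le> measure lebesgue U"
  proof (rule measure_mono_fmeasurable)
    show "E \<subseteq> U"
    proof
      fix x assume "x \<in> E"
      then have "F (W x) \<in> U" using U(2) by blast
      then show "x \<in> U" using F[OF \<open>x \<in> E\<close>] by simp
    qed
  qed (use Em U in auto)
  also have "\<dots> \<le> (1 / (\<gamma> * (1 - \<epsilon>))) ^ CARD('n) * measure lebesgue V + \<epsilon>" using U(3) mVN by simp
  also have "\<dots> \<le> (1 / (\<gamma> * (1 - \<epsilon>))) ^ CARD('n) * ((1 + \<epsilon>) ^ CARD('n) * J * measure lebesgue K + \<epsilon>) + \<epsilon>"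
    using V(3) pos by (intro add_right_mono mult_left_mono) auto
  finally show ?thesis unfolding \<gamma>_def .
qed

lemma contact_step:
  fixes u :: "real^'n \<Rightarrow> real"
  assumes u: "continuous_on (cball 0 1) u" and m: "\<And>x. x \<in> cball 0 1 \<Longrightarrow> \<bar>u x\<bar> \<le> m"
    and visc: "viscosity_pucci_minus_le_0 lam Lam (ball 0 1) u" and num: "viscosity_nonpos_eigenvalues_ge (ball 0 1) u k"
    and lam: "0 < lam" "lam \<le> Lam" and k: "k \<le> CARD('n)"
    and a: "0 < a" "a < a'" and r: "0 < r" "m / a \<le> r\<^sup>2 / 4" and m0: "0 \<le> m"
  shows "(1 - a / a') ^ CARD('n) * ((2 - lam / Lam) / (Lam / lam)) ^ (CARD('n) - k)
        * measure lebesgue (ball 0 (1 / 2 - 2 * r) - contact_set u a)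
      \<le> measure lebesgue (ball 0 (1 / 2) \<inter> contact_set u a' - contact_set u a)"
proof -
  let ?E = "measure lebesgue (ball 0 (1 / 2 - 2 * r) - contact_set u a)"
  let ?K = "measure lebesgue (ball 0 (1 / 2) \<inter> contact_set u a' - contact_set u a)"
  define J where "J = (Lam / lam / (2 - lam / Lam)) ^ (CARD('n) - k)"
  define \<gamma> where "\<gamma> = 1 - a / a'"
  have \<gamma>: "0 < \<gamma>" using a by (simp add: \<gamma>_def)
  let ?f = "\<lambda>\<epsilon>. (1 / (\<gamma> * (1 - \<epsilon>))) ^ CARD('n) * ((1 + \<epsilon>) ^ CARD('n) * J * ?K + \<epsilon>) + \<epsilon>"
  have "(?f \<longlongrightarrow> (1 / (\<gamma> * (1 - 0))) ^ CARD('n) * ((1 + 0) ^ CARD('n) * J * ?K + 0) + 0) (at_right 0)"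
    using \<gamma> by (intro tendsto_intros) auto
  moreover have "\<forall>\<^sub>F \<epsilon> in at_right 0. ?E \<le> ?f \<epsilon>"
    unfolding eventually_at_right_field \<gamma>_def J_def
    using contact_step_approx[OF u m visc num lam k a r m0] by (intro exI[of _ 1]) auto
  ultimately have "?E \<le> (1 / (\<gamma> * (1 - 0))) ^ CARD('n) * ((1 + 0) ^ CARD('n) * J * ?K + 0) + 0"
    by (rule tendsto_lowerbound) simp
  then have "?E \<le> (1 / \<gamma>) ^ CARD('n) * (J * ?K)" by simp
  then have "\<gamma> ^ CARD('n) * (1 / J) * ?E \<le> \<gamma> ^ CARD('n) * (1 / J) * ((1 / \<gamma>) ^ CARD('n) * (J * ?K))"
  proof (rule mult_left_mono)
    have "lam / Lam \<le> 1" using lam by simp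
    then have "0 \<le> 2 - lam / Lam" by linarith
    then show "0 \<le> \<gamma> ^ CARD('n) * (1 / J)" unfolding J_def using \<gamma> lam
      by (intro mult_nonneg_nonneg zero_le_power divide_nonneg_nonneg) auto
  qed
  also have "\<dots> = ?K"
  proof -
    have "lam / Lam \<le> 1" using lam by simp
    then have "0 < 2 - lam / Lam" by linarith
    then have "0 < J" unfolding J_def using lam by (intro zero_less_power divide_pos_pos) auto
    then show ?thesis using \<gamma> by (simp add: power_divide)
  qed
  also have "1 / J = ((2 - lam / Lam) / (Lam / lam)) ^ (CARD('n) - k)" by (simp add: J_def power_divide mult.commute)
  finally show ?thesis unfolding \<gamma>_def .
qed

text \<open>The paraboloid of opening \<open>b\<close> with the same slope at \<open>x\<close> lies
  below the one of opening \<open>a\<close>; its vertex is closer to \<open>x\<close> by the factor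
  a/b.\<close>

lemma contact_set_mono:
  assumes "0 < a" "a \<le> b"
  shows "contact_set u a \<subseteq> contact_set u b"
proof
  fix x assume "x \<in> contact_set u a"
  then obtain y where x: "x \<in> ball 0 1" and y: "touches_at u a x y" by (auto simp: contact_set_def)
  have "touches_at u b x (x + (a / b) *\<^sub>R (y - x))"
    unfolding touches_at_iff_slope
  proof
    fix x' :: "real^'a" assume "x' \<in> cball 0 1"
    then have "u x + (a *\<^sub>R (y - x)) \<bullet> (x' - x) - a / 2 * (norm (x' - x))\<^sup>2 \<le> u x'"
      using y unfolding touches_at_iff_slope by blast
    moreover have "a / 2 * (norm (x' - x))\<^sup>2 \<le> b / 2 * (norm (x' - x))\<^sup>2"
      using assms by (intro mult_right_mono) auto
    ultimately have "u x + (a *\<^sub>R (y - x)) \<bullet> (x' - x) - b / 2 * (norm (x' - x))\<^sup>2 \<le> u x'" by linarith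
    moreover have "b *\<^sub>R (x + (a / b) *\<^sub>R (y - x) - x) = a *\<^sub>R (y - x)" using assms by simp
    ultimately show "u x + (b *\<^sub>R (x + (a / b) *\<^sub>R (y - x) - x)) \<bullet> (x' - x) - b / 2 * (norm (x' - x))\<^sup>2 \<le> u x'"
      by (simp only:)
  qed
  with x show "x \<in> contact_set u b" by (auto simp: contact_set_def)
qed

lemma power_diff_le:
  fixes x y :: real
  assumes "0 \<le> y" "y \<le> x" "x \<le> 1"
  shows "x ^ n - y ^ n \<le> n * (x - y)"
proof (induction n)
  case (Suc n)
  have "x ^ Suc n - y ^ Suc n = x * (x ^ n - y ^ n) + y ^ n * (x - y)" by (simp add: algebra_simps)
  also have "\<dots> \<le> 1 * (x ^ n - y ^ n) + 1 * (x - y)"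
    using assms by (intro add_mono mult_right_mono power_le_one) (auto simp: power_mono)
  also have "\<dots> \<le> Suc n * (x - y)" using Suc by (simp add: algebra_simps)
  finally show ?case .
qed simp

text \<open>The new contact points make up at least the fraction \<theta> of the complement in the
  smaller ball. Passing to radius 1/2 costs the volume of a layer of width 2 r, at most 2 n r times
  that of the unit ball.\<close>

lemma contact_complement_step:
  fixes u :: "real^'n \<Rightarrow> real" and m r a a' :: real
  assumes u: "continuous_on (cball 0 1) u" and m: "\<And>x. x \<in> cball 0 1 \<Longrightarrow> \<bar>u x\<bar> \<le> m"
    and visc: "viscosity_pucci_minus_le_0 lam Lam (ball 0 1) u" and num: "viscosity_nonpos_eigenvalues_ge (ball 0 1) u k"
    and lam: "0 < lam" "lam \<le> Lam" and k: "k \<le> CARD('n)"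
    and a: "0 < a" "a < a'" and r: "0 < r" "r \<le> 1 / 4" "m / a \<le> r\<^sup>2 / 4" and m0: "0 \<le> m"
  defines "\<theta> \<equiv> (1 - a / a') ^ CARD('n) * ((2 - lam / Lam) / (Lam / lam)) ^ (CARD('n) - k)"
  shows "measure lebesgue (ball 0 (1 / 2) - contact_set u a')
    \<le> (1 - \<theta>) * measure lebesgue (ball 0 (1 / 2) - contact_set u a) + \<theta> * (unit_ball_vol CARD('n) * (CARD('n) * (2 * r)))"
proof -
  let ?B = "ball (0::real^'n) (1 / 2)" and ?B' = "ball (0::real^'n) (1 / 2 - 2 * r)"
  let ?A = "contact_set u a" and ?A' = "contact_set u a'"
  have Am: "?A \<in> sets lebesgue" "?A' \<in> sets lebesgue" using contact_set_borel[OF u] by auto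
  have lm: "?B - X \<in> lmeasurable" if "X \<in> sets lebesgue" for X
    using that by (intro bounded_set_imp_lmeasurable) (auto intro: bounded_subset[OF bounded_ball])
  have K: "?B \<inter> ?A' - ?A \<in> lmeasurable"
    using Am by (intro bounded_set_imp_lmeasurable sets.Diff sets.Int) (auto intro: bounded_subset[OF bounded_ball])
  have "?B - ?A = (?B - ?A') \<union> (?B \<inter> ?A' - ?A)"
    using contact_set_mono[of a a' u] a by auto
  then have "measure lebesgue (?B - ?A) = measure lebesgue (?B - ?A') + measure lebesgue (?B \<inter> ?A' - ?A)"
  proof -
    have "(?B - ?A') \<inter> (?B \<inter> ?A' - ?A) = {}" by auto
    then show ?thesis using measure_Un3[OF lm[OF Am(2)] K] \<open>?B - ?A = _\<close> by simp
  qed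
  moreover have "\<theta> * measure lebesgue (?B' - ?A) \<le> measure lebesgue (?B \<inter> ?A' - ?A)"
    unfolding \<theta>_def by (rule contact_step[OF u m visc num lam k a r(1,3) m0])
  moreover have "measure lebesgue (?B - ?A) \<le> measure lebesgue (?B' - ?A) + unit_ball_vol CARD('n) * (CARD('n) * (2 * r))"
  proof -
    have B'A: "?B' - ?A \<in> lmeasurable"
      using Am by (intro bounded_set_imp_lmeasurable) (auto intro: bounded_subset[OF bounded_ball])
    have "?B - ?A \<subseteq> (?B' - ?A) \<union> (?B - ?B')" by auto
    then have "measure lebesgue (?B - ?A) \<le> measure lebesgue ((?B' - ?A) \<union> (?B - ?B'))"
      using Am B'A lm by (intro measure_mono_fmeasurable fmeasurable.Un) auto
    also have "\<dots> \<le> measure lebesgue (?B' - ?A) + measure lebesgue (?B - ?B')"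
      using B'A lm by (intro measure_Un_le) auto
    also have "measure lebesgue (?B - ?B') = measure lebesgue ?B - measure lebesgue ?B'"
      using r by (intro measurable_measure_Diff) auto
    also have "\<dots> = unit_ball_vol CARD('n) * ((1 / 2) ^ CARD('n) - (1 / 2 - 2 * r) ^ CARD('n))"
      using r by (simp add: content_ball right_diff_distrib)
    also have "\<dots> \<le> unit_ball_vol CARD('n) * (CARD('n) * (1 / 2 - (1 / 2 - 2 * r)))"
      using r by (intro mult_left_mono power_diff_le) auto
    finally show ?thesis by simp
  qed
  moreover have "0 \<le> \<theta>"
  proof -
    have "lam / Lam \<le> 1" using lam by simp
    then have "0 \<le> 2 - lam / Lam" by linarith
    then show ?thesis unfolding \<theta>_def using lam a by (intro mult_nonneg_nonneg zero_le_power divide_nonneg_nonneg) auto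
  qed
  ultimately show ?thesis
    using mult_left_mono[of "measure lebesgue (?B - ?A)" "measure lebesgue (?B' - ?A) + unit_ball_vol CARD('n) * (CARD('n) * (2 * r))" \<theta>]
    by (simp add: algebra_simps)
qed

text \<open>C = c / (q - p) solves p C + c = q C, and the perturbation decays at least as fast as
  q^j because s \<le> q.\<close>

lemma geometric_decay:
  fixes f :: "nat \<Rightarrow> real"
  assumes step: "\<And>j. f (Suc j) \<le> p * f j + c * s ^ j" and f0: "f 0 \<le> F" and p: "0 \<le> p" "p < q" and s: "0 \<le> s" "s \<le> q"
    and c: "0 \<le> c"
  shows "f j \<le> (\<bar>F\<bar> + c / (q - p)) * q ^ j"
proof (induction j)
  case 0
  have "0 \<le> c / (q - p)" using c p by simp
  then show ?case using f0 by simp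
next
  case (Suc j)
  define C where "C = \<bar>F\<bar> + c / (q - p)"
  have "c = (q - p) * (c / (q - p))" using p by simp
  also have "\<dots> \<le> (q - p) * C" unfolding C_def using p by (intro mult_left_mono) auto
  finally have C: "p * C + c \<le> C * q" by (simp add: algebra_simps)
  have IH: "f j \<le> C * q ^ j" using Suc by (simp add: C_def)
  have "f (Suc j) \<le> p * (C * q ^ j) + c * q ^ j"
    using step[of j] mult_left_mono[OF IH p(1)] mult_left_mono[OF power_mono[OF s(2,1), of j] c] by linarith
  also have "\<dots> = (p * C + c) * q ^ j" by (simp add: algebra_simps)
  also have "\<dots> \<le> (C * q) * q ^ j" using C p by (intro mult_right_mono) auto
  finally show ?case by (simp add: C_def mult_ac)
qed

text \<open>Openings grow by the factor n, so 1 - a/a' = 1 - 1/n in each step, while the boundary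
  layer shrinks by 1 / sqrt n; the rate \<open>q\<close> accommodates both effects.\<close>

lemma contact_complement_decay:
  fixes u :: "real^'n \<Rightarrow> real" and m q lam Lam :: real
  assumes n: "2 \<le> CARD('n)" and u: "continuous_on (cball 0 1) u" and m: "\<And>x. x \<in> cball 0 1 \<Longrightarrow> \<bar>u x\<bar> \<le> m"
    and visc: "viscosity_pucci_minus_le_0 lam Lam (ball 0 1) u" and num: "viscosity_nonpos_eigenvalues_ge (ball 0 1) u k"
    and lam: "0 < lam" "lam \<le> Lam" and k: "k \<le> CARD('n)" and m0: "0 < m"
  defines "\<theta> \<equiv> (1 - 1 / CARD('n)) ^ CARD('n) * ((2 - lam / Lam) / (Lam / lam)) ^ (CARD('n) - k)"
  assumes q: "1 - \<theta> < q" "1 / sqrt CARD('n) \<le> q" and \<theta>1: "\<theta> \<le> 1"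
  shows "measure lebesgue (ball 0 (1 / 2) - contact_set u (64 * m * real CARD('n) ^ j))
     \<le> (unit_ball_vol CARD('n) + \<theta> * (unit_ball_vol CARD('n) * CARD('n)) / (q - (1 - \<theta>))) * q ^ j"
proof -
  let ?n = "real CARD('n)" and ?\<omega> = "unit_ball_vol CARD('n)"
  define f where "f j = measure lebesgue (ball 0 (1 / 2) - contact_set u (64 * m * ?n ^ j))" for j
  have n0: "0 < ?n" "1 < ?n" using n by auto
  have \<theta>0: "0 \<le> \<theta>"
  proof -
    have "lam / Lam \<le> 1" using lam by simp
    then have "0 \<le> 2 - lam / Lam" by linarith
    then show ?thesis unfolding \<theta>_def using lam n0 by (intro mult_nonneg_nonneg zero_le_power divide_nonneg_nonneg) auto
  qed
  have step: "f (Suc j) \<le> (1 - \<theta>) * f j + (\<theta> * (?\<omega> * ?n)) * (1 / sqrt ?n) ^ j" for j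
  proof -
    \<comment> \<open>For the opening 64 m n^j this gives m/a = r^2/4 exactly, and r = 1/4 at j = 0,
      the largest admissible value; this is the origin of 64.\<close>
    define r where "r = (1 / sqrt ?n) ^ j / 4"
    have r: "0 < r" "r \<le> 1 / 4" using n0 by (auto simp: r_def power_le_one)
    have "((1 / sqrt ?n) ^ j)\<^sup>2 = 1 / ?n ^ j"
    proof -
      have "((1 / sqrt ?n) ^ j)\<^sup>2 = ((1 / sqrt ?n)\<^sup>2) ^ j" by (simp only: power_mult[symmetric] mult.commute)
      also have "(1 / sqrt ?n)\<^sup>2 = 1 / ?n" using n0 by (simp add: power_divide)
      finally show ?thesis by (simp add: power_divide)
    qed
    then have r2: "m / (64 * m * ?n ^ j) \<le> r\<^sup>2 / 4" using m0 by (simp add: r_def power_divide)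
    have a: "0 < 64 * m * ?n ^ j" "64 * m * ?n ^ j < 64 * m * ?n ^ Suc j" using m0 n0 by auto
    have t: "64 * m * ?n ^ j / (64 * m * ?n ^ Suc j) = 1 / ?n" using m0 n0 by simp
    have "f (Suc j) \<le> (1 - \<theta>) * f j + \<theta> * (?\<omega> * (?n * (2 * r)))"
      using contact_complement_step[OF u m visc num lam k a r r2] m0 unfolding f_def \<theta>_def t by simp
    \<comment> \<open>The factor 4 r makes the error term exactly the power (1 / sqrt n)^j.\<close>
    also have "\<dots> \<le> (1 - \<theta>) * f j + \<theta> * (?\<omega> * (?n * (4 * r)))"
      using \<theta>0 n0 r by (intro add_left_mono mult_left_mono) auto
    finally show ?thesis by (simp add: r_def mult.assoc)
  qed
  have f0: "f 0 \<le> ?\<omega>"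
  proof -
    have "f 0 \<le> measure lebesgue (ball (0::real^'n) (1 / 2))"
      unfolding f_def using contact_set_borel[OF u] by (intro measure_mono_fmeasurable) auto
    also have "\<dots> = ?\<omega> * (1 / 2) ^ CARD('n)" by (simp add: content_ball)
    also have "\<dots> \<le> ?\<omega> * 1" by (intro mult_left_mono power_le_one) auto
    finally show ?thesis by simp
  qed
  have "f j \<le> (\<bar>?\<omega>\<bar> + \<theta> * (?\<omega> * ?n) / (q - (1 - \<theta>))) * q ^ j"
    by (rule geometric_decay[OF step f0 _ q(1) _ q(2)]) (use \<theta>0 \<theta>1 n0 in auto)
  then show ?thesis by (simp add: f_def)
qed

section \<open>The integral estimate and the exponent\<close>

text \<open>For continuous \<open>u\<close> the essential supremum bounds every value: the set where
  |u| exceeds it is open and null, hence empty, and the bound extends to the closed ball by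
  continuity.\<close>

lemma Linfty_norm_finite:
  fixes u :: "real^'n \<Rightarrow> real"
  assumes u: "continuous_on (cball 0 1) u"
  shows "Linfty_norm (ball 0 1) u < top"
    and "x \<in> cball 0 1 \<Longrightarrow> \<bar>u x\<bar> \<le> enn2real (Linfty_norm (ball 0 1) u)"
proof -
  let ?M = "restrict_space lborel (ball (0::real^'n) 1)"
  have ub: "continuous_on (ball 0 1) u" using u ball_subset_cball by (rule continuous_on_subset)
  have "u \<in> borel_measurable (restrict_space borel (ball 0 1))" by (rule borel_measurable_continuous_on_restrict[OF ub])
  then have "u \<in> borel_measurable ?M"
    by (subst measurable_cong_sets[OF sets_restrict_space_cong[OF sets_lborel] refl])
  then have meas: "(\<lambda>x. ennreal \<bar>u x\<bar>) \<in> borel_measurable ?M" by measurable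
  obtain x1 where x1: "x1 \<in> cball 0 1" "\<And>x. x \<in> cball 0 1 \<Longrightarrow> \<bar>u x\<bar> \<le> \<bar>u x1\<bar>"
    using continuous_attains_sup[OF compact_cball _ continuous_on_rabs[OF u]] by auto
  have "Linfty_norm (ball 0 1) u \<le> ennreal \<bar>u x1\<bar>"
    unfolding Linfty_norm_def
    by (rule esssup_I[OF meas]) (auto simp: AE_restrict_space_iff intro!: AE_I2 ennreal_leI x1(2))
  also have "\<dots> < top" by simp
  finally show fin: "Linfty_norm (ball 0 1) u < top" .
  let ?l = "enn2real (Linfty_norm (ball 0 1) u)"
  have L: "Linfty_norm (ball 0 1) u = ennreal ?l" using fin by simp
  have ae: "AE x in lborel. x \<in> ball 0 1 \<longrightarrow> ennreal \<bar>u x\<bar> \<le> ennreal ?l"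
    using esssup_AE[of "\<lambda>x. ennreal \<bar>u x\<bar>" ?M] unfolding Linfty_norm_def[symmetric] L[symmetric]
    by (simp add: AE_restrict_space_iff)
  define U where "U = {x \<in> ball 0 1. ?l < \<bar>u x\<bar>}"
  have "U = ball 0 1 \<inter> (\<lambda>x. \<bar>u x\<bar>) -` {?l<..}" by (auto simp: U_def)
  then have "open U" using continuous_open_preimage[OF continuous_on_rabs[OF ub] open_ball open_greaterThan] by simp
  moreover have "negligible U"
  proof -
    from ae obtain N' where N': "{x \<in> space lborel. \<not> (x \<in> ball 0 1 \<longrightarrow> ennreal \<bar>u x\<bar> \<le> ennreal ?l)} \<subseteq> N'" "N' \<in> null_sets lborel"
      by (auto elim!: AE_E simp: null_sets_def)
    have "negligible N'" unfolding negligible_iff_null_sets using N'(2) by (rule null_sets_completionI)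
    then show ?thesis by (rule negligible_subset) (use N'(1) in \<open>auto simp: U_def ennreal_le_iff\<close>)
  qed
  ultimately have "U = {}" using open_not_negligible by blast
  then have le: "\<bar>u x\<bar> \<le> ?l" if "x \<in> ball 0 1" for x using that by (force simp: U_def)
  have cl: "closure (ball (0::real^'n) 1) = cball 0 1" by simp
  show "\<bar>u x\<bar> \<le> ?l" if "x \<in> cball 0 1"
    using continuous_le_on_closure[of "ball 0 1" "\<lambda>x. \<bar>u x\<bar>" x ?l] continuous_on_rabs[OF u] that le unfolding cl by blast
qed

lemma ennreal_powr_mono:
  assumes "x \<le> ennreal t" "0 \<le> t" "0 < \<alpha>"
  shows "ennreal_powr x \<alpha> \<le> ennreal (t powr \<alpha>)"
proof -
  have "x \<noteq> top" using assms by (auto simp: top_unique)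
  moreover have "enn2real x \<le> t" using assms by (metis enn2real_ennreal enn2real_mono ennreal_less_top)
  ultimately show ?thesis unfolding ennreal_powr_def using assms by (auto intro!: ennreal_leI powr_mono2)
qed

lemma suminf_ennreal_top_if_ge:
  fixes f :: "nat \<Rightarrow> ennreal"
  assumes c: "0 < c" and f: "\<And>j. ennreal c \<le> f j"
  shows "(\<Sum>j. f j) = top"
proof (rule ccontr)
  assume "(\<Sum>j. f j) \<noteq> top"
  then obtain s where s: "0 \<le> s" "(\<Sum>j. f j) = ennreal s" by (cases "\<Sum>j. f j") auto
  obtain n where n: "s < real n * c" using reals_Archimedean3[OF c] by blast
  have "ennreal (real n * c) = (\<Sum>j<n. ennreal c)" using c by (simp add: ennreal_mult' ennreal_of_nat_eq_real_of_nat)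
  also have "\<dots> \<le> (\<Sum>j<n. f j)" by (intro sum_mono f)
  also have "\<dots> \<le> (\<Sum>j. f j)" by (intro sum_le_suminf) auto
  finally show False using s n c by (simp add: ennreal_le_iff)
qed

text \<open>If j > 0 is the first index with x in \<open>A j\<close>, the term of index j - 1 equals
  \<open>a j powr \<alpha>\<close>. If there is no such index, all terms are at least
  \<open>a 0 powr \<alpha>\<close> and the series is infinite.\<close>

lemma layer_cake_powr_bound:
  fixes a :: "nat \<Rightarrow> real"
  assumes \<alpha>: "0 < \<alpha>" and a: "\<And>j. 0 < a j" "\<And>j. a 0 \<le> a j"
    and A: "\<And>j. x \<in> A j \<Longrightarrow> T \<le> ennreal (a j)" and x: "x \<in> B"
  shows "ennreal_powr T \<alpha> \<le> ennreal (a 0 powr \<alpha>) + (\<Sum>j. ennreal (a (Suc j) powr \<alpha>) * indicator (B - A j) x)"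
proof (cases "\<exists>j. x \<in> A j")
  case False
  have "(\<Sum>j. ennreal (a (Suc j) powr \<alpha>) * indicator (B - A j) x) = top"
  proof (rule suminf_ennreal_top_if_ge[of "a 0 powr \<alpha>"])
    show "ennreal (a 0 powr \<alpha>) \<le> ennreal (a (Suc j) powr \<alpha>) * indicator (B - A j) x" for j
      using False x powr_mono2[of \<alpha> "a 0" "a (Suc j)"] less_imp_le[OF a(1)] a(2) \<alpha> by (simp add: ennreal_leI)
  qed (use a(1)[of 0] in simp)
  then show ?thesis by simp
next
  case True
  define j where "j = (LEAST j. x \<in> A j)"
  have j: "x \<in> A j" unfolding j_def using True by (rule LeastI_ex)
  have T: "ennreal_powr T \<alpha> \<le> ennreal (a j powr \<alpha>)" using A[OF j] a \<alpha> by (intro ennreal_powr_mono) (auto intro: less_imp_le)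
  show ?thesis
  proof (cases j)
    case 0
    then show ?thesis using T by (auto intro: add_increasing2)
  next
    case (Suc i)
    then have "x \<notin> A i" unfolding j_def using not_less_Least[of i "\<lambda>j. x \<in> A j"] by simp
    then have "ennreal (a j powr \<alpha>) = (\<Sum>j\<in>{i}. ennreal (a (Suc j) powr \<alpha>) * indicator (B - A j) x)"
      using Suc x by simp
    also have "\<dots> \<le> (\<Sum>j. ennreal (a (Suc j) powr \<alpha>) * indicator (B - A j) x)"
      by (intro sum_le_suminf) auto
    finally have "ennreal_powr T \<alpha> \<le> (\<Sum>j. ennreal (a (Suc j) powr \<alpha>) * indicator (B - A j) x)"
      by (rule order_trans[OF T])
    then show ?thesis by (rule add_increasing[OF zero_le])
  qed
qed

text \<open>The resulting geometric series has ratio \<open>N powr \<alpha> * q\<close> below 1, and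
  every opening is a multiple of \<open>m\<close>, whence the factor
  \<open>m powr \<alpha>\<close>.\<close>

lemma W2_integral_bound:
  fixes u :: "real^'n \<Rightarrow> real" and m q \<alpha> N D :: real
  assumes u: "continuous_on (cball 0 1) u" and m: "0 < m" and \<alpha>: "0 < \<alpha>" and N: "1 \<le> N" and q: "0 \<le> q" "N powr \<alpha> * q < 1"
    and D: "0 \<le> D" and decay: "\<And>j. measure lebesgue (ball 0 (1 / 2) - contact_set u (64 * m * N ^ j)) \<le> D * q ^ j"
  shows "(\<integral>\<^sup>+x\<in>ball 0 (1/2). ennreal_powr (Theta_lower (ball 0 1) u x) \<alpha> \<partial>lborel)
    \<le> ennreal (64 powr \<alpha> * (unit_ball_vol CARD('n) + N powr \<alpha> * D / (1 - N powr \<alpha> * q)) * m powr \<alpha>)"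
proof -
  let ?B = "ball (0::real^'n) (1 / 2)" and ?\<omega> = "unit_ball_vol CARD('n)"
  define a where "a j = 64 * m * N ^ j" for j
  have a0: "0 < a j" "a 0 \<le> a j" for j using m N by (auto simp: a_def)
  have apow: "a j powr \<alpha> = (64 powr \<alpha> * m powr \<alpha>) * (N powr \<alpha>) ^ j" for j
    using m N by (simp add: a_def powr_mult powr_power powr_realpow[symmetric] powr_powr mult.commute)
  define A where "A j = contact_set u (a j)" for j
  have Ab: "?B - A j \<in> sets lborel" for j using contact_set_borel[OF u] by (simp add: A_def)
  have em: "emeasure lborel (?B - A j) \<le> ennreal (D * q ^ j)" for j
  proof -
    have "emeasure lborel (?B - A j) \<le> emeasure lborel ?B" using Ab by (intro emeasure_mono) auto
    also have "\<dots> < top" using emeasure_lborel_ball_finite[of "0::real^'n" "1/2"] by simp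
    finally have "emeasure lborel (?B - A j) = ennreal (measure lborel (?B - A j))"
      by (intro emeasure_eq_ennreal_measure) auto
    also have "measure lborel (?B - A j) = measure lebesgue (?B - A j)" using Ab by (simp add: measure_completion)
    also have "ennreal \<dots> \<le> ennreal (D * q ^ j)" using decay by (intro ennreal_leI) (simp add: A_def a_def)
    finally show ?thesis .
  qed
  have "(\<integral>\<^sup>+x\<in>?B. ennreal_powr (Theta_lower (ball 0 1) u x) \<alpha> \<partial>lborel)
      \<le> (\<integral>\<^sup>+x. ennreal (a 0 powr \<alpha>) * indicator ?B x + (\<Sum>j. ennreal (a (Suc j) powr \<alpha>) * indicator (?B - A j) x) \<partial>lborel)"
  proof (rule nn_integral_mono)
    fix x :: "real^'n"
    show "ennreal_powr (Theta_lower (ball 0 1) u x) \<alpha> * indicator ?B x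
      \<le> ennreal (a 0 powr \<alpha>) * indicator ?B x + (\<Sum>j. ennreal (a (Suc j) powr \<alpha>) * indicator (?B - A j) x)"
    proof (cases "x \<in> ?B")
      case True
      have "Theta_lower (ball 0 1) u x \<le> ennreal (a j)" if "x \<in> A j" for j
        using contact_set_Theta_le that a0(1) unfolding A_def by blast
      from layer_cake_powr_bound[where a = a and A = A, OF \<alpha> a0 this True] True show ?thesis by simp
    qed simp
  qed
  also have "\<dots> = ennreal (a 0 powr \<alpha>) * emeasure lborel ?B + (\<Sum>j. ennreal (a (Suc j) powr \<alpha>) * emeasure lborel (?B - A j))"
  proof -
    have m: "(\<lambda>x. ennreal (a (Suc j) powr \<alpha>) * indicator (?B - A j) x) \<in> borel_measurable lborel" for j
      by (rule borel_measurable_times_ennreal[OF borel_measurable_const borel_measurable_indicator[OF Ab]])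
    have m0: "(\<lambda>x. ennreal (a 0 powr \<alpha>) * indicator ?B x) \<in> borel_measurable lborel"
      by (rule borel_measurable_times_ennreal[OF borel_measurable_const borel_measurable_indicator]) simp
    have "(\<integral>\<^sup>+x. ennreal (a 0 powr \<alpha>) * indicator ?B x + (\<Sum>j. ennreal (a (Suc j) powr \<alpha>) * indicator (?B - A j) x) \<partial>lborel)
        = (\<integral>\<^sup>+x. ennreal (a 0 powr \<alpha>) * indicator ?B x \<partial>lborel)
          + (\<integral>\<^sup>+x. (\<Sum>j. ennreal (a (Suc j) powr \<alpha>) * indicator (?B - A j) x) \<partial>lborel)"
      by (rule nn_integral_add[OF m0 borel_measurable_suminf_order[OF m]])
    also have "(\<integral>\<^sup>+x. (\<Sum>j. ennreal (a (Suc j) powr \<alpha>) * indicator (?B - A j) x) \<partial>lborel)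
        = (\<Sum>j. \<integral>\<^sup>+x. ennreal (a (Suc j) powr \<alpha>) * indicator (?B - A j) x \<partial>lborel)"
      by (rule nn_integral_suminf[OF m])
    also have "(\<lambda>j. \<integral>\<^sup>+x. ennreal (a (Suc j) powr \<alpha>) * indicator (?B - A j) x \<partial>lborel)
        = (\<lambda>j. ennreal (a (Suc j) powr \<alpha>) * emeasure lborel (?B - A j))"
      by (intro ext nn_integral_cmult_indicator Ab)
    also have "(\<integral>\<^sup>+x. ennreal (a 0 powr \<alpha>) * indicator ?B x \<partial>lborel) = ennreal (a 0 powr \<alpha>) * emeasure lborel ?B"
      by (intro nn_integral_cmult_indicator) simp
    finally show ?thesis .
  qed
  also have "\<dots> \<le> ennreal (a 0 powr \<alpha> * ?\<omega>) + (\<Sum>j. ennreal (a (Suc j) powr \<alpha> * (D * q ^ j)))"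
  proof (intro add_mono suminf_le)
    have "emeasure lborel ?B = ennreal (?\<omega> * (1 / 2) ^ CARD('n))" using emeasure_ball[of "1/2" "0::real^'n"] by simp
    also have "\<dots> \<le> ennreal (?\<omega> * 1)" by (intro ennreal_leI mult_left_mono power_le_one) auto
    finally have "ennreal (a 0 powr \<alpha>) * emeasure lborel ?B \<le> ennreal (a 0 powr \<alpha>) * ennreal ?\<omega>"
      by (intro mult_left_mono) auto
    then show "ennreal (a 0 powr \<alpha>) * emeasure lborel ?B \<le> ennreal (a 0 powr \<alpha> * ?\<omega>)" by (simp add: ennreal_mult)
    show "ennreal (a (Suc j) powr \<alpha>) * emeasure lborel (?B - A j) \<le> ennreal (a (Suc j) powr \<alpha> * (D * q ^ j))" for j
      using mult_left_mono[OF em[of j], of "ennreal (a (Suc j) powr \<alpha>)"] D q by (simp add: ennreal_mult)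
  qed auto
  also have "(\<Sum>j. ennreal (a (Suc j) powr \<alpha> * (D * q ^ j))) = ennreal ((64 powr \<alpha> * m powr \<alpha>) * (N powr \<alpha> * D / (1 - N powr \<alpha> * q)))"
  proof (rule suminf_ennreal_eq)
    show "0 \<le> a (Suc j) powr \<alpha> * (D * q ^ j)" for j using D q by simp
    have "(\<lambda>j. (N powr \<alpha> * q) ^ j) sums (1 / (1 - N powr \<alpha> * q))"
      using q by (intro geometric_sums) auto
    from sums_mult[OF this, of "(64 powr \<alpha> * m powr \<alpha>) * (N powr \<alpha> * D)"]
    show "(\<lambda>j. a (Suc j) powr \<alpha> * (D * q ^ j)) sums ((64 powr \<alpha> * m powr \<alpha>) * (N powr \<alpha> * D / (1 - N powr \<alpha> * q)))"
      by (simp add: apow power_mult_distrib mult_ac)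
  qed
  also have "ennreal (a 0 powr \<alpha> * ?\<omega>) + \<dots> = ennreal (64 powr \<alpha> * (?\<omega> + N powr \<alpha> * D / (1 - N powr \<alpha> * q)) * m powr \<alpha>)"
    using D q by (subst ennreal_plus[symmetric]) (auto simp: apow algebra_simps)
  finally show ?thesis .
qed

text \<open>The openings 64 m n^j degenerate for m = 0, so this case is separate: paraboloids of
  every positive opening touch the zero function.\<close>

lemma W2_estimate_zero:
  fixes u :: "real^'n \<Rightarrow> real"
  assumes u: "\<And>x. x \<in> ball 0 1 \<Longrightarrow> u x = 0" and \<alpha>: "0 < \<alpha>"
  shows "W2_estimate C \<alpha> u"
proof -
  have T: "Theta_lower (ball 0 1) u x = 0" if x: "x \<in> ball 0 1" for x
  proof -
    have "Theta_lower (ball 0 1) u x \<le> ennreal A" if A: "0 < A" for A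
    proof -
      have "\<forall>x'\<in>ball 0 1. u x' \<ge> u x + 0 \<bullet> (x' - x) - A / 2 * (norm (x' - x))\<^sup>2" using u x A by simp
      then show ?thesis unfolding Theta_lower_def using A by (intro Inf_lower) blast
    qed
    then have "Theta_lower (ball 0 1) u x \<le> 0 + ennreal A" if "0 < A" for A using that by simp
    then have "Theta_lower (ball 0 1) u x \<le> 0" by (rule ennreal_le_epsilon)
    then show ?thesis by simp
  qed
  have "(\<integral>\<^sup>+x\<in>ball 0 (1/2). ennreal_powr (Theta_lower (ball 0 1) u x) \<alpha> \<partial>lborel) = (\<integral>\<^sup>+(x::real^'n). 0 \<partial>lborel)"
    by (rule nn_integral_cong) (auto simp: T ennreal_powr_def split: split_indicator)
  then show ?thesis by (simp add: W2_estimate_def)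
qed

section \<open>Elementary bounds for the two exponents\<close>

lemma alpha_bound_le:
  fixes lam Lam :: real
  assumes n: "3 \<le> n" and lam: "0 < lam" "lam \<le> Lam" and k: "1 \<le> k" "real k < real n / 2"
  shows "alpha_bound n lam Lam k \<le> ((2 - lam / Lam) / (Lam / lam)) ^ (n - k) / (4 * ln (real n))"
proof -
  have kn: "k < n" using k by linarith
  have lnn: "0 < ln (real n)" using n by simp
  have r: "0 \<le> 1 - lam / Lam" using lam by simp
  let ?x = "(real n - 2 * real k) / (real n - real k)"
  have x: "0 \<le> ?x" "?x \<le> 1" using k by (auto simp: field_simps)
  \<comment> \<open>\<open>y\<close> is at most 1 - \<lambda>/\<Lambda>, which turns the numerator
    into the power of 2 - \<lambda>/\<Lambda> from the eigenvalue bound.\<close>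
  define y where "y = ?x * (1 - lam / Lam)"
  have "0 \<le> y" "y \<le> 1 - lam / Lam"
    unfolding y_def using mult_nonneg_nonneg[OF x(1) r] mult_right_mono[OF x(2) r] by (simp_all only: mult_1)
  then have "(1 + y) ^ (n - k) \<le> (2 - lam / Lam) ^ (n - k)"
    by (intro power_mono) linarith+
  moreover have "(Lam / lam) powi (int k - int n) = 1 / (Lam / lam) ^ (n - k)"
  proof -
    have "int k - int n = - int (n - k)" using kn by simp
    then show ?thesis by (simp only: power_int_minus power_int_of_nat inverse_eq_divide)
  qed
  moreover have "ln (real n ^ 4) = 4 * ln (real n)" using n by (simp add: ln_realpow)
  ultimately have "alpha_bound n lam Lam k = (1 + y) ^ (n - k) * (1 / (Lam / lam) ^ (n - k) / (4 * ln (real n)))"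
    by (simp add: alpha_bound_def y_def)
  also have "\<dots> \<le> (2 - lam / Lam) ^ (n - k) * (1 / (Lam / lam) ^ (n - k) / (4 * ln (real n)))"
    using \<open>(1 + y) ^ (n - k) \<le> _\<close> lam lnn by (intro mult_right_mono) auto
  finally show ?thesis by (simp add: power_divide power_mult_distrib)
qed

text \<open>Equality holds for n = 2. Bernoulli's inequality with the full exponent only gives 0;
  applied with half of it, it gives at least 1/2, and the result is squared. Odd n leave one extra
  factor.\<close>

lemma one_minus_inverse_power_ge:
  assumes "2 \<le> n"
  shows "1 / 4 \<le> (1 - 1 / real n) ^ n"
proof -
  define h where "h = n div 2"
  define x where "x = 1 - 1 / real n"
  have x: "0 \<le> x" using assms by (simp add: x_def)
  have "1 + real h * (- 1 / real n) \<le> (1 + - 1 / real n) ^ h"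
  proof (rule Bernoulli_inequality)
    have "1 / real n \<le> 1" using assms by simp
    then show "- 1 \<le> - 1 / real n" by linarith
  qed
  then have xh: "1 - real h / real n \<le> x ^ h" by (simp add: x_def)
  have h1: "1 \<le> real h" using assms by (simp add: h_def)
  have "1 / 4 \<le> x ^ n"
  proof (cases "even n")
    case True
    then have n: "n = 2 * h" by (simp add: h_def)
    then have "1 / 2 \<le> x ^ h" using xh h1 by (simp add: field_simps)
    then have "(1 / 2)\<^sup>2 \<le> (x ^ h)\<^sup>2" by (intro power_mono) auto
    also have "(x ^ h)\<^sup>2 = x ^ n" by (simp add: n mult.commute[of 2] power_mult)
    finally show ?thesis by (simp add: power2_eq_square)
  next
    case False
    then have n: "n = 2 * h + 1" by (simp add: h_def)
    have "1 - real h / real n = (real h + 1) / (2 * real h + 1)" using h1 by (simp add: n field_simps)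
    then have "((real h + 1) / (2 * real h + 1))\<^sup>2 \<le> (x ^ h)\<^sup>2" using xh h1 by (intro power_mono) auto
    moreover have xeq: "x = 2 * real h / (2 * real h + 1)" using h1 by (simp add: x_def n field_simps)
    ultimately have "((real h + 1) / (2 * real h + 1))\<^sup>2 * (2 * real h / (2 * real h + 1)) \<le> (x ^ h)\<^sup>2 * x"
      using x by (intro mult_mono) auto
    also have "(x ^ h)\<^sup>2 * x = x ^ n" unfolding n by (simp add: power_mult[symmetric] mult.commute)
    finally have 1: "(real h + 1)\<^sup>2 * (2 * real h) / (2 * real h + 1) ^ 3 \<le> x ^ n"
      by (simp add: power_divide power3_eq_cube power2_eq_square)
    \<comment> \<open>After expansion the sides differ by 4 h^2 + 2 h - 1.\<close>
    have "(2 * real h + 1) ^ 3 \<le> 4 * ((real h + 1)\<^sup>2 * (2 * real h))"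
    proof -
      have "1 * 1 \<le> real h * real h" using h1 by (intro mult_mono) auto
      then show ?thesis using h1 by (simp add: power3_eq_cube power2_eq_square algebra_simps)
    qed
    moreover have "0 < (2 * real h + 1) ^ 3" using h1 by simp
    ultimately have "1 / 4 \<le> (real h + 1)\<^sup>2 * (2 * real h) / (2 * real h + 1) ^ 3"
      by (simp only: pos_le_divide_eq)
    then show ?thesis using 1 by (rule order_trans)
  qed
  then show ?thesis by (simp add: x_def)
qed

text \<open>The lower bound is the entry i = 1, by (1 + b/(n-1))^(n-1) \<le> exp b with b =
  \<Lambda>/\<lambda> - 1. It does not depend on n.\<close>

lemma c_const_bounds:
  fixes lam Lam :: real
  assumes lam: "0 < lam" "lam < Lam" and k: "1 \<le> k" and n: "2 * k < n"
  shows "c_const n lam Lam k \<le> 1" "exp (- (Lam / lam - 1)) \<le> c_const n lam Lam k"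
proof -
  define b where "b = Lam / lam - 1"
  have b: "0 < b" using lam by (simp add: b_def)
  let ?f = "\<lambda>i::nat. (1 + b * (real i / (real n - real i))) powi (int i - int n)"
  have f: "?f i = 1 / (1 + b * (real i / (real n - real i))) ^ (n - i)" if "i \<le> k" for i
  proof -
    have "int i - int n = - int (n - i)" using that n by simp
    then show ?thesis by (simp only: power_int_minus power_int_of_nat inverse_eq_divide)
  qed
  have c: "c_const n lam Lam k = Max (?f ` {1..k})" by (simp add: c_const_def b_def)
  show "c_const n lam Lam k \<le> 1"
    unfolding c
  proof (rule Max.boundedI)
    fix y assume "y \<in> ?f ` {1..k}"
    then obtain i where i: "i \<in> {1..k}" "y = ?f i" by auto
    have "1 \<le> (1 + b * (real i / (real n - real i))) ^ (n - i)"
      using b i n by (intro one_le_power) auto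
    then show "y \<le> 1" using f[of i] i by (simp add: divide_le_eq_1)
  qed (use k in auto)
  have "(1 + b / (real n - 1)) ^ (n - 1) \<le> exp (b / (real n - 1)) ^ (n - 1)"
    using b n k exp_ge_add_one_self[of "b / (real n - 1)"] by (intro power_mono) auto
  also have "\<dots> = exp (real (n - 1) * (b / (real n - 1)))" by (rule exp_of_nat_mult[symmetric])
  also have "\<dots> = exp b" using n k by (simp add: of_nat_diff)
  finally have "1 / exp b \<le> 1 / (1 + b / (real n - 1)) ^ (n - 1)"
    using b n k by (intro divide_left_mono mult_pos_pos zero_less_power) (auto intro!: add_pos_nonneg)
  then have "exp (- b) \<le> ?f 1" using f[of 1] k by (simp add: exp_minus inverse_eq_divide)
  also have "?f 1 \<le> Max (?f ` {1..k})" using k by (intro Max_ge finite_imageI imageI) auto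
  finally show "exp (- (Lam / lam - 1)) \<le> c_const n lam Lam k" by (simp add: c b_def)
qed

text \<open>The supremum is tested at \<gamma> = 1 - 1/n, where the denominator is -ln n and the
  numerator at most -c \<gamma>^n \<le> -c/4.\<close>

lemma eps_ge:
  fixes lam Lam :: real
  assumes lam: "0 < lam" "lam < Lam" and k: "1 \<le> k" and n: "2 * k < n"
  shows "exp (- (Lam / lam - 1)) / (4 * ln (real n)) \<le> eps n lam Lam k"
proof -
  define c where "c = c_const n lam Lam k"
  have c: "0 < c" "c \<le> 1" "exp (- (Lam / lam - 1)) \<le> c"
    using c_const_bounds[OF lam k n] exp_gt_zero[of "- (Lam / lam - 1)"] unfolding c_def by linarith+
  have n2: "2 \<le> n" using n k by simp
  let ?q = "\<lambda>\<gamma>. ln (1 - c * \<gamma> ^ n) / ln (1 - \<gamma>)"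
  \<comment> \<open>Boundedness, without which a real supremum could not be estimated from below by
    one of its members.\<close>
  have le1: "?q \<gamma> \<le> 1" if \<gamma>: "\<gamma> \<in> {0<..<1}" for \<gamma> :: real
  proof -
    have "\<gamma> ^ n \<le> \<gamma> ^ 1" using \<gamma> n2 by (intro power_decreasing) auto
    then have "c * \<gamma> ^ n \<le> 1 * \<gamma>" using c \<gamma> by (intro mult_mono) auto
    then have "ln (1 - \<gamma>) \<le> ln (1 - c * \<gamma> ^ n)" using \<gamma> by simp
    moreover have "ln (1 - \<gamma>) < 0" using \<gamma> by simp
    ultimately show ?thesis by (simp add: divide_le_eq)
  qed
  define g where "g = 1 - 1 / real n"
  have g: "g \<in> {0<..<1}" using n2 by (simp add: g_def)
  have "?q g \<le> eps n lam Lam k"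
    unfolding eps_def c_def[symmetric] using le1 g
    by (intro cSUP_upper) (auto intro!: bdd_aboveI[of _ 1])
  moreover have "exp (- (Lam / lam - 1)) / (4 * ln (real n)) \<le> ?q g"
  proof -
    have lnn: "0 < ln (real n)" using n2 by simp
    have lng: "ln (1 - g) = - ln (real n)" using n2 by (simp add: g_def ln_div)
    have "g ^ n < 1" using g n2 by (intro power_less_one_iff[THEN iffD2]) auto
    moreover have "c * g ^ n \<le> 1 * g ^ n" using c g by (intro mult_right_mono zero_le_power) auto
    ultimately have cg: "c * g ^ n < 1" by linarith
    then have "ln (1 - c * g ^ n) \<le> - (c * g ^ n)" using ln_le_minus_one[of "1 - c * g ^ n"] by simp
    moreover have "exp (- (Lam / lam - 1)) * (1 / 4) \<le> c * g ^ n"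
      using c one_minus_inverse_power_ge[OF n2] by (intro mult_mono) (auto simp: g_def)
    ultimately have "exp (- (Lam / lam - 1)) / 4 \<le> - ln (1 - c * g ^ n)" by simp
    then show ?thesis unfolding lng using lnn by (simp add: field_simps)
  qed
  ultimately show ?thesis by linarith
qed

text \<open>By ln n \<le> n the ratio is eventually at least K b^n / n with b = \<Lambda>/\<lambda>
  > 1.\<close>

lemma eps_ratio_tendsto_infinity:
  fixes lam Lam :: real
  assumes lam: "0 < lam" "lam < Lam" and k: "1 \<le> k"
  shows "filterlim (\<lambda>n. eps n lam Lam k / (Lam / lam) powi (int k - int n)) at_top sequentially"
proof -
  define b where "b = Lam / lam"
  have b: "1 < b" using lam by (simp add: b_def)
  define K where "K = exp (- (b - 1)) / (4 * b ^ k)"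
  have K: "0 < K" using b by (simp add: K_def)
  have "(\<lambda>n. real n / b ^ n) \<longlonglongrightarrow> 0" using b by (intro lim_n_over_pown) auto
  then have "filterlim (\<lambda>n. inverse (real n / b ^ n)) at_top sequentially"
    by (rule filterlim_inverse_at_top) (use b in \<open>auto intro!: eventually_sequentiallyI[of 1]\<close>)
  then have "filterlim (\<lambda>n. K * inverse (real n / b ^ n)) at_top sequentially"
    by (intro filterlim_tendsto_pos_mult_at_top[OF tendsto_const K])
  moreover have "\<forall>\<^sub>F n in sequentially. K * inverse (real n / b ^ n) \<le> eps n lam Lam k / b powi (int k - int n)"
  proof (rule eventually_sequentiallyI[of "2 * k + 1"])
    fix n assume "2 * k + 1 \<le> n"
    then have n: "2 * k < n" by simp
    have n2: "2 \<le> n" using n k by simp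
    have lnn: "0 < ln (real n)" using n2 by simp
    have "ln (real n) \<le> real n" using n2 ln_le_minus_one[of "real n"] by simp
    have p: "b powi (int k - int n) = b ^ k / b ^ n" using b by (simp add: power_int_diff)
    have "K * inverse (real n / b ^ n) = exp (- (b - 1)) / (4 * real n) / (b ^ k / b ^ n)"
      using b by (simp add: K_def field_simps)
    also have "\<dots> \<le> exp (- (b - 1)) / (4 * ln (real n)) / (b ^ k / b ^ n)"
      using b lnn \<open>ln (real n) \<le> real n\<close> by (intro divide_right_mono divide_left_mono) auto
    also have "\<dots> \<le> eps n lam Lam k / (b ^ k / b ^ n)"
      using eps_ge[OF lam k n] b unfolding b_def[symmetric] by (intro divide_right_mono) auto
    finally show "K * inverse (real n / b ^ n) \<le> eps n lam Lam k / b powi (int k - int n)" unfolding p .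
  qed
  ultimately show ?thesis unfolding b_def[symmetric] by (rule filterlim_at_top_mono)
qed

text \<open>The constant is fixed before \<open>u\<close>. The bound on \<alpha> leaves room for a
  rate q above 1 - \<theta> and 1 / sqrt n, so that the complement decays, and below n^(-\<alpha>),
  so that the series converges.\<close>

lemma W2_estimate_uniform:
  fixes lam Lam \<alpha> :: real
  assumes n: "3 \<le> CARD('n::finite)" and lam: "0 < lam" "lam \<le> Lam" and k: "1 \<le> k" "real k < real CARD('n) / 2"
    and \<alpha>: "0 < \<alpha>" "\<alpha> < alpha_bound CARD('n) lam Lam k"
  shows "\<exists>C\<ge>0. \<forall>u::real^'n \<Rightarrow> real. continuous_on (cball 0 1) u \<and> viscosity_pucci_minus_le_0 lam Lam (ball 0 1) u
      \<and> viscosity_nonpos_eigenvalues_ge (ball 0 1) u k \<longrightarrow> W2_estimate C \<alpha> u"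
proof -
  let ?n = "real CARD('n)" and ?\<omega> = "unit_ball_vol CARD('n)"
  define c where "c = ((2 - lam / Lam) / (Lam / lam)) ^ (CARD('n) - k)"
  define \<theta> where "\<theta> = (1 - 1 / ?n) ^ CARD('n) * c"
  have n1: "1 < ?n" "2 \<le> CARD('n)" using n by auto
  have kn: "k \<le> CARD('n)" using k by linarith
  have r: "0 < lam / Lam" "lam / Lam \<le> 1" using lam by auto
  have base: "0 < (2 - lam / Lam) / (Lam / lam)" "(2 - lam / Lam) / (Lam / lam) \<le> 1"
  proof -
    have "0 < 2 - lam / Lam" using r(2) by linarith
    then show "0 < (2 - lam / Lam) / (Lam / lam)" using lam by (intro divide_pos_pos) auto
    have "(2 - lam / Lam) / (Lam / lam) = (2 - lam / Lam) * (lam / Lam)" by simp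
    also have "\<dots> = 1 - (1 - lam / Lam)\<^sup>2" by (simp only: power2_eq_square) (simp add: algebra_simps)
    also have "\<dots> \<le> 1" by simp
    finally show "(2 - lam / Lam) / (Lam / lam) \<le> 1" .
  qed
  have c: "0 < c" "c \<le> 1" using base by (auto simp: c_def intro: power_le_one)
  have quarter: "1 / 4 \<le> (1 - 1 / ?n) ^ CARD('n)" using n1 by (intro one_minus_inverse_power_ge)
  have p1: "(1 - 1 / ?n) ^ CARD('n) \<le> 1" using n1 by (intro power_le_one) auto
  have \<theta>: "c / 4 \<le> \<theta>" "\<theta> \<le> 1" "0 < \<theta>"
  proof -
    show "c / 4 \<le> \<theta>" unfolding \<theta>_def using mult_right_mono[OF quarter less_imp_le[OF c(1)]] by simp
    then show "0 < \<theta>" using c by simp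
    show "\<theta> \<le> 1" unfolding \<theta>_def using p1 c quarter by (intro mult_le_one) auto
  qed
  have "1 \<le> ln ?n"
  proof -
    have "exp 1 \<le> (3::real)" by (rule exp_le)
    then have "exp 1 \<le> ?n" using n by linarith
    then show ?thesis using n1 ln_ge_iff[of ?n 1] by simp
  qed
  have "\<alpha> < c / (4 * ln ?n)" using \<alpha> alpha_bound_le[OF n lam k] by (simp add: c_def)
  moreover have "0 < 4 * ln ?n" using \<open>1 \<le> ln ?n\<close> by linarith
  ultimately have "\<alpha> * (4 * ln ?n) < c" by (simp only: pos_less_divide_eq)
  then have \<alpha>c: "\<alpha> * ln ?n < c / 4" by simp
  define N where "N = ?n powr \<alpha>"
  have N: "0 < N" using n1 by (simp add: N_def)
  \<comment> \<open>From \<alpha> ln n < c/4 \<le> \<theta> and 1 - t \<le> exp (-t) with t =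
    \<alpha> ln n.\<close>
  have "1 - \<theta> < 1 / N"
  proof -
    have "1 - \<theta> \<le> 1 + - (c / 4)" using \<theta> by simp
    also have "\<dots> < 1 + - (\<alpha> * ln ?n)" using \<alpha>c by simp
    also have "\<dots> \<le> exp (- (\<alpha> * ln ?n))" by (rule exp_ge_add_one_self)
    also have "\<dots> = 1 / N" using n1 by (simp add: N_def powr_def exp_minus inverse_eq_divide)
    finally show ?thesis .
  qed
  \<comment> \<open>n \<ge> 3 gives ln n \<ge> 1, hence \<alpha> < c/4 \<le> 1/4: the boundary layer
    decays fast enough.\<close>
  moreover have "1 / sqrt ?n < 1 / N"
  proof -
    have "\<alpha> * 1 \<le> \<alpha> * ln ?n" using \<alpha>(1) \<open>1 \<le> ln ?n\<close> by (intro mult_left_mono) auto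
    then have "\<alpha> < 1 / 2" using \<alpha>c c by simp
    then have "?n powr \<alpha> < ?n powr (1 / 2)" using n1 by (intro powr_less_mono) auto
    then show ?thesis using n1 by (simp add: N_def powr_half_sqrt divide_strict_left_mono)
  qed
  ultimately obtain q where q: "max (1 - \<theta>) (1 / sqrt ?n) < q" "q < 1 / N" using dense[of "max (1 - \<theta>) (1 / sqrt ?n)" "1 / N"] by auto
  have q0: "0 \<le> q" "1 - \<theta> < q" "1 / sqrt ?n \<le> q" "N * q < 1"
  proof -
    show "1 - \<theta> < q" using q(1) by simp
    then show "0 \<le> q" using \<theta> by simp
    show "1 / sqrt ?n \<le> q" using q(1) by simp
    show "N * q < 1" using q(2) N by (simp add: field_simps)
  qed
  define D where "D = ?\<omega> + \<theta> * (?\<omega> * ?n) / (q - (1 - \<theta>))"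
  have D: "0 \<le> D" unfolding D_def using \<theta> q0 n1 by (intro add_nonneg_nonneg divide_nonneg_nonneg mult_nonneg_nonneg) auto
  define C where "C = 64 powr \<alpha> * (?\<omega> + N * D / (1 - N * q))"
  have C: "0 \<le> C" unfolding C_def using D N q0 by (intro mult_nonneg_nonneg add_nonneg_nonneg divide_nonneg_nonneg) auto
  have "W2_estimate C \<alpha> u" if u: "continuous_on (cball 0 1) u" and visc: "viscosity_pucci_minus_le_0 lam Lam (ball 0 1) u"
    and num: "viscosity_nonpos_eigenvalues_ge (ball 0 1) u k" for u :: "real^'n \<Rightarrow> real"
  proof -
    define m where "m = enn2real (Linfty_norm (ball 0 1) u)"
    have um: "\<And>x. x \<in> cball 0 1 \<Longrightarrow> \<bar>u x\<bar> \<le> m" unfolding m_def by (rule Linfty_norm_finite(2)[OF u])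
    have m0: "0 \<le> m" by (simp add: m_def)
    show ?thesis
    proof (cases "m = 0")
      case True
      then have "u x = 0" if "x \<in> ball 0 1" for x using um[of x] that by auto
      then show ?thesis by (intro W2_estimate_zero \<alpha>)
    next
      case False
      with m0 have m: "0 < m" by simp
      have decay: "measure lebesgue (ball 0 (1 / 2) - contact_set u (64 * m * ?n ^ j)) \<le> D * q ^ j" for j
        unfolding D_def \<theta>_def c_def
        by (rule contact_complement_decay[OF n1(2) u um visc num lam kn m])
           (use q0 \<theta> in \<open>simp_all add: \<theta>_def c_def\<close>)
      have "(\<integral>\<^sup>+x\<in>ball 0 (1/2). ennreal_powr (Theta_lower (ball 0 1) u x) \<alpha> \<partial>lborel) \<le> ennreal (C * m powr \<alpha>)"
        unfolding C_def N_def
        by (rule W2_integral_bound[OF u m \<alpha>(1) _ q0(1) _ D decay]) (use n1 q0 N_def in auto)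
      also have "\<dots> = ennreal C * ennreal_powr (Linfty_norm (ball 0 1) u) \<alpha>"
        using Linfty_norm_finite(1)[OF u] C by (simp add: ennreal_powr_def m_def ennreal_mult)
      finally show ?thesis unfolding W2_estimate_def .
    qed
  qed
  with C show ?thesis by blast
qed

theorem theorem3:
  shows "(\<forall>(lam::real) (Lam::real) (k::nat) (\<alpha>::real).
            CARD('n::finite) \<ge> 3 \<and> 0 < lam \<and> lam \<le> Lam \<and> 1 \<le> k \<and> real k < real CARD('n) / 2
            \<and> 0 < \<alpha> \<and> \<alpha> < alpha_bound CARD('n) lam Lam k
            \<longrightarrow> (\<exists>C\<ge>0. \<forall>u::real^'n \<Rightarrow> real.
                   continuous_on (cball 0 1) u
                   \<and> viscosity_pucci_minus_le_0 lam Lam (ball 0 1) u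
                   \<and> is_min_num_nonpos_eigenvalues (ball 0 1) u k
                   \<longrightarrow> W2_estimate C \<alpha> u))
       \<and> (\<forall>(lam::real) (Lam::real) (k::nat).
            0 < lam \<and> lam < Lam \<and> 1 \<le> k
            \<longrightarrow> filterlim (\<lambda>n. eps n lam Lam k / (Lam / lam) powi (int k - int n)) at_top sequentially)"
proof (intro conjI allI impI)
  fix lam Lam \<alpha> :: real and k :: nat
  assume *: "CARD('n) \<ge> 3 \<and> 0 < lam \<and> lam \<le> Lam \<and> 1 \<le> k \<and> real k < real CARD('n) / 2
            \<and> 0 < \<alpha> \<and> \<alpha> < alpha_bound CARD('n) lam Lam k"
  then obtain C where "0 \<le> C" "\<forall>u::real^'n \<Rightarrow> real. continuous_on (cball 0 1) u \<and> viscosity_pucci_minus_le_0 lam Lam (ball 0 1) u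
      \<and> viscosity_nonpos_eigenvalues_ge (ball 0 1) u k \<longrightarrow> W2_estimate C \<alpha> u"
    using W2_estimate_uniform[where 'n = 'n, of lam Lam k \<alpha>] by blast
  then show "\<exists>C\<ge>0. \<forall>u::real^'n \<Rightarrow> real.
                   continuous_on (cball 0 1) u
                   \<and> viscosity_pucci_minus_le_0 lam Lam (ball 0 1) u
                   \<and> is_min_num_nonpos_eigenvalues (ball 0 1) u k
                   \<longrightarrow> W2_estimate C \<alpha> u"
    unfolding is_min_num_nonpos_eigenvalues_def by (intro exI[of _ C]) blast
next
  fix lam Lam :: real and k :: nat
  assume "0 < lam \<and> lam < Lam \<and> 1 \<le> k"
  then show "filterlim (\<lambda>n. eps n lam Lam k / (Lam / lam) powi (int k - int n)) at_top sequentially"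
    by (intro eps_ratio_tendsto_infinity) auto
qed

end
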